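(* Let $(F^0,G^0)$ be the pair of universal Lie series proposed by Kashiwara and Vergne as a solution of their 1978 conjecture for solvable Lie algebras (the "solvable solution", defined explicitly in the context). This pair does not satisfy the Kashiwara--Vergne trace identity in degree $8$ for general Lie algebras. That is, there exist a finite-dimensional real Lie algebra $\mathfrak{g}$ and elements $X,Y\in\mathfrak{g}$ such that the homogeneous components of total degree $8$ in $(X,Y)$ of the two expressions $$\mathrm{tr}_{\mathfrak{g}}\left(\mathrm{ad}\,X\circ \partial_X F^0+\mathrm{ad}\,Y\circ \partial_Y G^0\right)$$ and $$\frac{1}{2}\,\mathrm{tr}_{\mathfrak{g}}\left( \frac{\mathrm{ad}\,X}{e^{\mathrm{ad}\,X}-1}+\frac{\mathrm{ad}\,Y}{e^{\mathrm{ad}\,Y}-1} -\frac{\mathrm{ad}\,Z(X,Y)}{e^{\mathrm{ad}\,Z(X,Y)}-1}-1\right)$$ take different values at $(X,Y)$.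
   Context: Let $\mathfrak{g}$ be a finite-dimensional real Lie algebra. $Z(X,Y)=X+Y+\frac12[X,Y]+\cdots$ denotes the Campbell--Hausdorff series, i.e. $\exp(X)\exp(Y)=\exp(Z(X,Y))$ in the connected simply connected Lie group of $\mathfrak{g}$, for $X,Y$ near $0$ (it is also a universal formal Lie series in $X,Y$). For $z$ near $0$ let $$\psi(z)=\frac{e^z-1-z}{(e^z-1)(1-e^{-z})}$$ (an analytic function near $0$). With $Z(t)=Z(tX,tY)$, set $$F^1(X,Y)=\left(\int_0^1 \frac{1-e^{-t\,\mathrm{ad}\,X}}{1-e^{-\mathrm{ad}\,X}}\circ\psi(\mathrm{ad}\,Z(t))\,dt\right)(X+Y),$$ $$F^0(X,Y)=\frac12\left(F^1(X,Y)+e^{\mathrm{ad}\,X}F^1(-X,-Y)\right)+\frac14\left(Z(X,Y)-X\right),\qquad G^0(X,Y)=F^0(-Y,-X).$$ These are universal Lie series in $X,Y$ with no constant term. For a Lie series $F$, $\partial_X F$ (at $(X,Y)$) is the endomorphism $U\mapsto \frac{d}{ds}F(X+sU,Y)\big|_{s=0}$ of $\mathfrak{g}$, and $\partial_Y F$ is the endomorphism $U\mapsto \frac{d}{ds}F(X,Y+sU)\big|_{s=0}$. $\mathrm{tr}_{\mathfrak{g}}$ is the trace of endomorphisms of $\mathfrak{g}$, $1$ inside the trace is the identity of $\mathfrak{g}$, and $\frac{\mathrm{ad}\,X}{e^{\mathrm{ad}\,X}-1}$ is the power series $\frac{z}{e^z-1}$ evaluated at $\mathrm{ad}\,X$. The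 homogeneous component of total degree $8$ of an analytic expression $E(X,Y)$ is the coefficient of $s^8$ in the Taylor expansion at $s=0$ of $E(sX,sY)$; it is a polynomial function on $\mathfrak{g}\times\mathfrak{g}$, defined for all $X,Y$. The Kashiwara--Vergne conjecture asks for Lie series $(F,G)$ satisfying (i) $X+Y-\log(\exp(Y)\exp(X))=(1-e^{-\mathrm{ad}\,X})F(X,Y)+(e^{\mathrm{ad}\,Y}-1)G(X,Y)$ and (ii) the trace identity, namely the equality of the two displayed trace expressions with $(F,G)$ in place of $(F^0,G^0)$. *)

theory Defs
  imports "HOL-Analysis.Analysis"
begin

(* A Lie algebra is a finite-dimensional subspace L of an ambient real vector space with a
   bracket that is constrained only on L. In the ambient Banach space of bounded sequences
   (nat \<Rightarrow>\<^sub>C real) every finite-dimensional real Lie algebra is realised up to isomorphism;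
   the ambient norm induces the usual topology on L. *)
locale fd_lie_algebra =
  fixes L :: "'a::real_vector set" and br :: "'a \<Rightarrow> 'a \<Rightarrow> 'a"
  assumes subspace: "subspace L"
    and fin_dim: "\<exists>B. finite B \<and> span B = L"
    and closed: "x \<in> L \<Longrightarrow> y \<in> L \<Longrightarrow> br x y \<in> L"
    and add_left: "x \<in> L \<Longrightarrow> y \<in> L \<Longrightarrow> z \<in> L \<Longrightarrow> br (x + y) z = br x z + br y z"
    and add_right: "x \<in> L \<Longrightarrow> y \<in> L \<Longrightarrow> z \<in> L \<Longrightarrow> br x (y + z) = br x y + br x z"
    and scale_left: "x \<in> L \<Longrightarrow> y \<in> L \<Longrightarrow> br (c *\<^sub>R x) y = c *\<^sub>R br x y"
    and scale_right: "x \<in> L \<Longrightarrow> y \<in> L \<Longrightarrow> br x (c *\<^sub>R y) = c *\<^sub>R br x y"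
    and alternating: "x \<in> L \<Longrightarrow> br x x = 0"
    and jacobi: "x \<in> L \<Longrightarrow> y \<in> L \<Longrightarrow> z \<in> L \<Longrightarrow>
      br x (br y z) + br y (br z x) + br z (br x y) = 0"

definition trace_on :: "'a::real_vector set \<Rightarrow> ('a \<Rightarrow> 'a) \<Rightarrow> real" where
  "trace_on L A = (let B = (SOME B. independent B \<and> span B = L)
                   in \<Sum>b\<in>B. representation B (A b) b)"

lemma trace_basis_change:
  fixes A :: "'a::real_vector \<Rightarrow> 'a"
  assumes B: "independent B" "finite B" "span B = L"
    and C: "independent C" "finite C" "span C = L"
    and add: "\<And>x y. x \<in> L \<Longrightarrow> y \<in> L \<Longrightarrow> A (x + y) = A x + A y"
    and scale: "\<And>c x. x \<in> L \<Longrightarrow> A (c *\<^sub>R x) = c *\<^sub>R A x"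
    and closed: "\<And>x. x \<in> L \<Longrightarrow> A x \<in> L"
  shows "(\<Sum>b\<in>B. representation B (A b) b) = (\<Sum>c\<in>C. representation C (A c) c)"
proof -
  have L: "subspace L" using B(3) subspace_span by metis
  have A_sum: "A (\<Sum>i\<in>I. g i *\<^sub>R i) = (\<Sum>i\<in>I. g i *\<^sub>R A i)"
    if "finite I" "I \<subseteq> L" for g :: "'a \<Rightarrow> real" and I
    using that
  proof (induction I rule: finite_induct)
    case empty
    have "A (0 *\<^sub>R 0) = 0 *\<^sub>R A 0" using L by (intro scale) (simp add: subspace_0)
    then show ?case by simp
  next
    case (insert i I)
    have "(\<Sum>i\<in>I. g i *\<^sub>R i) \<in> L" "g i *\<^sub>R i \<in> L"
      using insert.prems L by (auto intro!: subspace_sum subspace_scale)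
    with insert show ?case by (simp add: add scale)
  qed
  have rep_sum: "representation D (\<Sum>i\<in>I. g i *\<^sub>R h i) d
      = (\<Sum>i\<in>I. g i * representation D (h i) d)"
    if "independent D" "\<And>i. i \<in> I \<Longrightarrow> h i \<in> span D"
    for D :: "'a set" and I :: "'a set" and g h d
    using that by (simp add: real_vector.representation_sum span_scale real_vector.representation_scale)
  have BL: "B \<subseteq> L" and CL: "C \<subseteq> L" using B(3) C(3) span_superset by blast+
  have "representation B (A b) b
      = (\<Sum>c\<in>C. representation C b c * representation B (A c) b)" if "b \<in> B" for b
  proof -
    have "b = (\<Sum>c\<in>C. representation C b c *\<^sub>R c)"
      using C BL that by (subst real_vector.sum_representation_eq) auto
    then have "A b = (\<Sum>c\<in>C. representation C b c *\<^sub>R A c)"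
      using A_sum[OF C(2) CL] by metis
    then show ?thesis using rep_sum[OF B(1)] closed CL B(3) by (metis subsetD)
  qed
  then have "(\<Sum>b\<in>B. representation B (A b) b)
      = (\<Sum>b\<in>B. \<Sum>c\<in>C. representation C b c * representation B (A c) b)"
    by simp
  also have "\<dots> = (\<Sum>c\<in>C. \<Sum>b\<in>B. representation B (A c) b * representation C b c)"
    by (subst sum.swap) (simp add: mult.commute)
  also have "\<dots> = (\<Sum>c\<in>C. representation C (A c) c)"
  proof (rule sum.cong[OF refl])
    fix c assume "c \<in> C"
    then have "(\<Sum>b\<in>B. representation B (A c) b *\<^sub>R b) = A c"
      using B CL closed by (intro real_vector.sum_representation_eq) auto
    then show "(\<Sum>b\<in>B. representation B (A c) b * representation C b c) = representation C (A c) c"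
      using rep_sum[OF C(1), of B "\<lambda>b. b" "representation B (A c)" c] BL C(3) by (metis subsetD)
  qed
  finally show ?thesis .
qed

(* f(A) for a scalar power series f and an endomorphism A. *)
definition fps_op :: "real fps \<Rightarrow> ('a::real_normed_vector \<Rightarrow> 'a) \<Rightarrow> 'a \<Rightarrow> 'a" where
  "fps_op f A v = (\<Sum>n. fps_nth f n *\<^sub>R (A ^^ n) v)"

(* The quotients below are exact: the order of vanishing at 0 of the numerator is at least
   that of the denominator. *)
definition psi_fps :: "real fps" where
  "psi_fps = (fps_exp 1 - 1 - fps_X) / ((fps_exp 1 - 1) * (1 - fps_exp (- 1)))"

definition quot_fps :: "real \<Rightarrow> real fps" where
  "quot_fps t = (1 - fps_exp (- t)) / (1 - fps_exp (- 1))"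

definition todd_fps :: "real fps" where
  "todd_fps = fps_X / (fps_exp 1 - 1)"

(* Noncommutative formal power series in x = False and y = True, given by their coefficients. *)
type_synonym nc_series = "bool list \<Rightarrow> real"

definition nc_one :: nc_series where
  "nc_one w = (if w = [] then 1 else 0)"

definition nc_mult :: "nc_series \<Rightarrow> nc_series \<Rightarrow> nc_series" where
  "nc_mult f g w = (\<Sum>i\<le>length w. f (take i w) * g (drop i w))"

definition nc_exp :: "bool \<Rightarrow> nc_series" where
  "nc_exp a w = (if set w \<subseteq> {a} then 1 / fact (length w) else 0)"

(* log f for f with constant term 1; then (f - 1)^k has no words shorter than k. *)
definition nc_log :: "nc_series \<Rightarrow> nc_series" where
  "nc_log f w = (\<Sum>k = 1..length w.
     (- 1) ^ (k + 1) / real k * ((nc_mult (\<lambda>v. f v - nc_one v)) ^^ k) nc_one w)"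

fun nested_bracket :: "('a \<Rightarrow> 'a \<Rightarrow> 'a) \<Rightarrow> (bool \<Rightarrow> 'a) \<Rightarrow> bool list \<Rightarrow> 'a::zero" where
  "nested_bracket br e [] = 0"
| "nested_bracket br e [a] = e a"
| "nested_bracket br e (a # b # w) = br (e a) (nested_bracket br e (b # w))"

(* The Campbell-Hausdorff series log(e^x e^y) is a Lie series; by Dynkin-Specht-Wever its
   component of degree n becomes a Lie polynomial on replacing each word by 1/n times the
   right-nested bracket of its letters. This is Dynkin's form of the series. *)
definition ch_component ::
  "('a::real_vector \<Rightarrow> 'a \<Rightarrow> 'a) \<Rightarrow> nat \<Rightarrow> 'a \<Rightarrow> 'a \<Rightarrow> 'a" where
  "ch_component br n X Y = (1 / real n) *\<^sub>R (\<Sum>w | length w = n.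
     nc_log (nc_mult (nc_exp False) (nc_exp True)) w *\<^sub>R
     nested_bracket br (\<lambda>a. if a then Y else X) w)"

definition ch :: "('a::real_normed_vector \<Rightarrow> 'a \<Rightarrow> 'a) \<Rightarrow> 'a \<Rightarrow> 'a \<Rightarrow> 'a" where
  "ch br X Y = (\<Sum>n. ch_component br n X Y)"

lemma ch_component_1: "ch_component br 1 X Y = X + Y"
proof -
  have "{w::bool list. length w = 1} = {[False], [True]}"
    by (auto simp: length_Suc_conv)
  then show ?thesis
    by (simp add: ch_component_def nc_log_def nc_mult_def nc_exp_def nc_one_def atMost_Suc)
qed

lemma (in fd_lie_algebra) ch_component_2:
  assumes "X \<in> L" "Y \<in> L"
  shows "ch_component br 2 X Y = (1 / 2) *\<^sub>R br X Y"
proof -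
  have words: "{w::bool list. length w = Suc (Suc 0)}
      = {[False, False], [False, True], [True, False], [True, True]}"
    by (auto simp: length_Suc_conv)
  have XY: "X + Y \<in> L" using assms subspace by (simp add: subspace_add)
  have "0 = br (X + Y) (X + Y)" using alternating[OF XY] by simp
  also have "\<dots> = br X Y + br Y X"
    using assms by (simp add: add_left[OF _ _ XY] add_right alternating)
  finally have "br Y X = - br X Y" by (simp add: eq_neg_iff_add_eq_0 add.commute)
  moreover have "{Suc 0..Suc (Suc 0)} = {Suc 0, Suc (Suc 0)}" by auto
  ultimately show ?thesis
    using assms
    by (simp add: ch_component_def words nc_log_def nc_mult_def nc_exp_def nc_one_def
        atMost_Suc numeral_2_eq_2 alternating flip: scaleR_add_left)
qed

(* The operator-valued integral is applied to X + Y under the integral sign. *)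
definition kv_F1 :: "('a::real_normed_vector \<Rightarrow> 'a \<Rightarrow> 'a) \<Rightarrow> 'a \<Rightarrow> 'a \<Rightarrow> 'a" where
  "kv_F1 br X Y = integral {0..1} (\<lambda>t.
     (fps_op (quot_fps t) (br X) \<circ> fps_op psi_fps (br (ch br (t *\<^sub>R X) (t *\<^sub>R Y)))) (X + Y))"

definition kv_F0 :: "('a::real_normed_vector \<Rightarrow> 'a \<Rightarrow> 'a) \<Rightarrow> 'a \<Rightarrow> 'a \<Rightarrow> 'a" where
  "kv_F0 br X Y =
     (1 / 2) *\<^sub>R (kv_F1 br X Y + fps_op (fps_exp 1) (br X) (kv_F1 br (- X) (- Y)))
     + (1 / 4) *\<^sub>R (ch br X Y - X)"

definition kv_G0 :: "('a::real_normed_vector \<Rightarrow> 'a \<Rightarrow> 'a) \<Rightarrow> 'a \<Rightarrow> 'a \<Rightarrow> 'a" where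
  "kv_G0 br X Y = kv_F0 br (- Y) (- X)"

definition partial_X ::
  "('a::real_normed_vector \<Rightarrow> 'a \<Rightarrow> 'a) \<Rightarrow> 'a \<Rightarrow> 'a \<Rightarrow> 'a \<Rightarrow> 'a" where
  "partial_X F X Y U = vector_derivative (\<lambda>s. F (X + s *\<^sub>R U) Y) (at 0)"

definition partial_Y ::
  "('a::real_normed_vector \<Rightarrow> 'a \<Rightarrow> 'a) \<Rightarrow> 'a \<Rightarrow> 'a \<Rightarrow> 'a \<Rightarrow> 'a" where
  "partial_Y F X Y U = vector_derivative (\<lambda>s. F X (Y + s *\<^sub>R U)) (at 0)"

definition kv_trace_left ::
  "'a::real_normed_vector set \<Rightarrow> ('a \<Rightarrow> 'a \<Rightarrow> 'a) \<Rightarrow> ('a \<Rightarrow> 'a \<Rightarrow> 'a) \<Rightarrow> ('a \<Rightarrow> 'a \<Rightarrow> 'a)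
    \<Rightarrow> 'a \<Rightarrow> 'a \<Rightarrow> real" where
  "kv_trace_left L br F G X Y =
     trace_on L (\<lambda>v. (br X \<circ> partial_X F X Y) v + (br Y \<circ> partial_Y G X Y) v)"

definition kv_trace_right ::
  "'a::real_normed_vector set \<Rightarrow> ('a \<Rightarrow> 'a \<Rightarrow> 'a) \<Rightarrow> 'a \<Rightarrow> 'a \<Rightarrow> real" where
  "kv_trace_right L br X Y = 1 / 2 * trace_on L (\<lambda>v.
     fps_op todd_fps (br X) v + fps_op todd_fps (br Y) v
     - fps_op todd_fps (br (ch br X Y)) v - v)"

(* Coefficient of s^n in the Taylor expansion of E (s X) (s Y) at s = 0. *)
definition hom_component ::
  "nat \<Rightarrow> ('a::real_vector \<Rightarrow> 'a \<Rightarrow> real) \<Rightarrow> 'a \<Rightarrow> 'a \<Rightarrow> real" where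
  "hom_component n E X Y = (deriv ^^ n) (\<lambda>s::real. E (s *\<^sub>R X) (s *\<^sub>R Y)) 0 / fact n"

end

theory Submission
  imports Defs
begin

text \<open>Let \<open>g = h + V\<close> be a semidirect product in which \<open>V\<close> is an abelian ideal, and let
\<open>X, Y\<close> lie in \<open>h\<close>. All operators under the two traces preserve \<open>h\<close> and \<open>V\<close>, so each trace over \<open>g\<close>
is the trace over \<open>h\<close> plus a contribution of \<open>V\<close>. If the contributions of \<open>V\<close> to the two sides differ
in degree 8, the trace identity therefore fails in degree 8 for \<open>h\<close> or for \<open>g\<close>, and nothing has to be
computed on \<open>h\<close> itself. Here \<open>h\<close> is \<open>gl(8)\<close> and \<open>V\<close> is \<open>R^8\<close>.

Expand everything into words in \<open>x\<close> and \<open>y\<close>. Since \<open>V\<close> is abelian, the partial derivative of a Lie series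
\<open>F\<close> at \<open>X\<close> in a direction \<open>v\<close> of \<open>V\<close> only sees the words of the associative expansion of \<open>F\<close> which end
in the letter \<open>x\<close>, and replaces this last letter by \<open>v\<close>. So the contribution of \<open>V\<close> to either side is a sum
over words \<open>w\<close> of a universal coefficient times the trace of \<open>w(X, Y)\<close> on \<open>V\<close>. Fix a word \<open>W\<close> of length 8
and let \<open>X\<close> (resp. \<open>Y\<close>) be the sum of the matrix units \<open>E(i, i + 1 mod 8)\<close> over the positions \<open>i\<close> at which
\<open>W\<close> has the letter \<open>x\<close> (resp. \<open>y\<close>). A word of length 8 then has trace equal to the number of rotations of \<open>W\<close>
which it equals, so the two sides are sums of eight coefficients. This is the content of
\<open>cyclic_word_criterion\<close>. For \<open>W = xxxyxxyy\<close> the left side is \<open>-1/544320\<close> (\<open>left_sum\<close>) and the right side is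
\<open>0\<close> (\<open>right_sum\<close>).

To make this precise the Campbell-Hausdorff series, given in Dynkin's form, is identified with the
associative logarithm of \<open>e^x e^y\<close> (\<open>dynkin_specht_wever\<close>; the logarithm vanishes on shuffles by
\<open>shuf_nc_log\<close>). Series whose coefficients grow at most geometrically in the length of the word are closed under
all operations in the definition of \<open>F^0\<close> and can be evaluated at small elements of a Banach algebra, where
evaluation commutes with these operations. Hence \<open>F^0\<close> is the value of an explicit series
(\<open>kv_F0_eq_ev\<close>), it can be differentiated term by term (\<open>ev_has_vector_derivative\<close>), and both traces are power
series in the scaling parameter whose coefficients are finite sums over words
(\<open>hom_component_left\<close>, \<open>hom_component_right\<close>).

The eight coefficients are computed exactly. In degree 8 the integral over \<open>t\<close> and the outer
operations in \<open>F^0\<close> reduce to eight rational numbers (\<open>F0_series_degree_8\<close>), and the coefficients of all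
series at the subwords of the rotations of \<open>W\<close> form tables which multiply like twisted polynomials
(\<open>tmul_correct\<close>). After scaling, these tables have integer entries.\<close>

section \<open>Shuffles and the Dynkin form of the Campbell-Hausdorff series\<close>

text \<open>The pairing of a series with the shuffle product of two words, that is, the coefficient of \<open>u \<otimes> v\<close> in the
coproduct of \<open>f\<close> for which the letters are primitive.\<close>

fun shuf :: "nc_series \<Rightarrow> bool list \<Rightarrow> bool list \<Rightarrow> real" where
  "shuf f [] v = f v"
| "shuf f (a # u) [] = f (a # u)"
| "shuf f (a # u) (b # v) = shuf (\<lambda>w. f (a # w)) u (b # v) + shuf (\<lambda>w. f (b # w)) (a # u) v"

lemma shuf_Nil2 [simp]: "shuf f u [] = f u"
  by (cases u) auto

lemma shuf_first_letter:
  "u \<noteq> [] \<or> v \<noteq> [] \<Longrightarrow> shuf f u v =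
    (case u of [] \<Rightarrow> 0 | a # u' \<Rightarrow> shuf (\<lambda>w. f (a # w)) u' v) +
    (case v of [] \<Rightarrow> 0 | b # v' \<Rightarrow> shuf (\<lambda>w. f (b # w)) u v')"
  by (cases u; cases v) auto

lemma shuf_add: "shuf (\<lambda>w. f w + g w) u v = shuf f u v + shuf g u v"
  by (induction f u v arbitrary: g rule: shuf.induct) auto

lemma shuf_scale: "shuf (\<lambda>w. c * f w) u v = c * shuf f u v"
  by (induction f u v rule: shuf.induct) (auto simp: algebra_simps)

lemma shuf_zero [simp]: "shuf (\<lambda>w. 0) u v = 0"
  using shuf_scale[of 0 "\<lambda>w. 0" u v] by simp

lemma shuf_sum: "shuf (\<lambda>w. \<Sum>k\<in>S. c k * f k w) u v = (\<Sum>k\<in>S. c k * shuf (f k) u v)"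
  by (induction S rule: infinite_finite_induct) (auto simp: shuf_add shuf_scale)

lemma shuf_cong:
  "(\<And>w. length w = length u + length v \<Longrightarrow> f w = g w) \<Longrightarrow> shuf f u v = shuf g u v"
proof (induction f u v arbitrary: g rule: shuf.induct)
  case (3 f a u b v)
  show ?case
    using "3.IH"(1)[of "\<lambda>w. g (a # w)"] "3.IH"(2)[of "\<lambda>w. g (b # w)"] "3.prems" by simp
qed auto

lemma nc_mult_Nil [simp]: "nc_mult f h [] = f [] * h []"
  by (simp add: nc_mult_def)

lemma nc_mult_Cons [simp]:
  "nc_mult f h (a # w) = f [] * h (a # w) + nc_mult (\<lambda>w. f (a # w)) h w"
  by (simp add: nc_mult_def sum.atMost_Suc_shift del: sum.atMost_Suc)

text \<open>The coproduct is multiplicative: a shuffle of \<open>u\<close> and \<open>v\<close>, cut into two pieces, cuts \<open>u\<close> and \<open>v\<close> as well.\<close>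

lemma shuf_nc_mult:
  "shuf (nc_mult f h) u v = (\<Sum>i\<le>length u. \<Sum>j\<le>length v.
     shuf f (take i u) (take j v) * shuf h (drop i u) (drop j v))"
proof (induction "length u + length v" arbitrary: f u v)
  case 0
  then show ?case by simp
next
  case (Suc n)
  show ?case
  proof (cases u; cases v)
    fix a u' b v' assume uv: "u = a # u'" "v = b # v'"
    have "shuf (nc_mult f h) u v =
        f [] * shuf h u v + shuf (nc_mult (\<lambda>w. f (a # w)) h) u' v + shuf (nc_mult (\<lambda>w. f (b # w)) h) u v'"
      by (simp add: uv shuf_add shuf_scale algebra_simps)
    also have "shuf (nc_mult (\<lambda>w. f (a # w)) h) u' v = (\<Sum>i\<le>length u'. \<Sum>j\<le>length v.
     shuf (\<lambda>w. f (a # w)) (take i u') (take j v) * shuf h (drop i u') (drop j v))"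
      by (rule Suc.hyps(1)) (use Suc.hyps(2) uv in auto)
    also have "shuf (nc_mult (\<lambda>w. f (b # w)) h) u v' = (\<Sum>i\<le>length u. \<Sum>j\<le>length v'.
     shuf (\<lambda>w. f (b # w)) (take i u) (take j v') * shuf h (drop i u) (drop j v'))"
      by (rule Suc.hyps(1)) (use Suc.hyps(2) uv in auto)
    finally show ?thesis
      by (simp add: uv sum.atMost_Suc_shift sum.distrib algebra_simps del: sum.atMost_Suc)
  qed (use Suc.hyps in \<open>auto simp: nc_mult_def\<close>)
qed

definition grouplike :: "nc_series \<Rightarrow> bool" where
  "grouplike f \<longleftrightarrow> (\<forall>u v. shuf f u v = f u * f v)"

lemma grouplike_mult:
  assumes "grouplike f" "grouplike h"
  shows "grouplike (nc_mult f h)"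
  using assms unfolding grouplike_def shuf_nc_mult
  by (simp add: nc_mult_def sum_product algebra_simps)

lemma grouplike_one: "grouplike nc_one"
  unfolding grouplike_def
proof (intro allI)
  fix u v show "shuf nc_one u v = nc_one u * nc_one v"
    by (cases u; cases v) (auto simp: nc_one_def)
qed

text \<open>The recursion on the first letter shifts the factorial, which is why \<open>k\<close> appears; for \<open>k = 0\<close> this is
group-likeness of an exponential.\<close>

lemma shuf_exp:
  "shuf (\<lambda>w. if set w \<subseteq> {a} then 1 / fact (k + length w) else 0) u v =
    (if set u \<subseteq> {a} \<and> set v \<subseteq> {a}
     then real ((length u + length v) choose length u) / fact (k + length u + length v) else 0)"
proof (induction "length u + length v" arbitrary: k u v)
  case 0
  then show ?case by simp
next
  case (Suc n)
  show ?case
  proof (cases u; cases v)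
    fix b u' c v' assume uv: "u = b # u'" "v = c # v'"
    have 1: "shuf (\<lambda>w. if set w \<subseteq> {a} then 1 / fact (Suc k + length w) else 0) u' v =
      (if set u' \<subseteq> {a} \<and> set v \<subseteq> {a}
     then real ((length u' + length v) choose length u') / fact (Suc k + length u' + length v) else 0)"
      by (rule Suc.hyps(1)) (use Suc.hyps(2) uv in auto)
    have 2: "shuf (\<lambda>w. if set w \<subseteq> {a} then 1 / fact (Suc k + length w) else 0) u v' =
      (if set u \<subseteq> {a} \<and> set v' \<subseteq> {a}
     then real ((length u + length v') choose length u) / fact (Suc k + length u + length v') else 0)"
      by (rule Suc.hyps(1)) (use Suc.hyps(2) uv in auto)
    have step: "(\<lambda>w. if set (b # w) \<subseteq> {a} then 1 / fact (k + length (b # w)) else 0) =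
      (if b = a then (\<lambda>w. if set w \<subseteq> {a} then 1 / fact (Suc k + length w) else 0) else (\<lambda>w. 0 :: real))" for b
      by auto
    have "shuf (\<lambda>w. if set w \<subseteq> {a} then 1 / fact (k + length w) else 0) u v =
       (if b = a then shuf (\<lambda>w. if set w \<subseteq> {a} then 1 / fact (Suc k + length w) else 0) u' v else 0)
      + (if c = a then shuf (\<lambda>w. if set w \<subseteq> {a} then 1 / fact (Suc k + length w) else 0) u v' else 0)"
      unfolding uv shuf.simps(3) step by simp
    also have "\<dots> = (if set u \<subseteq> {a} \<and> set v \<subseteq> {a}
     then real ((length u + length v) choose length u) / fact (k + length u + length v) else 0)"
      unfolding 1 2 by (auto simp: uv add_divide_distrib simp del: fact_Suc)
    finally show ?thesis .
  qed (use Suc.hyps in \<open>auto simp: add.assoc\<close>)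
qed

lemma grouplike_exp: "grouplike (nc_exp a)"
proof -
  have "nc_exp a = (\<lambda>w. if set w \<subseteq> {a} then 1 / fact (0 + length w) else 0)"
    by (auto simp: nc_exp_def fun_eq_iff)
  then show ?thesis
    unfolding grouplike_def using shuf_exp[of a 0]
    by (auto simp: binomial_fact)
qed

abbreviation nc_power :: "nc_series \<Rightarrow> nat \<Rightarrow> nc_series" where
  "nc_power f k \<equiv> (nc_mult f ^^ k) nc_one"

lemma grouplike_power: "grouplike f \<Longrightarrow> grouplike (nc_power f k)"
  by (induction k) (auto simp: grouplike_one grouplike_mult)

lemma nc_mult_sum_right: "nc_mult f (\<lambda>w. \<Sum>k\<in>S. c k * h k w) w = (\<Sum>k\<in>S. c k * nc_mult f (h k) w)"
  unfolding nc_mult_def sum_distrib_left by (subst sum.swap) (simp add: mult.left_commute)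

lemma nc_mult_add_left: "nc_mult (\<lambda>w. f w + g w) h w = nc_mult f h w + nc_mult g h w"
  by (simp add: nc_mult_def distrib_right sum.distrib)

lemma nc_mult_one_left [simp]: "nc_mult nc_one h w = h w"
proof -
  have z: "nc_mult (\<lambda>w. 0) h w = 0" for w by (simp add: nc_mult_def)
  show ?thesis by (cases w) (auto simp: nc_one_def z)
qed

lemma nc_power_expand:
  assumes "\<And>w. g w = nc_one w + q w"
  shows "nc_power g m w = (\<Sum>k\<le>m. real (m choose k) * nc_power q k w)"
proof (induction m arbitrary: w)
  case 0
  then show ?case by simp
next
  case (Suc m)
  have g: "g = (\<lambda>w. nc_one w + q w)" using assms by auto
  have "nc_power g (Suc m) w = nc_mult g (\<lambda>w. \<Sum>k\<le>m. real (m choose k) * nc_power q k w) w"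
    by (simp add: Suc[abs_def])
  also have "\<dots> = (\<Sum>k\<le>m. real (m choose k) * nc_power q k w)
      + (\<Sum>k\<le>m. real (m choose k) * nc_power q (Suc k) w)"
    by (simp add: g nc_mult_add_left nc_mult_sum_right)
  also have "(\<Sum>k\<le>m. real (m choose k) * nc_power q k w) = 
     nc_power q 0 w + (\<Sum>k\<le>m. real (m choose Suc k) * nc_power q (Suc k) w)"
  proof -
    have "(\<Sum>k\<le>m. real (m choose k) * nc_power q k w) = (\<Sum>k\<le>Suc m. real (m choose k) * nc_power q k w)"
      by simp
    then show ?thesis by (simp add: sum.atMost_Suc_shift del: sum.atMost_Suc)
  qed
  finally show ?case
    by (simp add: sum.atMost_Suc_shift sum.distrib algebra_simps del: sum.atMost_Suc)
qed

lemma nc_power_short: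
  assumes "q [] = 0" "length w < k"
  shows "nc_power q k w = 0"
  using assms(2)
proof (induction k arbitrary: w)
  case (Suc k)
  have "q (take i w) * nc_power q k (drop i w) = 0" if "i \<le> length w" for i
  proof (cases "i = 0")
    case False
    then have "length (drop i w) < k" using that Suc.prems by auto
    then show ?thesis using Suc.IH by simp
  qed (simp add: assms)
  then show ?case unfolding funpow.simps o_apply nc_mult_def[of q] by (intro sum.neutral) auto
qed simp

text \<open>The polynomial \<open>m choose k\<close> in \<open>m\<close>. Its linear coefficient is the coefficient of \<open>(g - 1)^k\<close> in \<open>log g\<close>.\<close>

definition choose_poly :: "nat \<Rightarrow> real poly" where
  "choose_poly k = smult (1 / fact k) (\<Prod>i<k. [:- real i, 1:])"

lemma poly_choose_poly: "poly (choose_poly k) (real m) = real (m choose k)"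
proof -
  have "real (m choose k) = real m gchoose k" by (simp add: binomial_gbinomial)
  then show ?thesis
    by (simp add: choose_poly_def poly_prod gbinomial_prod_rev lessThan_atLeast0)
qed

lemma coeff_choose_poly:
  assumes "k > 0"
  shows "coeff (choose_poly k) 0 = 0" "coeff (choose_poly k) 1 = (-1) ^ (k + 1) / real k"
proof -
  have p: "(\<Prod>i<k. [:- real i, 1:]) = pCons 0 (\<Prod>i=1..<k. [:- real i, 1:])"
  proof -
    have "{..<k} = insert 0 {1..<k}" using assms by auto
    then have "(\<Prod>i<k. [:- real i, 1:]) = [:0, 1:] * (\<Prod>i=1..<k. [:- real i, 1:])" by simp
    then show ?thesis by simp
  qed
  show "coeff (choose_poly k) 0 = 0" by (simp add: choose_poly_def p)
  have "coeff (\<Prod>i=1..<k. [:- real i, 1:]) 0 = (\<Prod>i=1..<k. - real i)"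
    by (simp add: poly_prod flip: poly_0_coeff_0)
  also have "\<dots> = (-1) ^ (k - 1) * fact (k - 1)"
    using prod.distrib[of "\<lambda>i. -1::real" real "{1..<k}"] assms
    by (simp add: fact_prod atLeastLessThanSuc_atLeastAtMost[symmetric])
  finally have c: "coeff (\<Prod>i=1..<k. [:- real i, 1:]) 0 = (-1) ^ (k - 1) * fact (k - 1)" .
  have "coeff (choose_poly k) 1 = (-1) ^ (k - 1) * fact (k - 1) / fact k"
    unfolding choose_poly_def p coeff_smult One_nat_def coeff_pCons_Suc c[unfolded One_nat_def] by simp
  also have "\<dots> = (-1) ^ (k + 1) / real k"
  proof -
    obtain j where k: "k = Suc j" using assms by (cases k) auto
    have "fact k = (real k :: real) * fact j" by (simp add: k)
    then show ?thesis using assms by (simp add: k del: of_nat_Suc)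
  qed
  finally show "coeff (choose_poly k) 1 = (-1) ^ (k + 1) / real k" .
qed

text \<open>The power \<open>g^m\<close> is the sum of \<open>(m choose k) (g - 1)^k\<close>, a polynomial in \<open>m\<close> whose linear coefficient is
\<open>log g\<close>. All powers of \<open>g\<close> are group-like, so \<open>shuf (g^m) u v = g^m u * g^m v\<close> as polynomials in \<open>m\<close>. Both
factors on the right have no constant term, hence the linear coefficient vanishes.\<close>

lemma shuf_nc_log:
  assumes g: "grouplike g" "g [] = 1" and "u \<noteq> []" "v \<noteq> []"
  shows "shuf (nc_log g) u v = 0"
proof -
  define q where "q w = g w - nc_one w" for w
  have q0: "q [] = 0" by (simp add: q_def g nc_one_def)
  \<comment> \<open>all coefficients at u, v and their shuffles are determined by the powers up to n\<close>
  define n where "n = length u + length v"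
  define P where "P w = (\<Sum>k\<le>n. smult (nc_power q k w) (choose_poly k))" for w
  define Q where "Q = (\<Sum>k\<le>n. smult (shuf (nc_power q k) u v) (choose_poly k))"
  have pw: "nc_power g m w = (\<Sum>k\<le>n. real (m choose k) * nc_power q k w)" if "length w \<le> n" for m w
  proof -
    have "nc_power g m w = (\<Sum>k\<le>m. real (m choose k) * nc_power q k w)"
      by (rule nc_power_expand) (simp add: q_def)
    also have "\<dots> = (\<Sum>k\<le>max m n. real (m choose k) * nc_power q k w)"
      by (rule sum.mono_neutral_left) auto
    also have "\<dots> = (\<Sum>k\<le>n. real (m choose k) * nc_power q k w)"
      by (rule sum.mono_neutral_right) (use that q0 in \<open>auto simp: nc_power_short\<close>)
    finally show ?thesis .
  qed
  have "poly Q (real m) = poly (P u * P v) (real m)" for m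
  proof -
    have "poly Q (real m) = (\<Sum>k\<le>n. real (m choose k) * shuf (nc_power q k) u v)"
      by (simp add: Q_def poly_sum poly_choose_poly mult.commute)
    also have "\<dots> = shuf (nc_power g m) u v"
      unfolding shuf_sum[symmetric] by (rule shuf_cong) (simp add: pw n_def)
    also have "\<dots> = nc_power g m u * nc_power g m v"
      using grouplike_power[OF g(1)] by (simp add: grouplike_def)
    also have "\<dots> = poly (P u * P v) (real m)"
      by (simp add: pw n_def P_def poly_sum poly_choose_poly mult.commute)
    finally show ?thesis .
  qed
  then have "range real \<subseteq> {x. poly (Q - P u * P v) x = 0}" by auto
  moreover have "infinite (range real)" by (simp add: range_inj_infinite inj_on_def)
  ultimately have "Q - P u * P v = 0" using poly_roots_finite finite_subset by blast
  then have "coeff Q 1 = coeff (P u * P v) 1" by simp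
  also have "coeff (P w) 0 = 0" if "w \<noteq> []" for w
  proof -
    have "nc_power q 0 w = 0" using that by (simp add: nc_one_def)
    then have "nc_power q k w * coeff (choose_poly k) 0 = 0" for k
      using coeff_choose_poly(1)[of k] by (cases "k = 0") auto
    then show ?thesis by (auto simp: P_def coeff_sum intro!: sum.neutral)
  qed
  then have "coeff (P u * P v) 1 = 0" using assms by (simp add: coeff_mult)
  finally have Q1: "coeff Q 1 = 0" .
  have "shuf (nc_log g) u v = shuf (\<lambda>w. \<Sum>k=1..n. (- 1) ^ (k + 1) / real k * nc_power q k w) u v"
    by (rule shuf_cong) (simp add: nc_log_def n_def q_def[abs_def])
  also have "\<dots> = (\<Sum>k=1..n. (- 1) ^ (k + 1) / real k * shuf (nc_power q k) u v)"
    by (rule shuf_sum)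
  also have "\<dots> = (\<Sum>k=1..n. coeff (smult (shuf (nc_power q k) u v) (choose_poly k)) 1)"
    by (rule sum.cong) (use coeff_choose_poly in auto)
  also have "\<dots> = (\<Sum>k\<le>n. coeff (smult (shuf (nc_power q k) u v) (choose_poly k)) 1)"
  proof (rule sum.mono_neutral_left)
    show "\<forall>i\<in>{..n} - {1..n}. coeff (smult (shuf (nc_power q i) u v) (choose_poly i)) 1 = 0"
    proof
      fix i assume "i \<in> {..n} - {1..n}"
      then have "i = 0" by auto
      then show "coeff (smult (shuf (nc_power q i) u v) (choose_poly i)) 1 = 0"
        by (simp add: choose_poly_def)
    qed
  qed auto
  also have "\<dots> = coeff Q 1" by (simp add: Q_def coeff_sum)
  finally show ?thesis using Q1 by simp
qed

lemma shuf_campbell_hausdorff: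
  assumes "u \<noteq> []" "v \<noteq> []"
  shows "shuf (nc_log (nc_mult (nc_exp False) (nc_exp True))) u v = 0"
  by (rule shuf_nc_log) (use assms in \<open>auto simp: grouplike_mult grouplike_exp nc_exp_def\<close>)

text \<open>Unshuffling, the adjoint of shuffling (\<open>sum_split_sum\<close>): the letters of a word are distributed to two subwords in all
possible ways.\<close>

fun split_sum :: "('l list \<Rightarrow> 'l list \<Rightarrow> 'a::real_vector) \<Rightarrow> 'l list \<Rightarrow> 'a" where
  "split_sum \<phi> [] = \<phi> [] []"
| "split_sum \<phi> (a # w) = split_sum (\<lambda>u v. \<phi> (a # u) v) w + split_sum (\<lambda>u v. \<phi> u (a # v)) w"

lemma split_sum_cong:
  "(\<And>u v. length u + length v = length w \<Longrightarrow> \<phi> u v = \<phi>' u v) \<Longrightarrow> split_sum \<phi> w = split_sum \<phi>' w"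
proof (induction w arbitrary: \<phi> \<phi>')
  case (Cons a w)
  show ?case
    using Cons.IH[of "\<lambda>u v. \<phi> (a # u) v" "\<lambda>u v. \<phi>' (a # u) v"]
      Cons.IH[of "\<lambda>u v. \<phi> u (a # v)" "\<lambda>u v. \<phi>' u (a # v)"] Cons.prems by simp
qed auto

lemma split_sum_add: "split_sum (\<lambda>u v. \<phi> u v + \<phi>' u v) w = split_sum \<phi> w + split_sum \<phi>' w"
  by (induction w arbitrary: \<phi> \<phi>') (auto simp: algebra_simps)

lemma split_sum_linear:
  assumes "linear h"
  shows "split_sum (\<lambda>u v. h (\<phi> u v)) w = h (split_sum \<phi> w)"
  by (induction w arbitrary: \<phi>) (auto simp: linear_add[OF assms])

lemma split_sum_snoc:
  "split_sum \<phi> (w @ [b]) = split_sum (\<lambda>u v. \<phi> (u @ [b]) v) w + split_sum (\<lambda>u v. \<phi> u (v @ [b])) w"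
  by (induction w arbitrary: \<phi>) (auto simp: algebra_simps)

text \<open>Moving the last letter of \<open>w\<close> from one subword to the other changes the sign but not the word \<open>u @ rev v\<close>, so
the terms cancel in pairs. In Hopf algebra terms, identity times antipode is the counit.\<close>

lemma split_sum_antipode:
  fixes \<psi> :: "'l list \<Rightarrow> 'b::real_vector"
  assumes "w \<noteq> []"
  shows "split_sum (\<lambda>u v. (-1) ^ length v *\<^sub>R \<psi> (u @ rev v)) w = 0"
proof -
  obtain w' b where w: "w = w' @ [b]" using assms by (metis append_butlast_last_id)
  have "split_sum (\<lambda>u v. (-1) ^ length v *\<^sub>R \<psi> (u @ rev v)) w =
      split_sum (\<lambda>u v. (-1) ^ length v *\<^sub>R \<psi> (u @ b # rev v) + - ((-1) ^ length v *\<^sub>R \<psi> (u @ b # rev v))) w'"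
    unfolding w split_sum_snoc split_sum_add by simp
  also have "\<dots> = split_sum (\<lambda>u v. 0 *\<^sub>R (0::'b)) w'" by simp
  also have "\<dots> = 0" by (subst split_sum_linear) auto
  finally show ?thesis .
qed

lemma finite_words [simp]: "finite {w :: bool list. length w = n}"
  using finite_lists_length_eq[of "UNIV :: bool set" n] by simp

lemma sum_words_Suc:
  "(\<Sum>w | length w = Suc n. g w) = (\<Sum>a\<in>UNIV. \<Sum>w | length w = n. g ((a::bool) # w))"
proof -
  have "{w :: bool list. length w = Suc n} = (\<lambda>(a, w). a # w) ` (UNIV \<times> {w. length w = n})"
    by (auto simp: length_Suc_conv image_iff)
  then have "(\<Sum>w | length w = Suc n. g w) = (\<Sum>(a, w)\<in>UNIV \<times> {w. length w = n}. g (a # w))"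
    by (simp add: sum.reindex inj_on_def case_prod_unfold prod_eq_iff)
  then show ?thesis by (simp add: sum.cartesian_product)
qed

abbreviation word_pairs :: "nat \<Rightarrow> (bool list \<times> bool list) set" where
  "word_pairs n \<equiv> {(u, v). length u + length v = n}"

lemma finite_word_pairs [simp]: "finite (word_pairs n)"
proof (rule finite_subset)
  show "word_pairs n \<subseteq> {w. length w \<le> n} \<times> {w. length w \<le> n}" by auto
  show "finite ({w :: bool list. length w \<le> n} \<times> {w :: bool list. length w \<le> n})"
    using finite_lists_length_le[of "UNIV :: bool set" n] by simp
qed

lemma sum_word_pairs_first:
  "(\<Sum>(u, v)\<in>word_pairs (Suc n). case u of [] \<Rightarrow> 0 | a # u' \<Rightarrow> g a u' v) =
   (\<Sum>a\<in>UNIV. \<Sum>(u, v)\<in>word_pairs n. g (a::bool) u v)"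
proof -
  have "(\<Sum>a\<in>UNIV. \<Sum>(u, v)\<in>word_pairs n. g (a::bool) u v) =
      (\<Sum>(a, u, v)\<in>UNIV \<times> word_pairs n. g (a::bool) u v)"
    by (subst sum.cartesian_product) (simp add: case_prod_unfold)
  also have "\<dots> = (\<Sum>(u, v)\<in>(\<lambda>(a, u, v). (a # u, v)) ` (UNIV \<times> word_pairs n). case u of [] \<Rightarrow> 0 | a # u' \<Rightarrow> g a u' v)"
    by (subst sum.reindex) (auto simp: inj_on_def intro!: sum.cong)
  also have "\<dots> = (\<Sum>(u, v)\<in>word_pairs (Suc n). case u of [] \<Rightarrow> 0 | a # u' \<Rightarrow> g a u' v)"
  proof (rule sum.mono_neutral_left)
    show "\<forall>i\<in>word_pairs (Suc n) - (\<lambda>(a, u, v). (a # u, v)) ` (UNIV \<times> word_pairs n).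
       (case i of (u, v) \<Rightarrow> case u of [] \<Rightarrow> 0 | a # u' \<Rightarrow> g a u' v) = 0"
    proof clarify
      fix u v assume n: "(u, v) \<notin> (\<lambda>(a, u, v). (a # u, v)) ` (UNIV \<times> word_pairs n)" "length u + length v = Suc n"
      show "(case u of [] \<Rightarrow> 0 | a # u' \<Rightarrow> g a u' v) = 0"
      proof (cases u)
        case (Cons a u')
        then have "(u, v) \<in> (\<lambda>(a, u, v). (a # u, v)) ` (UNIV \<times> word_pairs n)"
          using n(2) by (intro image_eqI[of _ _ "(a, u', v)"]) auto
        then show ?thesis using n(1) by blast
      qed simp
    qed
  qed (auto simp del: UNIV_bool)
  finally show ?thesis by simp
qed

lemma sum_word_pairs_second:
  "(\<Sum>(u, v)\<in>word_pairs (Suc n). case v of [] \<Rightarrow> 0 | a # v' \<Rightarrow> g a u v') =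
   (\<Sum>a\<in>UNIV. \<Sum>(u, v)\<in>word_pairs n. g (a::bool) u v)"
proof -
  have swap: "(\<Sum>(u, v)\<in>word_pairs k. h u v) = (\<Sum>(u, v)\<in>word_pairs k. h v u)" for k and h :: "_ \<Rightarrow> _ \<Rightarrow> 'a"
    by (rule sum.reindex_bij_witness[of _ prod.swap prod.swap]) auto
  show ?thesis
    by (simp only: swap[where h = "\<lambda>u v. case v of [] \<Rightarrow> 0 | a # v' \<Rightarrow> g a u v'"]
        swap[where h = "g _"] sum_word_pairs_first)
qed

lemma sum_split_sum:
  "(\<Sum>w | length w = n. f w *\<^sub>R split_sum \<phi> w) = (\<Sum>(u, v)\<in>word_pairs n. shuf f u v *\<^sub>R \<phi> u v)"
proof (induction n arbitrary: f \<phi>)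
  case 0
  have "{w::bool list. w = []} = {[]}" "{(u::bool list, v::bool list). u = [] \<and> v = []} = {([], [])}" by auto
  then show ?case by simp
next
  case (Suc n)
  have "(\<Sum>w | length w = Suc n. f w *\<^sub>R split_sum \<phi> w) =
      (\<Sum>a\<in>UNIV. (\<Sum>(u, v)\<in>word_pairs n. shuf (\<lambda>w. f (a # w)) u v *\<^sub>R \<phi> (a # u) v)
        + (\<Sum>(u, v)\<in>word_pairs n. shuf (\<lambda>w. f (a # w)) u v *\<^sub>R \<phi> u (a # v)))"
    by (simp add: sum_words_Suc scaleR_add_right sum.distrib Suc del: UNIV_bool)
  also have "\<dots> = (\<Sum>(u, v)\<in>word_pairs (Suc n). case u of [] \<Rightarrow> 0 | a # u' \<Rightarrow> shuf (\<lambda>w. f (a # w)) u' v *\<^sub>R \<phi> (a # u') v)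
     + (\<Sum>(u, v)\<in>word_pairs (Suc n). case v of [] \<Rightarrow> 0 | a # v' \<Rightarrow> shuf (\<lambda>w. f (a # w)) u v' *\<^sub>R \<phi> u (a # v'))"
    by (simp add: sum_word_pairs_first sum_word_pairs_second sum.distrib del: UNIV_bool)
  also have "\<dots> = (\<Sum>(u, v)\<in>word_pairs (Suc n). shuf f u v *\<^sub>R \<phi> u v)"
    unfolding sum.distrib[symmetric]
  proof (rule sum.cong[OF refl], clarify)
    fix u v :: "bool list" assume "length u + length v = Suc n"
    then have "u \<noteq> [] \<or> v \<noteq> []" by auto
    show "(case u of [] \<Rightarrow> 0 | a # u' \<Rightarrow> shuf (\<lambda>w. f (a # w)) u' v *\<^sub>R \<phi> (a # u') v) +
       (case v of [] \<Rightarrow> 0 | a # v' \<Rightarrow> shuf (\<lambda>w. f (a # w)) u v' *\<^sub>R \<phi> u (a # v')) = shuf f u v *\<^sub>R \<phi> u v"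
      unfolding shuf_first_letter[of u v f, OF \<open>u \<noteq> [] \<or> v \<noteq> []\<close>] by (cases u; cases v; simp add: scaleR_add_left)
  qed
  finally show ?case .
qed

locale banach_product = bounded_bilinear m
  for m :: "'a::banach \<Rightarrow> 'a \<Rightarrow> 'a" (infixl "\<odot>" 70) +
  assumes assoc: "(x \<odot> y) \<odot> z = x \<odot> (y \<odot> z)"
begin

abbreviation mon :: "(bool \<Rightarrow> 'a) \<Rightarrow> bool list \<Rightarrow> 'a" where
  "mon \<equiv> nested_bracket (\<odot>)"

definition com :: "'a \<Rightarrow> 'a \<Rightarrow> 'a" where
  "com x y = x \<odot> y - y \<odot> x"

lemma mon_Cons: "w \<noteq> [] \<Longrightarrow> mon e (a # w) = e a \<odot> mon e w"
  by (cases w) auto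

lemma mon_append: "u \<noteq> [] \<Longrightarrow> v \<noteq> [] \<Longrightarrow> mon e (u @ v) = mon e u \<odot> mon e v"
proof (induction u)
  case (Cons a u)
  then show ?case by (cases "u = []") (auto simp: mon_Cons assoc)
qed simp

text \<open>The right-nested bracket is the convolution of the length operator with the antipode
\<open>v \<mapsto> (-1)^n rev v\<close>. By induction: if the first letter \<open>a\<close> goes to \<open>u\<close> it multiplies from the left and raises
the length by one, if it goes to \<open>v\<close> it multiplies from the right with a sign; the surplus from the raised
length vanishes by \<open>split_sum_antipode\<close>.\<close>

lemma nested_com_eq_split_sum:
  "nested_bracket com e w =
     split_sum (\<lambda>u v. (real (length u) * (-1) ^ length v) *\<^sub>R mon e (u @ rev v)) w"
proof (induction w)
  case (Cons a w)
  let ?\<phi> = "\<lambda>(u::bool list) (v::bool list). (real (length u) * (-1) ^ length v) *\<^sub>R mon e (u @ rev v)"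
  show ?case
  proof (cases "w = []")
    case False
    have 1: "split_sum (\<lambda>u v. ?\<phi> (a # u) v) w =
       split_sum (\<lambda>u v. e a \<odot> ?\<phi> u v + (-1) ^ length v *\<^sub>R mon e (a # (u @ rev v))) w"
    proof (rule split_sum_cong)
      fix u v :: "bool list" assume "length u + length v = length w"
      then have "u @ rev v \<noteq> []" using False by auto
      then show "?\<phi> (a # u) v = e a \<odot> ?\<phi> u v + (-1) ^ length v *\<^sub>R mon e (a # (u @ rev v))"
        using mon_Cons[of "u @ rev v" e a] by (simp add: scaleR_right algebra_simps)
    qed
    have 2: "split_sum (\<lambda>u v. ?\<phi> u (a # v)) w = split_sum (\<lambda>u v. - (?\<phi> u v \<odot> e a)) w"
    proof (rule split_sum_cong)
      fix u v :: "bool list" assume "length u + length v = length w"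
      then have "u @ rev v \<noteq> []" using False by auto
      then show "?\<phi> u (a # v) = - (?\<phi> u v \<odot> e a)"
        using mon_append[of "u @ rev v" "[a]" e] by (simp add: scaleR_left)
    qed
    have l1: "linear (\<lambda>x. e a \<odot> x)" and l2: "linear (\<lambda>x. - (x \<odot> e a))"
      by (auto intro!: linearI simp: add_right add_left scaleR_right scaleR_left)
    have "nested_bracket com e (a # w) = com (e a) (split_sum ?\<phi> w)"
      using False Cons by (cases w) auto
    also have "\<dots> = split_sum ?\<phi> (a # w)"
      by (simp only: split_sum.simps 1 2 split_sum_add split_sum_linear[OF l1] split_sum_linear[OF l2]
          split_sum_antipode[OF False] com_def)
        (simp add: split_sum_antipode[OF False, of "\<lambda>w. mon e (a # w)"])
    finally show ?thesis .
  qed simp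
qed simp

text \<open>After \<open>nested_com_eq_split_sum\<close> and adjointness, the factor \<open>length u\<close> kills \<open>u = []\<close> and the hypothesis
kills the pairs of nonempty words, so only \<open>v = []\<close> is left.\<close>

theorem dynkin_specht_wever:
  assumes "\<And>u v. u \<noteq> [] \<Longrightarrow> v \<noteq> [] \<Longrightarrow> shuf f u v = 0"
  shows "(\<Sum>w | length w = n. f w *\<^sub>R nested_bracket com e w) = real n *\<^sub>R (\<Sum>w | length w = n. f w *\<^sub>R mon e w)"
proof (cases "n = 0")
  case False
  let ?\<phi> = "\<lambda>(u::bool list) (v::bool list). (real (length u) * (-1) ^ length v) *\<^sub>R mon e (u @ rev v)"
  have "(\<Sum>w | length w = n. f w *\<^sub>R nested_bracket com e w) = (\<Sum>(u, v)\<in>word_pairs n. shuf f u v *\<^sub>R ?\<phi> u v)"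
    unfolding nested_com_eq_split_sum by (rule sum_split_sum)
  also have "\<dots> = (\<Sum>(u, v)\<in>(\<lambda>u. (u, [])) ` {w. length w = n}. shuf f u v *\<^sub>R ?\<phi> u v)"
  proof (rule sum.mono_neutral_right)
    show "\<forall>i\<in>word_pairs n - (\<lambda>u. (u, [])) ` {w. length w = n}.
       (case i of (u, v) \<Rightarrow> shuf f u v *\<^sub>R ?\<phi> u v) = 0"
    proof clarify
      fix u v :: "bool list" assume "(u, v) \<notin> (\<lambda>u. (u, [])) ` {w. length w = length u + length v}"
      then have "v \<noteq> []" by auto
      then show "shuf f u v *\<^sub>R ?\<phi> u v = 0" using assms by (cases "u = []") auto
    qed
  qed auto
  also have "\<dots> = (\<Sum>u | length u = n. f u *\<^sub>R (real n *\<^sub>R mon e u))"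
    by (subst sum.reindex) (auto simp: inj_on_def intro!: sum.cong)
  finally show ?thesis by (simp add: scaleR_sum_right mult.commute)
qed (auto)

abbreviation (input) ch_series :: nc_series where
  "ch_series \<equiv> nc_log (nc_mult (nc_exp False) (nc_exp True))"

lemma ch_component_eq:
  "ch_component com n X Y = (\<Sum>w | length w = n. ch_series w *\<^sub>R mon (\<lambda>a. if a then Y else X) w)"
proof (cases "n = 0")
  case False
  then show ?thesis
    using dynkin_specht_wever[OF shuf_campbell_hausdorff, where e = "\<lambda>a. if a then Y else X"]
    by (simp add: ch_component_def)
qed (simp add: ch_component_def)

end

section \<open>Geometrically bounded series and their values in a Banach algebra\<close>

text \<open>All series below satisfy such a bound for some \<open>C\<close>. It is stable under the operations that occur, at the cost
of increasing \<open>C\<close>, and makes evaluation converge near the origin.\<close>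

definition geo_bdd :: "real \<Rightarrow> nc_series \<Rightarrow> bool" where
  "geo_bdd C f \<longleftrightarrow> (\<forall>w. \<bar>f w\<bar> \<le> C ^ length w)"

lemma geo_bddD: "geo_bdd C f \<Longrightarrow> \<bar>f w\<bar> \<le> C ^ length w"
  by (simp add: geo_bdd_def)

lemma geo_bdd_nonneg: "geo_bdd C f \<Longrightarrow> 0 \<le> C"
  using geo_bddD[of C f "[False]"] by simp

lemma geo_bdd_mono: "geo_bdd C f \<Longrightarrow> C \<le> D \<Longrightarrow> geo_bdd D f"
  unfolding geo_bdd_def using geo_bdd_nonneg[of C f] power_mono[of C D]
  by (meson geo_bdd_def order_trans)

text \<open>For \<open>(\<alpha>, \<beta>) = (1, -1)\<close> this is the commutator with \<open>z\<close>, for \<open>(1, 0)\<close> it is left multiplication.\<close>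

definition nc_ad :: "real \<Rightarrow> real \<Rightarrow> nc_series \<Rightarrow> nc_series \<Rightarrow> nc_series" where
  "nc_ad \<alpha> \<beta> z p w = \<alpha> * nc_mult z p w + \<beta> * nc_mult p z w"

text \<open>The series \<open>\<phi>(ad z) p\<close>. For \<open>z\<close> and \<open>p\<close> without constant term, \<open>(ad z)^n p\<close> only has words longer than \<open>n\<close>, so
the truncated sum is the full one.\<close>

definition nc_fps :: "real \<Rightarrow> real \<Rightarrow> real fps \<Rightarrow> nc_series \<Rightarrow> nc_series \<Rightarrow> nc_series" where
  "nc_fps \<alpha> \<beta> \<phi> z p w = (\<Sum>n\<le>length w. fps_nth \<phi> n * (nc_ad \<alpha> \<beta> z ^^ n) p w)"

lemma sum_pow3: "(\<Sum>i\<in>{1..l}. (3::real) ^ (l - i)) \<le> 3 ^ l / 2"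
proof -
  have "(\<Sum>i\<in>{1..l}. (3::real) ^ (l - i)) = (\<Sum>i<l. 3 ^ i)"
    by (rule sum.reindex_bij_witness[of _ "\<lambda>i. l - i" "\<lambda>i. l - i"]) auto
  also have "\<dots> = (3 ^ l - 1) / 2" by (simp add: geometric_sum)
  finally show ?thesis by simp
qed

text \<open>The rate of \<open>q\<close> is three times that of \<open>z\<close>, and the positive powers of \<open>1/3\<close> sum to \<open>1/2\<close>. Left and right products together
then reproduce the bound of \<open>q\<close>, so it survives arbitrarily many applications of \<open>nc_ad\<close>.\<close>

lemma nc_mult_bound_left:
  assumes z: "geo_bdd C z" "z [] = 0" and q: "geo_bdd (3 * C) q"
  shows "\<bar>nc_mult z q w\<bar> \<le> (3 * C) ^ length w / 2"
proof -
  let ?l = "length w"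
  have "\<bar>nc_mult z q w\<bar> \<le> (\<Sum>i\<le>?l. \<bar>z (take i w) * q (drop i w)\<bar>)"
    unfolding nc_mult_def by (rule sum_abs)
  also have "\<dots> = (\<Sum>i\<in>{1..?l}. \<bar>z (take i w) * q (drop i w)\<bar>)"
  proof (rule sum.mono_neutral_right)
    show "\<forall>i\<in>{..?l} - {1..?l}. \<bar>z (take i w) * q (drop i w)\<bar> = 0"
    proof
      fix i assume "i \<in> {..?l} - {1..?l}"
      then have "i = 0" by auto
      then show "\<bar>z (take i w) * q (drop i w)\<bar> = 0" using z by simp
    qed
  qed auto
  also have "\<dots> \<le> (\<Sum>i\<in>{1..?l}. C ^ ?l * 3 ^ (?l - i))"
  proof (rule sum_mono)
    fix i assume i: "i \<in> {1..?l}"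
    have "\<bar>z (take i w)\<bar> * \<bar>q (drop i w)\<bar> \<le> C ^ i * (3 * C) ^ (?l - i)"
      using geo_bddD[OF z(1), of "take i w"] geo_bddD[OF q, of "drop i w"] i geo_bdd_nonneg[OF z(1)]
      by (intro mult_mono) auto
    also have "\<dots> = C ^ ?l * 3 ^ (?l - i)"
      using i by (simp add: power_mult_distrib flip: power_add)
    finally show "\<bar>z (take i w) * q (drop i w)\<bar> \<le> C ^ ?l * 3 ^ (?l - i)" by (simp add: abs_mult)
  qed
  also have "\<dots> \<le> C ^ ?l * (3 ^ ?l / 2)"
    unfolding sum_distrib_left[symmetric]
    using geo_bdd_nonneg[OF z(1)] by (intro mult_left_mono sum_pow3) auto
  finally show ?thesis by (simp add: power_mult_distrib mult.commute)
qed

lemma nc_mult_rev: "nc_mult q z w = nc_mult (\<lambda>w. z (rev w)) (\<lambda>w. q (rev w)) (rev w)"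
  unfolding nc_mult_def
  by (rule sum.reindex_bij_witness[of _ "\<lambda>i. length w - i" "\<lambda>i. length w - i"])
    (auto simp: rev_take rev_drop mult.commute)

lemma nc_mult_bound_right:
  assumes z: "geo_bdd C z" "z [] = 0" and q: "geo_bdd (3 * C) q"
  shows "\<bar>nc_mult q z w\<bar> \<le> (3 * C) ^ length w / 2"
proof -
  have "geo_bdd C (\<lambda>w. z (rev w))" "geo_bdd (3 * C) (\<lambda>w. q (rev w))"
    using geo_bddD[OF z(1), of "rev _"] geo_bddD[OF q, of "rev _"] by (auto simp: geo_bdd_def)
  from nc_mult_bound_left[OF this(1) _ this(2), of "rev w"] z(2) show ?thesis
    by (simp add: nc_mult_rev[of q z])
qed

lemma geo_bdd_nc_ad:
  assumes "geo_bdd C z" "z [] = 0" "geo_bdd (3 * C) q" "\<bar>\<alpha>\<bar> \<le> 1" "\<bar>\<beta>\<bar> \<le> 1"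
  shows "geo_bdd (3 * C) (nc_ad \<alpha> \<beta> z q)"
  unfolding geo_bdd_def
proof
  fix w
  have "\<bar>nc_ad \<alpha> \<beta> z q w\<bar> \<le> \<bar>\<alpha>\<bar> * \<bar>nc_mult z q w\<bar> + \<bar>\<beta>\<bar> * \<bar>nc_mult q z w\<bar>"
    unfolding nc_ad_def by (metis abs_mult abs_triangle_ineq)
  also have "\<dots> \<le> 1 * ((3 * C) ^ length w / 2) + 1 * ((3 * C) ^ length w / 2)"
    using assms nc_mult_bound_left[OF assms(1-3), of w] nc_mult_bound_right[OF assms(1-3), of w]
    by (intro add_mono mult_mono) auto
  finally show "\<bar>nc_ad \<alpha> \<beta> z q w\<bar> \<le> (3 * C) ^ length w" by (simp add: mult.commute)
qed

lemma geo_bdd_nc_mult: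
  assumes "geo_bdd C z" "z [] = 0" "geo_bdd (3 * C) q"
  shows "geo_bdd (3 * C) (nc_mult z q)" "geo_bdd (3 * C) (nc_mult q z)"
  using geo_bdd_nc_ad[OF assms, of 1 0] geo_bdd_nc_ad[OF assms, of 0 1] by (simp_all add: nc_ad_def[abs_def])

lemma geo_bdd_nc_ad_power:
  assumes "geo_bdd C z" "z [] = 0" "geo_bdd C p" "\<bar>\<alpha>\<bar> \<le> 1" "\<bar>\<beta>\<bar> \<le> 1"
  shows "geo_bdd (3 * C) ((nc_ad \<alpha> \<beta> z ^^ n) p)"
proof (induction n)
  case 0
  then show ?case using assms(3) geo_bdd_nonneg[OF assms(3)] by (auto intro: geo_bdd_mono)
next
  case (Suc n)
  then show ?case using assms by (simp add: geo_bdd_nc_ad)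
qed

lemma nc_ad_power_short:
  assumes "z [] = 0" "p [] = 0" "length w \<le> n"
  shows "(nc_ad \<alpha> \<beta> z ^^ n) p w = 0"
  using assms(3)
proof (induction n arbitrary: w)
  case (Suc n)
  let ?q = "(nc_ad \<alpha> \<beta> z ^^ n) p"
  have "z (take i w) * ?q (drop i w) = 0" for i
    using Suc assms by (cases "i = 0 \<or> w = []") auto
  moreover have "?q (take i w) * z (drop i w) = 0" if "i \<le> length w" for i
    using Suc assms that by (cases "i = length w") auto
  ultimately have "nc_mult z ?q w = 0" "nc_mult ?q z w = 0"
    unfolding nc_mult_def by (metis (no_types, lifting) sum.neutral, metis (no_types, lifting) atMost_iff sum.neutral)
  then show ?case unfolding funpow.simps o_apply by (subst nc_ad_def) simp
qed (use assms in auto)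

lemma nc_ad_power_Nil [simp]: "z [] = 0 \<Longrightarrow> p [] = 0 \<Longrightarrow> (nc_ad \<alpha> \<beta> z ^^ n) p [] = 0"
  by (rule nc_ad_power_short) auto

lemma nc_fps_Nil [simp]: "z [] = 0 \<Longrightarrow> p [] = 0 \<Longrightarrow> nc_fps \<alpha> \<beta> \<phi> z p [] = 0"
  by (simp add: nc_fps_def)

definition fps_geo_bdd :: "real \<Rightarrow> real fps \<Rightarrow> bool" where
  "fps_geo_bdd B \<phi> \<longleftrightarrow> 1 \<le> B \<and> (\<forall>n. \<bar>fps_nth \<phi> n\<bar> \<le> B ^ Suc n)"

lemma nc_fps_abs_bound:
  assumes "geo_bdd C z" "z [] = 0" "geo_bdd C p" "p [] = 0" "\<bar>\<alpha>\<bar> \<le> 1" "\<bar>\<beta>\<bar> \<le> 1" "fps_geo_bdd B \<phi>"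
  shows "(\<Sum>n\<le>length w. \<bar>fps_nth \<phi> n * (nc_ad \<alpha> \<beta> z ^^ n) p w\<bar>) \<le> (6 * B * C) ^ length w"
proof -
  let ?l = "length w"
  have B: "1 \<le> B" using assms by (simp add: fps_geo_bdd_def)
  have C: "0 \<le> C" using assms geo_bdd_nonneg by blast
  have "(\<Sum>n\<le>?l. \<bar>fps_nth \<phi> n * (nc_ad \<alpha> \<beta> z ^^ n) p w\<bar>) =
        (\<Sum>n<?l. \<bar>fps_nth \<phi> n * (nc_ad \<alpha> \<beta> z ^^ n) p w\<bar>)"
    by (rule sum.mono_neutral_right) (use assms in \<open>auto simp: nc_ad_power_short\<close>)
  also have "\<dots> \<le> (\<Sum>n<?l. B ^ ?l * (3 * C) ^ ?l)"
  proof (rule sum_mono)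
    fix n assume n: "n \<in> {..<?l}"
    have "\<bar>fps_nth \<phi> n\<bar> \<le> B ^ Suc n" using assms(7) by (simp add: fps_geo_bdd_def)
    also have "\<dots> \<le> B ^ ?l" using n B by (intro power_increasing) auto
    finally have "\<bar>fps_nth \<phi> n\<bar> * \<bar>(nc_ad \<alpha> \<beta> z ^^ n) p w\<bar> \<le> B ^ ?l * (3 * C) ^ ?l"
      using geo_bddD[OF geo_bdd_nc_ad_power[OF assms(1-3,5,6)], of n w] B by (intro mult_mono) auto
    then show "\<bar>fps_nth \<phi> n * (nc_ad \<alpha> \<beta> z ^^ n) p w\<bar> \<le> B ^ ?l * (3 * C) ^ ?l"
      by (simp add: abs_mult)
  qed
  also have "\<dots> = real ?l * (B ^ ?l * (3 * C) ^ ?l)" by simp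
  also have "\<dots> \<le> 2 ^ ?l * (B ^ ?l * (3 * C) ^ ?l)"
    using B C of_nat_less_two_power[of ?l, where 'a = real] by (intro mult_right_mono) auto
  also have "\<dots> = (6 * B * C) ^ ?l"
  proof -
    have "6 * B * C = 2 * (B * (3 * C))" by simp
    then show ?thesis by (simp only: power_mult_distrib)
  qed
  finally show ?thesis .
qed

lemma geo_bdd_nc_fps:
  assumes "geo_bdd C z" "z [] = 0" "geo_bdd C p" "p [] = 0" "\<bar>\<alpha>\<bar> \<le> 1" "\<bar>\<beta>\<bar> \<le> 1" "fps_geo_bdd B \<phi>"
  shows "geo_bdd (6 * B * C) (nc_fps \<alpha> \<beta> \<phi> z p)"
  unfolding geo_bdd_def nc_fps_def by (intro allI order_trans[OF sum_abs nc_fps_abs_bound[OF assms]])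

lemma card_words: "card {w :: bool list. length w = n} = 2 ^ n"
  using card_lists_length_eq[of "UNIV :: bool set" n] by simp

lemma sum_words_power: "(\<Sum>w :: bool list | length w = n. q ^ length w) = (2 * q :: real) ^ n"
  by (simp add: card_words power_mult_distrib)

lemma summable_words:
  assumes "0 \<le> q" "2 * q < (1::real)"
  shows "(\<lambda>w :: bool list. q ^ length w) summable_on UNIV"
proof (rule nonneg_bdd_above_summable_on)
  show "bdd_above (sum (\<lambda>w :: bool list. q ^ length w) ` {F. F \<subseteq> UNIV \<and> finite F})"
  proof (rule bdd_aboveI2)
    fix F :: "bool list set" assume "F \<in> {F. F \<subseteq> UNIV \<and> finite F}"
    then have F: "finite F" by simp
    define N where "N = Suc (Max (insert 0 (length ` F)))"
    have sub: "F \<subseteq> (\<Union>n<N. {w. length w = n})"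
      using F by (auto simp: N_def less_Suc_eq_le)
    have "(\<Sum>w\<in>F. q ^ length w) \<le> (\<Sum>w\<in>(\<Union>n<N. {w :: bool list. length w = n}). q ^ length w)"
      by (rule sum_mono2) (use sub assms in \<open>auto intro: finite_UN_I\<close>)
    also have "\<dots> = (\<Sum>n<N. \<Sum>w :: bool list | length w = n. q ^ length w)"
      by (rule sum.UNION_disjoint) auto
    also have "\<dots> = (\<Sum>n<N. (2 * q) ^ n)" by (simp only: sum_words_power)
    also have "\<dots> \<le> (\<Sum>n. (2 * q) ^ n)"
      using assms by (intro sum_le_suminf summable_geometric) auto
    finally show "(\<Sum>w\<in>F. q ^ length w) \<le> (\<Sum>n. (2 * q) ^ n)" .
  qed
qed (use assms in auto)

lemma sums_by_length:
  fixes g :: "bool list \<Rightarrow> 'b::banach"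
  assumes "g summable_on UNIV"
  shows "(\<lambda>n. \<Sum>w | length w = n. g w) sums infsum g UNIV"
proof -
  have "bij_betw snd (SIGMA n:UNIV. {w :: bool list. length w = n}) UNIV"
    by (intro bij_betwI[where g = "\<lambda>w. (length w, w)"]) auto
  then have "((\<lambda>p. g (snd p)) has_sum infsum g UNIV) (SIGMA n:UNIV. {w. length w = n})"
    by (subst has_sum_reindex_bij_betw[of snd _ UNIV g]) (use assms in auto)
  then have "((\<lambda>n. \<Sum>w | length w = n. g w) has_sum infsum g UNIV) UNIV"
    by (rule has_sum_SigmaD) (auto intro!: has_sum_finiteI)
  then show ?thesis by (rule has_sum_imp_sums)
qed

context banach_product begin

definition bnd :: real where
  "bnd = (SOME K. 1 \<le> K \<and> (\<forall>x y. norm (x \<odot> y) \<le> K * norm x * norm y))"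

lemma bnd: "1 \<le> bnd" "norm (x \<odot> y) \<le> bnd * norm x * norm y"
proof -
  obtain K where K: "\<And>x y. norm (x \<odot> y) \<le> norm x * norm y * K" "K > 0" using pos_bounded by blast
  have "norm (x \<odot> y) \<le> max 1 K * norm x * norm y" for x y
  proof -
    have "norm (x \<odot> y) \<le> K * (norm x * norm y)" using K(1)[of x y] by (simp add: mult_ac)
    also have "\<dots> \<le> max 1 K * (norm x * norm y)" by (intro mult_right_mono) auto
    finally show ?thesis by (simp add: mult_ac)
  qed
  then have "\<exists>K. 1 \<le> K \<and> (\<forall>x y. norm (x \<odot> y) \<le> K * norm x * norm y)"
    by (intro exI[of _ "max 1 K"]) auto
  from someI_ex[OF this] show "1 \<le> bnd" "norm (x \<odot> y) \<le> bnd * norm x * norm y"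
    unfolding bnd_def by auto
qed

definition size_le :: "(bool \<Rightarrow> 'a) \<Rightarrow> real \<Rightarrow> bool" where
  "size_le e r \<longleftrightarrow> (\<forall>a. bnd * norm (e a) \<le> r)"

lemma size_le_nonneg: "size_le e r \<Longrightarrow> 0 \<le> r"
  unfolding size_le_def using bnd(1) by (meson norm_ge_zero mult_nonneg_nonneg order_trans zero_le_one)

lemma size_leD: "size_le e r \<Longrightarrow> norm (e a) \<le> r"
  unfolding size_le_def using mult_right_mono[OF bnd(1), of "norm (e a)"] by (metis mult_1 norm_ge_zero order_trans)

lemma norm_mon: "size_le e r \<Longrightarrow> norm (mon e w) \<le> r ^ length w"
proof (induction w)
  case (Cons a w)
  show ?case
  proof (cases "w = []")
    case True
    then show ?thesis using size_leD[OF Cons.prems, of a] by simp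
  next
    case False
    have "norm (mon e (a # w)) \<le> (bnd * norm (e a)) * norm (mon e w)"
      using bnd(2)[of "e a" "mon e w"] by (simp add: mon_Cons[OF False])
    also have "\<dots> \<le> r * r ^ length w"
      using Cons size_le_nonneg[OF Cons.prems] by (intro mult_mono) (auto simp: size_le_def)
    finally show ?thesis by simp
  qed
qed simp

text \<open>The algebra has no unit and the empty word has value \<open>0\<close>; only series without constant term are evaluated
multiplicatively.\<close>

definition ev :: "(bool \<Rightarrow> 'a) \<Rightarrow> nc_series \<Rightarrow> 'a" where
  "ev e f = (\<Sum>\<^sub>\<infinity>w. f w *\<^sub>R mon e w)"

lemma norm_term:
  assumes "geo_bdd C f" "size_le e r"
  shows "norm (f w *\<^sub>R mon e w) \<le> (C * r) ^ length w"
  using geo_bddD[OF assms(1), of w] norm_mon[OF assms(2), of w] geo_bdd_nonneg[OF assms(1)]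
  by (auto simp: power_mult_distrib intro!: mult_mono)

lemma ev_abs_summable:
  assumes "geo_bdd C f" "size_le e r" "2 * (C * r) < 1"
  shows "(\<lambda>w. norm (f w *\<^sub>R mon e w)) summable_on UNIV"
  by (rule Infinite_Sum.abs_summable_on_comparison_test'[OF summable_words[of "C * r"]])
    (use assms norm_term size_le_nonneg geo_bdd_nonneg in auto)

lemma ev_has_sum:
  assumes "geo_bdd C f" "size_le e r" "2 * (C * r) < 1"
  shows "((\<lambda>w. f w *\<^sub>R mon e w) has_sum ev e f) UNIV"
  unfolding ev_def by (rule has_sum_infsum) (rule abs_summable_summable[OF ev_abs_summable[OF assms]])

lemma ev_sums:
  assumes "geo_bdd C f" "size_le e r" "2 * (C * r) < 1"
  shows "(\<lambda>n. \<Sum>w | length w = n. f w *\<^sub>R mon e w) sums ev e f"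
  unfolding ev_def by (rule sums_by_length[OF abs_summable_summable[OF ev_abs_summable[OF assms]]])

lemma ev_lincomb:
  assumes "geo_bdd C f" "geo_bdd C g" "size_le e r" "2 * (C * r) < 1"
  shows "ev e (\<lambda>w. a * f w + b * g w) = a *\<^sub>R ev e f + b *\<^sub>R ev e g"
proof -
  have "((\<lambda>w. a *\<^sub>R (f w *\<^sub>R mon e w) + b *\<^sub>R (g w *\<^sub>R mon e w)) has_sum (a *\<^sub>R ev e f + b *\<^sub>R ev e g)) UNIV"
    by (intro has_sum_add has_sum_scaleR ev_has_sum[OF assms(1,3,4)] ev_has_sum[OF assms(2,3,4)])
  then show ?thesis unfolding ev_def by (intro infsumI) (simp add: scaleR_left_distrib)
qed

lemma ev_mult:
  assumes f: "geo_bdd C f" "f [] = 0" and h: "geo_bdd C h" "h [] = 0"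
    and e: "size_le e r" "2 * (C * r) < 1"
  shows "ev e f \<odot> ev e h = ev e (nc_mult f h)"
proof -
  define F H where "F u = f u *\<^sub>R mon e u" and "H u = h u *\<^sub>R mon e u" for u
  note fs = ev_abs_summable[OF f(1) e] and hs = ev_abs_summable[OF h(1) e]
  have prod: "(\<lambda>p. norm (case p of (u, v) \<Rightarrow> F u \<odot> H v)) summable_on (UNIV \<times> UNIV)"
  proof (rule Infinite_Sum.abs_summable_on_comparison_test')
    have "(\<lambda>(u, v). norm (F u) * norm (H v)) summable_on UNIV \<times> UNIV"
      by (rule summable_on_SigmaI[where g = "\<lambda>u. norm (F u) * infsum (\<lambda>v. norm (H v)) UNIV"])
        (use fs hs in \<open>auto simp: F_def H_def intro!: has_sum_cmult_right summable_on_cmult_left has_sum_infsum\<close>)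
    then show "(\<lambda>p. bnd * (case p of (u, v) \<Rightarrow> norm (F u) * norm (H v))) summable_on UNIV \<times> UNIV"
      by (rule summable_on_cmult_right)
    show "norm (case p of (u, v) \<Rightarrow> F u \<odot> H v) \<le> bnd * (case p of (u, v) \<Rightarrow> norm (F u) * norm (H v))" for p
      using bnd(2) by (auto simp: mult.assoc split: prod.splits)
  qed
  define S where "S = infsum (\<lambda>(u, v). F u \<odot> H v) (UNIV \<times> UNIV)"
  have S: "((\<lambda>(u, v). F u \<odot> H v) has_sum S) (UNIV \<times> UNIV)"
    unfolding S_def by (rule has_sum_infsum[OF abs_summable_summable[OF prod]])
  have "((\<lambda>u. F u \<odot> ev e h) has_sum S) UNIV"
    by (rule has_sum_SigmaD[OF S])
      (auto simp: H_def intro!: has_sum_bounded_linear[OF bounded_linear_right, unfolded o_def] ev_has_sum h e)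
  moreover have "((\<lambda>u. F u \<odot> ev e h) has_sum (ev e f \<odot> ev e h)) UNIV"
    by (auto simp: F_def intro!: has_sum_bounded_linear[OF bounded_linear_left, unfolded o_def] ev_has_sum f e)
  ultimately have S_eq: "S = ev e f \<odot> ev e h" by (rule has_sum_unique)
  have bij: "bij_betw (\<lambda>(w, i). (take i w, drop i w)) (SIGMA w:UNIV. {..length w}) (UNIV \<times> UNIV)"
    by (rule bij_betwI[where g = "\<lambda>(u, v). (u @ v, length u)"]) auto
  have "((\<lambda>p. case (case p of (w, i) \<Rightarrow> (take i w, drop i w)) of (u, v) \<Rightarrow> F u \<odot> H v) has_sum S)
      (SIGMA w:UNIV. {..length w})"
    using has_sum_reindex_bij_betw[OF bij] S by blast
  then have "((\<lambda>w. \<Sum>i\<le>length w. F (take i w) \<odot> H (drop i w)) has_sum S) UNIV"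
    by (rule has_sum_SigmaD) (auto intro!: has_sum_finiteI)
  moreover have "(\<Sum>i\<le>length w. F (take i w) \<odot> H (drop i w)) = nc_mult f h w *\<^sub>R mon e w" for w
  proof -
    have "F (take i w) \<odot> H (drop i w) = (f (take i w) * h (drop i w)) *\<^sub>R mon e w" if "i \<le> length w" for i
    proof (cases "take i w = [] \<or> drop i w = []")
      case True
      then show ?thesis using f h by (auto simp: F_def H_def zero_left zero_right)
    next
      case False
      then show ?thesis using mon_append[of "take i w" "drop i w" e]
        by (simp add: F_def H_def scaleR_left scaleR_right)
    qed
    then show ?thesis by (simp add: nc_mult_def scaleR_sum_left)
  qed
  ultimately show ?thesis using S_eq by (simp add: ev_def infsumI)
qed

definition mult_op :: "real \<Rightarrow> real \<Rightarrow> 'a \<Rightarrow> 'a \<Rightarrow> 'a" where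
  "mult_op \<alpha> \<beta> Z x = \<alpha> *\<^sub>R (Z \<odot> x) + \<beta> *\<^sub>R (x \<odot> Z)"

lemma com_eq_mult_op: "com = mult_op 1 (-1)"
  by (auto simp: fun_eq_iff com_def mult_op_def)

lemma ev_mult_op_power:
  assumes z: "geo_bdd C z" "z [] = 0" and p: "geo_bdd C p" "p [] = 0" and ab: "\<bar>\<alpha>\<bar> \<le> 1" "\<bar>\<beta>\<bar> \<le> 1"
    and e: "size_le e r" "2 * (3 * C * r) < 1"
  shows "(mult_op \<alpha> \<beta> (ev e z) ^^ n) (ev e p) = ev e ((nc_ad \<alpha> \<beta> z ^^ n) p)"
proof (induction n)
  case (Suc n)
  let ?q = "(nc_ad \<alpha> \<beta> z ^^ n) p"
  have q: "geo_bdd (3 * C) ?q" by (rule geo_bdd_nc_ad_power) (use assms in auto)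
  have z3: "geo_bdd (3 * C) z" using z geo_bdd_nonneg[OF z(1)] by (auto intro: geo_bdd_mono)
  have "(mult_op \<alpha> \<beta> (ev e z) ^^ Suc n) (ev e p) = \<alpha> *\<^sub>R (ev e z \<odot> ev e ?q) + \<beta> *\<^sub>R (ev e ?q \<odot> ev e z)"
    by (simp add: Suc mult_op_def)
  also have "\<dots> = \<alpha> *\<^sub>R ev e (nc_mult z ?q) + \<beta> *\<^sub>R ev e (nc_mult ?q z)"
    using q z3 z p e by (simp add: ev_mult[where C = "3 * C" and r = r])
  also have "\<dots> = ev e (nc_ad \<alpha> \<beta> z ?q)"
    using ev_lincomb[symmetric, OF geo_bdd_nc_mult[OF z q] e, of \<alpha> \<beta>]
    by (simp only: nc_ad_def[of \<alpha> \<beta> z ?q, abs_def])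
  finally show ?case by simp
qed simp

text \<open>The double family over words and powers is absolutely summable because for each word only finitely many powers
contribute, with a geometric bound, so the two sums may be exchanged.\<close>

theorem fps_op_ev:
  assumes z: "geo_bdd C z" "z [] = 0" and p: "geo_bdd C p" "p [] = 0" and ab: "\<bar>\<alpha>\<bar> \<le> 1" "\<bar>\<beta>\<bar> \<le> 1"
    and B: "fps_geo_bdd B \<phi>" and e: "size_le e r" "2 * (6 * B * C * r) < 1"
  shows "(\<lambda>n. fps_nth \<phi> n *\<^sub>R (mult_op \<alpha> \<beta> (ev e z) ^^ n) (ev e p)) sums ev e (nc_fps \<alpha> \<beta> \<phi> z p)"
proof -
  have B1: "1 \<le> B" using B by (simp add: fps_geo_bdd_def)
  have C0: "0 \<le> C" using geo_bdd_nonneg z by blast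
  have r0: "0 \<le> r" using size_le_nonneg e by blast
  have "C * r \<le> B * (C * r)" using mult_right_mono[OF B1, of "C * r"] C0 r0 by simp
  then have e3: "2 * (3 * C * r) < 1" using e(2) mult_nonneg_nonneg[OF C0 r0] by (simp add: mult_ac)
  define h where "h = (\<lambda>(w, n). (fps_nth \<phi> n * (nc_ad \<alpha> \<beta> z ^^ n) p w) *\<^sub>R mon e w)"
  have supp: "h (w, n) = 0" if "n \<notin> {..length w}" for w n
    using that z p by (simp add: h_def nc_ad_power_short)
  have inner: "((\<lambda>n. h (w, n)) has_sum (nc_fps \<alpha> \<beta> \<phi> z p w *\<^sub>R mon e w)) UNIV" for w
  proof -
    have "((\<lambda>n. h (w, n)) has_sum (\<Sum>n\<le>length w. h (w, n))) {..length w}" by (simp add: has_sum_finite)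
    then have "((\<lambda>n. h (w, n)) has_sum (\<Sum>n\<le>length w. h (w, n))) UNIV"
      by (rule has_sum_cong_neutral[THEN iffD1, rotated -1]) (use supp in auto)
    then show ?thesis by (simp add: h_def nc_fps_def scaleR_sum_left)
  qed
  have inner': "((\<lambda>n. norm (h (w, n))) has_sum (\<Sum>n\<le>length w. norm (h (w, n)))) UNIV" for w
  proof -
    have "((\<lambda>n. norm (h (w, n))) has_sum (\<Sum>n\<le>length w. norm (h (w, n)))) {..length w}" by (simp add: has_sum_finite)
    then show ?thesis
      by (rule has_sum_cong_neutral[THEN iffD1, rotated -1]) (use supp in auto)
  qed
  have "(\<lambda>w. \<Sum>n\<le>length w. norm (h (w, n))) summable_on UNIV"
  proof -
    have "(\<Sum>n\<le>length w. norm (h (w, n))) \<le> (6 * B * C * r) ^ length w" for w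
    proof -
      have "(\<Sum>n\<le>length w. norm (h (w, n))) = (\<Sum>n\<le>length w. \<bar>fps_nth \<phi> n * (nc_ad \<alpha> \<beta> z ^^ n) p w\<bar>) * norm (mon e w)"
        by (simp add: h_def sum_distrib_right)
      also have "\<dots> \<le> (6 * B * C) ^ length w * r ^ length w"
        using nc_fps_abs_bound[OF z p ab B, of w] norm_mon[OF e(1), of w] B1 C0
        by (intro mult_mono) auto
      finally show ?thesis by (simp only: power_mult_distrib)
    qed
    then have "(\<lambda>w. norm (\<Sum>n\<le>length w. norm (h (w, n)))) summable_on UNIV"
      by (intro Infinite_Sum.abs_summable_on_comparison_test'[OF summable_words[of "6 * B * C * r"]])
         (use B1 C0 r0 e(2) in \<open>auto simp: sum_nonneg\<close>)
    then show ?thesis by (simp add: sum_nonneg)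
  qed
  then have "(\<lambda>p. norm (h p)) summable_on (UNIV \<times> UNIV)"
    by (intro summable_on_SigmaI[OF inner']) auto
  then have hs: "h summable_on (UNIV \<times> UNIV)" by (rule abs_summable_summable)
  define S where "S = infsum h (UNIV \<times> UNIV)"
  have S: "(h has_sum S) (UNIV \<times> UNIV)" unfolding S_def using hs by (rule has_sum_infsum)
  then have "((\<lambda>w. nc_fps \<alpha> \<beta> \<phi> z p w *\<^sub>R mon e w) has_sum S) UNIV"
    by (rule has_sum_SigmaD) (rule inner)
  then have S_eq: "S = ev e (nc_fps \<alpha> \<beta> \<phi> z p)" by (simp add: ev_def infsumI)
  have "((\<lambda>q. h (prod.swap q)) has_sum S) (UNIV \<times> UNIV)"
    using S has_sum_reindex_bij_betw[of prod.swap "UNIV \<times> UNIV" "UNIV \<times> UNIV" h] by (simp add: bij_betw_def)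
  then have "((\<lambda>n. fps_nth \<phi> n *\<^sub>R ev e ((nc_ad \<alpha> \<beta> z ^^ n) p)) has_sum S) UNIV"
  proof (rule has_sum_SigmaD)
    fix n
    have "geo_bdd (3 * C) ((nc_ad \<alpha> \<beta> z ^^ n) p)" by (rule geo_bdd_nc_ad_power) (use z p ab in auto)
    from has_sum_scaleR[OF ev_has_sum[OF this e(1) e3], of "fps_nth \<phi> n"]
    show "((\<lambda>w. h (prod.swap (n, w))) has_sum (fps_nth \<phi> n *\<^sub>R ev e ((nc_ad \<alpha> \<beta> z ^^ n) p))) UNIV"
      by (simp add: h_def)
  qed
  then have "(\<lambda>n. fps_nth \<phi> n *\<^sub>R ev e ((nc_ad \<alpha> \<beta> z ^^ n) p)) sums S" by (rule has_sum_imp_sums)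
  then show ?thesis unfolding ev_mult_op_power[OF z p ab e(1) e3] S_eq .
qed

end

section \<open>The scalar power series\<close>

lemma fps_geo_bdd_mono: "fps_geo_bdd B \<phi> \<Longrightarrow> B \<le> B' \<Longrightarrow> fps_geo_bdd B' \<phi>"
  unfolding fps_geo_bdd_def
proof (elim conjE, intro conjI allI)
  fix n assume "B \<le> B'" "1 \<le> B" "\<forall>n. \<bar>fps_nth \<phi> n\<bar> \<le> B ^ Suc n"
  then show "\<bar>fps_nth \<phi> n\<bar> \<le> B' ^ Suc n" using power_mono[of B B' "Suc n"] order_trans by fastforce
qed simp

lemma fps_geo_bdd_if_conv_radius_pos:
  fixes \<phi> :: "real fps"
  assumes "fps_conv_radius \<phi> > 0"
  shows "\<exists>B. fps_geo_bdd B \<phi>"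
proof -
  obtain x where x: "0 < ereal x" "ereal x < fps_conv_radius \<phi>" using ereal_dense2[OF assms] by auto
  then have "summable (\<lambda>n. fps_nth \<phi> n * x ^ n)" by (intro summable_fps) auto
  then obtain M where M: "\<And>n. \<bar>fps_nth \<phi> n * x ^ n\<bar> \<le> M"
    using summable_imp_Bseq unfolding Bseq_def by (metis real_norm_def)
  define B where "B = max 1 (max M (1 / x))"
  have "\<bar>fps_nth \<phi> n\<bar> \<le> B ^ Suc n" for n
  proof -
    have "\<bar>fps_nth \<phi> n\<bar> = \<bar>fps_nth \<phi> n * x ^ n\<bar> * (1 / x) ^ n"
      using x by (simp add: abs_mult power_divide)
    also have "\<dots> \<le> B * B ^ n"
      using M[of n] x by (intro mult_mono power_mono) (auto simp: B_def)
    finally show ?thesis by simp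
  qed
  then show ?thesis by (auto simp: fps_geo_bdd_def B_def intro!: exI[of _ B])
qed

lemma fps_conv_radius_pos_if_bounded:
  fixes \<phi> :: "real fps"
  assumes "\<And>n. \<bar>fps_nth \<phi> n\<bar> \<le> 1"
  shows "fps_conv_radius \<phi> > 0"
proof -
  have "summable (\<lambda>n. fps_nth \<phi> n * (1 / 2) ^ n)"
    by (rule summable_comparison_test[OF _ summable_geometric[of "1 / 2"]])
      (use assms in \<open>auto simp: abs_mult intro!: exI[of _ 0] mult_left_le_one_le\<close>)
  then have "conv_radius (fps_nth \<phi>) \<ge> norm (1 / 2 :: real)" by (rule conv_radius_geI)
  then have "fps_conv_radius \<phi> \<ge> ereal (1 / 2)" by (simp add: fps_conv_radius_def)
  then show ?thesis using less_le_trans[of 0 "ereal (1 / 2)"] by (simp add: zero_ereal_def)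
qed

text \<open>The power series \<open>(exp(t X) - \<dots>) / (t X)^k\<close>, where the dots stand for the terms of degree less than \<open>k\<close>, extended by continuity to \<open>t = 0\<close>.\<close>

definition exp_tail :: "real \<Rightarrow> nat \<Rightarrow> real fps" where
  "exp_tail t k = Abs_fps (\<lambda>n. t ^ n / fact (n + k))"

lemma exp_tail_nth [simp]: "fps_nth (exp_tail t k) n = t ^ n / fact (n + k)"
  by (simp add: exp_tail_def)

lemma exp_tail_nth_bound: "\<bar>t\<bar> \<le> 1 \<Longrightarrow> \<bar>fps_nth (exp_tail t k) n\<bar> \<le> 1"
proof -
  assume t: "\<bar>t\<bar> \<le> 1"
  have "\<bar>t\<bar> ^ n / fact (n + k) \<le> 1 / 1"
    using t by (intro frac_le power_le_one) auto
  then show ?thesis by (simp add: power_abs)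
qed

lemma one_minus_exp: "1 - fps_exp (- t) = fps_X * (fps_const t * exp_tail (- t) 1)"
proof (rule fps_ext)
  fix n show "fps_nth (1 - fps_exp (- t)) n = fps_nth (fps_X * (fps_const t * exp_tail (- t) 1)) n"
    by (cases n) (auto simp del: fact_Suc)
qed

lemma exp_minus_one: "fps_exp 1 - 1 = fps_X * exp_tail 1 1"
proof (rule fps_ext)
  fix n show "fps_nth (fps_exp 1 - 1) n = fps_nth (fps_X * exp_tail 1 1) n"
    by (cases n) (auto simp del: fact_Suc)
qed

lemma exp_minus_one_minus_X: "fps_exp 1 - 1 - fps_X = fps_X * (fps_X * exp_tail 1 2)"
proof (rule fps_ext)
  fix n show "fps_nth (fps_exp 1 - 1 - fps_X) n = fps_nth (fps_X * (fps_X * exp_tail 1 2)) n"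
  proof (cases n)
    case (Suc m) then show ?thesis by (cases m) (auto simp del: fact_Suc simp: numeral_2_eq_2)
  qed auto
qed

lemma todd_fps_eq: "todd_fps = inverse (exp_tail 1 1)"
  unfolding todd_fps_def exp_minus_one
  using div_mult_mult1[of "fps_X :: real fps" 1 "exp_tail 1 1"]
  by (simp add: fps_divide_unit)

lemma quot_fps_eq: "quot_fps t = fps_const t * exp_tail (- t) 1 * inverse (exp_tail (- 1) 1)"
  unfolding quot_fps_def one_minus_exp
  by (subst div_mult_mult1) (simp_all add: fps_divide_unit)

lemma quot_fps_nth: "fps_nth (quot_fps t) n =
    (\<Sum>i=0..n. t * fps_nth (exp_tail (- t) 1) i * fps_nth (inverse (exp_tail (- 1) 1)) (n - i))"
  unfolding quot_fps_eq mult.assoc fps_mult_left_const_nth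
  unfolding fps_mult_nth sum_distrib_left by (simp add: mult.assoc)

lemma psi_fps_eq: "psi_fps = exp_tail 1 2 * inverse (exp_tail 1 1 * exp_tail (- 1) 1)"
proof -
  have "psi_fps = ((fps_X * fps_X) * exp_tail 1 2) / ((fps_X * fps_X) * (exp_tail 1 1 * exp_tail (- 1) 1))"
    unfolding psi_fps_def exp_minus_one_minus_X unfolding exp_minus_one one_minus_exp
    by (simp add: mult_ac)
  also have "\<dots> = exp_tail 1 2 / (exp_tail 1 1 * exp_tail (- 1) 1)"
    by (rule div_mult_mult1) simp
  finally show ?thesis by (simp add: fps_divide_unit)
qed

lemma exp_tail_conv_radius: "\<bar>t\<bar> \<le> 1 \<Longrightarrow> fps_conv_radius (exp_tail t k) > 0"
  using fps_conv_radius_pos_if_bounded exp_tail_nth_bound by blast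

text \<open>The bound for the quotients has to be uniform in \<open>t\<close> since the integrand is summed and integrated term by
term.\<close>

lemma kv_fps_geo_bdd:
  obtains B where "fps_geo_bdd B psi_fps" "fps_geo_bdd B todd_fps" "fps_geo_bdd B (fps_exp 1)"
    "\<And>t. t \<in> {0..1} \<Longrightarrow> fps_geo_bdd B (quot_fps t)"
proof -
  have mult: "fps_conv_radius (f * g) > 0" if "fps_conv_radius f > 0" "fps_conv_radius g > 0" for f g :: "real fps"
    using fps_conv_radius_mult[of f g] that by (meson less_le_trans min_less_iff_conj)
  have inv: "fps_conv_radius (inverse f) > 0" if "fps_conv_radius f > 0" "fps_nth f 0 \<noteq> 0" for f :: "real fps"
    using fps_conv_radius_inverse_pos that by blast
  obtain B1 where B1: "fps_geo_bdd B1 psi_fps"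
    unfolding psi_fps_eq
    using fps_geo_bdd_if_conv_radius_pos[OF mult[OF exp_tail_conv_radius inv[OF mult[OF exp_tail_conv_radius exp_tail_conv_radius]]]]
    by force
  obtain B2 where B2: "fps_geo_bdd B2 todd_fps"
    unfolding todd_fps_eq using fps_geo_bdd_if_conv_radius_pos[OF inv[OF exp_tail_conv_radius]] by force
  obtain B3 where B3: "fps_geo_bdd B3 (inverse (exp_tail (- 1) 1))"
    using fps_geo_bdd_if_conv_radius_pos[OF inv[OF exp_tail_conv_radius]] by force
  have B3': "1 \<le> B3" using B3 by (simp add: fps_geo_bdd_def)
  have quot: "fps_geo_bdd (2 * B3) (quot_fps t)" if t: "t \<in> {0..1}" for t
    unfolding fps_geo_bdd_def
  proof (intro conjI allI)
    fix n
    have "\<bar>fps_nth (quot_fps t) n\<bar> \<le> (\<Sum>i=0..n. \<bar>t * fps_nth (exp_tail (- t) 1) i * fps_nth (inverse (exp_tail (- 1) 1)) (n - i)\<bar>)"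
      unfolding quot_fps_nth by (rule sum_abs)
    also have "\<dots> \<le> (\<Sum>i=0..n. 1 * B3 ^ Suc n)"
    proof (rule sum_mono)
      fix i assume i: "i \<in> {0..n}"
      have "\<bar>t\<bar> * \<bar>fps_nth (exp_tail (- t) 1) i\<bar> \<le> 1 * 1"
        using t exp_tail_nth_bound[of "- t" 1 i] by (intro mult_mono) auto
      moreover have "\<bar>fps_nth (inverse (exp_tail (- 1) 1)) (n - i)\<bar> \<le> B3 ^ Suc n"
        using B3 B3' power_increasing[of "Suc (n - i)" "Suc n" B3] order_trans unfolding fps_geo_bdd_def
        by (metis Suc_le_mono diff_le_self)
      ultimately show "\<bar>t * fps_nth (exp_tail (- t) 1) i * fps_nth (inverse (exp_tail (- 1) 1)) (n - i)\<bar> \<le> 1 * B3 ^ Suc n"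
        unfolding abs_mult by (intro mult_mono) auto
    qed
    also have "\<dots> = real (Suc n) * B3 ^ Suc n" by simp
    also have "\<dots> \<le> 2 ^ Suc n * B3 ^ Suc n"
      using of_nat_less_two_power[of "Suc n", where 'a = real] B3' by (intro mult_right_mono) auto
    finally show "\<bar>fps_nth (quot_fps t) n\<bar> \<le> (2 * B3) ^ Suc n" by (simp only: power_mult_distrib)
  qed (use B3' in auto)
  have exp1: "fps_geo_bdd 1 (fps_exp 1)" by (auto simp: fps_geo_bdd_def)
  define B where "B = max (max B1 B2) (2 * B3)"
  show ?thesis
  proof (rule that[of B])
    show "fps_geo_bdd B (quot_fps t)" if "t \<in> {0..1}" for t
      by (rule fps_geo_bdd_mono[OF quot[OF that]]) (simp add: B_def)
    show "fps_geo_bdd B (fps_exp 1)"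
      by (rule fps_geo_bdd_mono[OF exp1]) (use B3' in \<open>auto simp: B_def\<close>)
  qed (use B1 B2 in \<open>auto intro: fps_geo_bdd_mono simp: B_def\<close>)
qed

section \<open>The Kashiwara-Vergne series as noncommutative series\<close>

definition letter :: "bool \<Rightarrow> nc_series" where
  "letter a w = (if w = [a] then 1 else 0)"

definition two_letters :: nc_series where
  "two_letters w = letter False w + letter True w"

definition scale_series :: "real \<Rightarrow> nc_series \<Rightarrow> nc_series" where
  "scale_series t f w = t ^ length w * f w"

definition z_series :: nc_series where
  "z_series = nc_log (nc_mult (nc_exp False) (nc_exp True))"

definition kv_integrand :: "real \<Rightarrow> nc_series" where
  "kv_integrand t = nc_fps 1 (-1) (quot_fps t) (letter False)
     (nc_fps 1 (-1) psi_fps (scale_series t z_series) two_letters)"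

definition F1_series :: nc_series where
  "F1_series w = integral {0..1} (\<lambda>t. kv_integrand t w)"

definition F0_series :: nc_series where
  "F0_series w = 1 / 2 * (F1_series w + nc_fps 1 (-1) (fps_exp 1) (letter False) (scale_series (-1) F1_series) w)
     + 1 / 4 * (z_series w - letter False w)"

lemma geo_bdd_letter: "geo_bdd 1 (letter a)"
  by (auto simp: geo_bdd_def letter_def)

lemma geo_bdd_two_letters: "geo_bdd 1 two_letters"
  by (auto simp: geo_bdd_def letter_def two_letters_def)

lemma geo_bdd_scale: "\<bar>t\<bar> \<le> 1 \<Longrightarrow> geo_bdd C f \<Longrightarrow> geo_bdd C (scale_series t f)"
  unfolding geo_bdd_def scale_series_def abs_mult power_abs
  using power_le_one[of "\<bar>t\<bar>"] mult_left_le_one_le[of "\<bar>f w\<bar>" "\<bar>t\<bar> ^ length w" for w]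
  by (meson abs_ge_zero order_trans zero_le_power)

lemma geo_bdd_z: "geo_bdd 12 z_series"
proof -
  define q where "q v = nc_mult (nc_exp False) (nc_exp True) v - nc_one v" for v
  have q0: "q [] = 0" by (simp add: q_def nc_exp_def nc_one_def)
  have "geo_bdd 2 q"
    unfolding geo_bdd_def
  proof
    fix w
    show "\<bar>q w\<bar> \<le> 2 ^ length w"
    proof (cases "w = []")
      case False
      have e: "\<bar>nc_exp a v\<bar> \<le> 1" for a v by (auto simp: nc_exp_def)
      have "\<bar>q w\<bar> \<le> (\<Sum>i\<le>length w. \<bar>nc_exp False (take i w) * nc_exp True (drop i w)\<bar>)"
        using False by (simp add: q_def nc_one_def nc_mult_def sum_abs)
      also have "\<dots> \<le> (\<Sum>i\<le>length w. 1)"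
        using e by (intro sum_mono) (auto simp: abs_mult intro!: mult_le_one)
      also have "\<dots> = real (Suc (length w))" by simp
      also have "\<dots> \<le> real (2 ^ length w)"
        using less_exp[of "length w"] by (intro of_nat_mono) (simp add: Suc_le_eq)
      finally show ?thesis by simp
    qed (simp add: q0)
  qed
  have pow: "geo_bdd (3 * 2) (nc_power q k)" for k
  proof (induction k)
    case 0
    then show ?case by (auto simp: geo_bdd_def nc_one_def)
  next
    case (Suc k)
    then show ?case using geo_bdd_nc_mult(1)[OF \<open>geo_bdd 2 q\<close> q0] by simp
  qed
  show ?thesis
    unfolding geo_bdd_def z_series_def nc_log_def q_def[symmetric, abs_def]
  proof
    fix w
    have "\<bar>\<Sum>k = 1..length w. (- 1) ^ (k + 1) / real k * nc_power q k w\<bar> \<le> (\<Sum>k = 1..length w. 1 * 6 ^ length w)"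
    proof (rule order_trans[OF sum_abs], rule sum_mono)
      fix k assume "k \<in> {1..length w}"
      then have "\<bar>(- 1) ^ (k + 1) / real k\<bar> * \<bar>nc_power q k w\<bar> \<le> 1 * 6 ^ length w"
        using geo_bddD[OF pow, of k w] by (intro mult_mono) (auto simp: divide_simps)
      then show "\<bar>(- 1) ^ (k + 1) / real k * nc_power q k w\<bar> \<le> 1 * 6 ^ length w" by (simp add: abs_mult)
    qed
    also have "\<dots> \<le> 2 ^ length w * 6 ^ length w"
      using of_nat_less_two_power[of "length w", where 'a = real] by simp
    finally show "\<bar>\<Sum>k = 1..length w. (- 1) ^ (k + 1) / real k * nc_power q k w\<bar> \<le> 12 ^ length w"
      by (simp flip: power_mult_distrib)
  qed
qed

lemma series_Nil [simp]:
  "letter a [] = 0" "two_letters [] = 0" "z_series [] = 0" "scale_series t f [] = f []"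
  "kv_integrand t [] = 0" "F1_series [] = 0" "F0_series [] = 0"
proof -
  show 1: "letter a [] = 0" "two_letters [] = 0" "z_series [] = 0" "scale_series t f [] = f []" for a t f
    by (simp_all add: letter_def two_letters_def z_series_def nc_log_def scale_series_def)
  show 2: "kv_integrand t [] = 0" for t by (simp add: kv_integrand_def 1)
  show 3: "F1_series [] = 0" by (simp add: F1_series_def 2)
  show "F0_series [] = 0" by (simp add: F0_series_def 1 3)
qed

lemma continuous_on_nc_mult:
  assumes "\<And>w. continuous_on T (\<lambda>t. f t w)" "\<And>w. continuous_on T (\<lambda>t. h t w)"
  shows "continuous_on T (\<lambda>t. nc_mult (f t) (h t) w)"
  unfolding nc_mult_def by (intro continuous_intros assms)

lemma continuous_on_nc_fps:
  assumes "\<And>w. continuous_on T (\<lambda>t. z t w)" "\<And>w. continuous_on T (\<lambda>t. p t w)"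
    "\<And>n. continuous_on T (\<lambda>t. fps_nth (\<phi> t) n)"
  shows "continuous_on T (\<lambda>t. nc_fps \<alpha> \<beta> (\<phi> t) (z t) (p t) w)"
proof -
  have "continuous_on T (\<lambda>t. (nc_ad \<alpha> \<beta> (z t) ^^ n) (p t) w)" for n w
  proof (induction n arbitrary: w)
    case (Suc n)
    show ?case
      unfolding funpow.simps o_apply by (subst nc_ad_def) (intro continuous_intros continuous_on_nc_mult Suc assms)
  qed (use assms in auto)
  then show ?thesis unfolding nc_fps_def by (intro continuous_intros assms)
qed

lemma continuous_on_kv_integrand: "continuous_on T (\<lambda>t. kv_integrand t w)"
proof -
  have "continuous_on T (\<lambda>t. fps_nth (quot_fps t) n)" for n
    unfolding quot_fps_nth exp_tail_nth by (intro continuous_intros) auto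
  then show ?thesis
    unfolding kv_integrand_def
    by (intro continuous_on_nc_fps) (auto simp: scale_series_def intro!: continuous_intros)
qed

lemma geo_bdd_integral:
  fixes f :: "real \<Rightarrow> nc_series"
  assumes "\<And>t. t \<in> {0..1} \<Longrightarrow> geo_bdd C (f t)" "\<And>w. continuous_on {0..1} (\<lambda>t. f t w)"
  shows "geo_bdd C (\<lambda>w. integral {0..1} (\<lambda>t. f t w))"
  unfolding geo_bdd_def
proof
  fix w
  have "norm (integral {0..1} (\<lambda>t. f t w)) \<le> C ^ length w * (1 - 0)"
    by (rule Henstock_Kurzweil_Integration.integral_bound) (use assms geo_bddD in auto)
  then show "\<bar>integral {0..1} (\<lambda>t. f t w)\<bar> \<le> C ^ length w" by simp
qed

context banach_product begin

lemma mon_scale: "mon (\<lambda>a. c *\<^sub>R e a) w = c ^ length w *\<^sub>R mon e w"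
proof (induction w)
  case (Cons a w)
  then show ?case by (cases "w = []") (auto simp: mon_Cons scaleR_left scaleR_right)
qed simp

lemma ev_scale: "ev (\<lambda>a. c *\<^sub>R e a) f = ev e (scale_series c f)"
  by (simp add: ev_def mon_scale scale_series_def mult.commute)

lemma size_le_scale: "size_le e r \<Longrightarrow> \<bar>c\<bar> \<le> 1 \<Longrightarrow> size_le (\<lambda>a. c *\<^sub>R e a) r"
  unfolding size_le_def
proof
  fix a assume r: "\<forall>a. bnd * norm (e a) \<le> r" and c: "\<bar>c\<bar> \<le> 1"
  have "\<bar>c\<bar> * (bnd * norm (e a)) \<le> 1 * (bnd * norm (e a))"
    using bnd(1) c by (intro mult_right_mono) auto
  with r show "bnd * norm (c *\<^sub>R e a) \<le> r" by (simp add: mult_ac) (meson order_trans)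
qed

lemma ev_letter: "ev e (letter a) = e a"
proof -
  have "((\<lambda>w. letter a w *\<^sub>R mon e w) has_sum (\<Sum>w\<in>{[a]}. letter a w *\<^sub>R mon e w)) {[a]}"
    by (rule has_sum_finite) simp
  then have "((\<lambda>w. letter a w *\<^sub>R mon e w) has_sum (\<Sum>w\<in>{[a]}. letter a w *\<^sub>R mon e w)) UNIV"
    by (rule has_sum_cong_neutral[THEN iffD1, rotated -1]) (auto simp: letter_def)
  then show ?thesis unfolding ev_def by (intro infsumI) (simp add: letter_def)
qed

lemma ev_two_letters:
  assumes "size_le e r" "2 * r < 1"
  shows "ev e two_letters = e False + e True"
  using ev_lincomb[OF geo_bdd_letter[of False] geo_bdd_letter[of True] assms(1), of 1 1] assms
  by (simp add: ev_letter two_letters_def[abs_def])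

text \<open>By the Dynkin-Specht-Wever theorem the homogeneous components agree.\<close>

theorem ch_eq_ev:
  assumes "size_le e r" "2 * (12 * r) < 1"
  shows "ch com (e False) (e True) = ev e z_series"
proof -
  have "(\<lambda>a. if a then e True else e False) = e" by auto
  then have "ch_component com n (e False) (e True) = (\<Sum>w | length w = n. z_series w *\<^sub>R mon e w)" for n
    by (simp add: ch_component_eq z_series_def)
  then show ?thesis
    unfolding ch_def using ev_sums[OF geo_bdd_z assms] by (simp add: sums_iff)
qed

text \<open>The homogeneous components are bounded by a geometric sequence uniformly in \<open>t\<close>, so their sum converges uniformly
and can be integrated term by term.\<close>

theorem integral_ev:
  fixes f :: "real \<Rightarrow> nc_series"
  assumes f: "\<And>t. t \<in> {0..1} \<Longrightarrow> geo_bdd C (f t)" and cont: "\<And>w. continuous_on {0..1} (\<lambda>t. f t w)"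
    and e: "size_le e r" "2 * (C * r) < 1"
  shows "integral {0..1} (\<lambda>t. ev e (f t)) = ev e (\<lambda>w. integral {0..1} (\<lambda>t. f t w))"
proof -
  define g where "g n t = (\<Sum>w | length w = n. f t w *\<^sub>R mon e w)" for n t
  have C0: "0 \<le> C" by (rule geo_bdd_nonneg[OF f[of 0]]) simp
  have r0: "0 \<le> r" using size_le_nonneg e by blast
  have bound: "norm (g n t) \<le> (2 * (C * r)) ^ n" if "t \<in> {0..1}" for n t
  proof -
    have "norm (g n t) \<le> (\<Sum>w :: bool list | length w = n. (C * r) ^ length w)"
      unfolding g_def by (rule sum_norm_le) (use norm_term[OF f[OF that] e(1)] in auto)
    then show ?thesis by (simp only: sum_words_power)
  qed
  have ul: "uniform_limit {0..1} (\<lambda>N t. \<Sum>n<N. g n t) (\<lambda>t. \<Sum>n. g n t) sequentially"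
    by (rule Weierstrass_m_test[OF bound], assumption, rule summable_geometric) (use C0 r0 e in auto)
  have geq: "(\<Sum>n. g n t) = ev e (f t)" if "t \<in> {0..1}" for t
    using ev_sums[OF f[OF that] e] by (simp add: g_def sums_iff)
  have lim: "uniform_limit {0..1} (\<lambda>N t. \<Sum>n<N. g n t) (\<lambda>t. ev e (f t)) sequentially"
    using ul by (rule uniform_limit_cong'[THEN iffD1, rotated -1]) (use geq in auto)
  have gcont: "continuous_on {0..1} (\<lambda>t. \<Sum>n<N. g n t)" for N
    unfolding g_def by (intro continuous_intros cont)
  obtain I J where I: "\<And>N. ((\<lambda>t. \<Sum>n<N. g n t) has_integral I N) {0..1}"
    and J: "((\<lambda>t. ev e (f t)) has_integral J) {0..1}" and IJ: "I \<longlonglongrightarrow> J"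
    using uniform_limit_integral[OF lim gcont] by auto
  have "((\<lambda>t. \<Sum>n<N. g n t) has_integral (\<Sum>n<N. \<Sum>w | length w = n. integral {0..1} (\<lambda>t. f t w) *\<^sub>R mon e w)) {0..1}" for N
    unfolding g_def
    by (intro has_integral_sum has_integral_scaleR_left integrable_integral integrable_continuous_interval cont) auto
  then have "I = (\<lambda>N. \<Sum>n<N. \<Sum>w | length w = n. integral {0..1} (\<lambda>t. f t w) *\<^sub>R mon e w)"
    using I has_integral_unique by blast
  with IJ have "(\<lambda>n. \<Sum>w | length w = n. integral {0..1} (\<lambda>t. f t w) *\<^sub>R mon e w) sums J"
    by (simp add: sums_def)
  moreover have "(\<lambda>n. \<Sum>w | length w = n. integral {0..1} (\<lambda>t. f t w) *\<^sub>R mon e w) sums ev e (\<lambda>w. integral {0..1} (\<lambda>t. f t w))"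
    by (rule ev_sums[OF geo_bdd_integral e]) (use f cont in auto)
  ultimately show ?thesis using J by (simp add: sums_iff integral_unique)
qed

lemma fps_op_com_ev:
  assumes "geo_bdd C z" "z [] = 0" "geo_bdd C p" "p [] = 0" "fps_geo_bdd B \<phi>"
    "size_le e r" "2 * (6 * B * C * r) < 1"
  shows "fps_op \<phi> (com (ev e z)) (ev e p) = ev e (nc_fps 1 (-1) \<phi> z p)"
  unfolding com_eq_mult_op fps_op_def by (rule sums_unique[symmetric, OF fps_op_ev]) (use assms in auto)

lemma size_le_mono: "size_le e r \<Longrightarrow> r \<le> r' \<Longrightarrow> size_le e r'"
  unfolding size_le_def by (meson order_trans)

text \<open>Each constituent of the definition is the value of a series: the integrand by applying \<open>fps_op_com_ev\<close> twice, the
integral by \<open>integral_ev\<close>, and the outer terms by one more application. Each application multiplies the growth rate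
by \<open>6 * B\<close>, whence the three constants \<open>C2\<close>, \<open>C3\<close>, \<open>C4\<close>.\<close>

theorem kv_F0_eq_ev:
  obtains C r where "0 < r" "geo_bdd C F0_series" "2 * (C * r) < 1"
    "\<And>e. size_le e r \<Longrightarrow> kv_F0 com (e False) (e True) = ev e F0_series"
proof -
  obtain B where B: "fps_geo_bdd B psi_fps" "fps_geo_bdd B (fps_exp 1)"
    "\<And>t. t \<in> {0..1} \<Longrightarrow> fps_geo_bdd B (quot_fps t)"
    using kv_fps_geo_bdd by metis
  have B1: "1 \<le> B" using B(1) by (simp add: fps_geo_bdd_def)
  define C2 where "C2 = 6 * B * 12"
  define C3 where "C3 = 6 * B * C2"
  define C4 where "C4 = 6 * B * C3"
  have le: "12 \<le> C2" "C2 \<le> C3" "C3 \<le> C4" "1 \<le> C2" "1 \<le> C3" "1 \<le> C4"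
  proof -
    show "12 \<le> C2" using B1 by (simp add: C2_def)
    have "c \<le> 6 * B * c" if "0 \<le> c" for c using mult_right_mono[of 1 "6 * B" c] B1 that by simp
    then show "C2 \<le> C3" "C3 \<le> C4" using \<open>12 \<le> C2\<close> B1 by (auto simp: C3_def C4_def)
    then show "1 \<le> C2" "1 \<le> C3" "1 \<le> C4" using \<open>12 \<le> C2\<close> by auto
  qed
  \<comment> \<open>with this radius all three evaluations converge\<close>
  define r where "r = 1 / (4 * C4)"
  have r: "0 < r" and rC: "2 * (C4 * r) < 1" using le by (auto simp: r_def)
  have rc: "2 * (c * r) < 1" if "c \<le> C4" for c
    using mult_right_mono[OF that less_imp_le[OF r]] rC by linarith
  define p where "p t = nc_fps 1 (-1) psi_fps (scale_series t z_series) two_letters" for t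
  have p: "geo_bdd C2 (p t)" "p t [] = 0" if "t \<in> {0..1}" for t
    unfolding p_def C2_def
    by (rule geo_bdd_nc_fps)
      (use that geo_bdd_scale[OF _ geo_bdd_z] geo_bdd_mono[OF geo_bdd_two_letters] B in auto)
  have x: "geo_bdd c (letter False)" if "1 \<le> c" for c using geo_bdd_mono[OF geo_bdd_letter that] .
  have k: "geo_bdd C3 (kv_integrand t)" if "t \<in> {0..1}" for t
    unfolding kv_integrand_def C3_def p_def[symmetric]
    by (rule geo_bdd_nc_fps) (use that p x le B in auto)
  have F1b: "geo_bdd C3 F1_series"
    unfolding F1_series_def by (rule geo_bdd_integral) (use k continuous_on_kv_integrand in auto)
  have F1_eq: "kv_F1 com (e False) (e True) = ev e F1_series" if e: "size_le e r" for e
  proof -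
    have "(fps_op (quot_fps t) (com (e False)) \<circ> fps_op psi_fps (com (ch com (t *\<^sub>R e False) (t *\<^sub>R e True))))
        (e False + e True) = ev e (kv_integrand t)" if t: "t \<in> {0..1}" for t
    proof -
      have "ch com (t *\<^sub>R e False) (t *\<^sub>R e True) = ev e (scale_series t z_series)"
        using ch_eq_ev[of "\<lambda>a. t *\<^sub>R e a" r] size_le_scale[OF e] t rc[of 12] le by (simp add: ev_scale)
      moreover have "e False + e True = ev e two_letters"
        using ev_two_letters[OF e] rc[of 1] le by simp
      moreover have "fps_op psi_fps (com (ev e (scale_series t z_series))) (ev e two_letters) = ev e (p t)"
        unfolding p_def
        by (rule fps_op_com_ev[of 12 _ _ B _ _ r])
          (use t geo_bdd_scale[OF _ geo_bdd_z] geo_bdd_mono[OF geo_bdd_two_letters] B e rc[of C2] le in \<open>auto simp: C2_def\<close>)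
      moreover have "fps_op (quot_fps t) (com (ev e (letter False))) (ev e (p t)) = ev e (kv_integrand t)"
        unfolding kv_integrand_def p_def[symmetric]
        by (rule fps_op_com_ev[of C2 _ _ B _ _ r]) (use t p x B e rc[of C3] le in \<open>auto simp: C3_def\<close>)
      ultimately show ?thesis by (simp add: ev_letter)
    qed
    then have "kv_F1 com (e False) (e True) = integral {0..1} (\<lambda>t. ev e (kv_integrand t))"
      unfolding kv_F1_def by (intro integral_cong) auto
    also have "\<dots> = ev e F1_series"
      unfolding F1_series_def[abs_def]
      by (rule integral_ev[OF k continuous_on_kv_integrand e]) (use rc[of C3] le in auto)
    finally show ?thesis .
  qed
  define q where "q = nc_fps 1 (-1) (fps_exp 1) (letter False) (scale_series (-1) F1_series)"
  have qb: "geo_bdd C4 q"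
    unfolding q_def C4_def by (rule geo_bdd_nc_fps) (use x le F1b geo_bdd_scale B in auto)
  have F0_eq: "kv_F0 com (e False) (e True) = ev e F0_series" if e: "size_le e r" for e
  proof -
    have "kv_F1 com (- e False) (- e True) = ev e (scale_series (-1) F1_series)"
      using F1_eq[OF size_le_scale[OF e, of "-1"]] ev_scale[of "-1" e F1_series] by simp
    moreover have "fps_op (fps_exp 1) (com (ev e (letter False))) (ev e (scale_series (-1) F1_series)) = ev e q"
      unfolding q_def
      by (rule fps_op_com_ev[of C3 _ _ B _ _ r]) (use x le F1b geo_bdd_scale B e rC in \<open>auto simp: C4_def\<close>)
    moreover have "ch com (e False) (e True) = ev e z_series"
      using ch_eq_ev[OF e] rc[of 12] le by simp
    ultimately have "kv_F0 com (e False) (e True) =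
        (1 / 2) *\<^sub>R (ev e F1_series + ev e q) + (1 / 4) *\<^sub>R (ev e z_series - ev e (letter False))"
      using F1_eq[OF e] by (simp add: kv_F0_def ev_letter)
    also have "\<dots> = ev e F0_series"
    proof -
      have hs: "((\<lambda>w. f w *\<^sub>R mon e w) has_sum ev e f) UNIV" if "geo_bdd c f" "c \<le> C4" for c f
        by (rule ev_has_sum[OF geo_bdd_mono[OF that] e rC])
      have "((\<lambda>w. (1 / 2) *\<^sub>R (F1_series w *\<^sub>R mon e w + q w *\<^sub>R mon e w)
          + (1 / 4) *\<^sub>R (z_series w *\<^sub>R mon e w + (-1) *\<^sub>R (letter False w *\<^sub>R mon e w))) has_sum
          ((1 / 2) *\<^sub>R (ev e F1_series + ev e q) + (1 / 4) *\<^sub>R (ev e z_series + (-1) *\<^sub>R ev e (letter False)))) UNIV"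
        by (intro has_sum_add has_sum_scaleR hs[OF F1b] hs[OF qb] hs[OF geo_bdd_z] hs[OF geo_bdd_letter])
          (use le in auto)
      also have "(\<lambda>w. (1 / 2) *\<^sub>R (F1_series w *\<^sub>R mon e w + q w *\<^sub>R mon e w)
          + (1 / 4) *\<^sub>R (z_series w *\<^sub>R mon e w + (-1) *\<^sub>R (letter False w *\<^sub>R mon e w))) = (\<lambda>w. F0_series w *\<^sub>R mon e w)"
        by (simp add: F0_series_def q_def algebra_simps add_divide_distrib diff_divide_distrib)
      finally show ?thesis unfolding ev_def[of e F0_series] by (simp add: infsumI)
    qed
    finally show ?thesis .
  qed
  have "geo_bdd (2 * C4) F0_series"
    unfolding geo_bdd_def
  proof
    fix w
    show "\<bar>F0_series w\<bar> \<le> (2 * C4) ^ length w"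
    proof (cases "w = []")
      case False
      have "C3 ^ length w \<le> C4 ^ length w" "12 ^ length w \<le> C4 ^ length w" "1 ^ length w \<le> C4 ^ length w"
        using le by (auto intro!: power_mono)
      then have "\<bar>F0_series w\<bar> \<le> 2 * C4 ^ length w"
        using geo_bddD[OF F1b, of w] geo_bddD[OF qb, of w] geo_bddD[OF geo_bdd_z, of w] geo_bddD[OF geo_bdd_letter, of False w]
        unfolding F0_series_def q_def[symmetric] by (simp add: abs_le_iff) argo
      also have "\<dots> \<le> 2 ^ length w * C4 ^ length w"
        using False le self_le_power[of "2::real" "length w"] by (intro mult_right_mono) auto
      finally show ?thesis by (simp add: power_mult_distrib)
    qed simp
  qed
  moreover have "2 * (2 * C4 * (r / 4)) < 1" using rC r le by simp
  moreover have "size_le e (r / 4) \<Longrightarrow> size_le e r" for e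
    by (rule size_le_mono) (use r in auto)
  ultimately show ?thesis using that[of "r / 4" "2 * C4"] r F0_eq by auto
qed

end

section \<open>Derivatives, traces and Taylor coefficients\<close>

lemma deriv_of_power_series:
  fixes E :: "real \<Rightarrow> real"
  assumes "0 < \<epsilon>" "\<And>s. \<bar>s\<bar> < \<epsilon> \<Longrightarrow> (\<lambda>n. a n * s ^ n) sums E s"
  shows "(deriv ^^ n) E 0 = fact n * a n"
  using assms(2)
proof (induction n arbitrary: E a)
  case 0
  have "(\<lambda>n. a n * 0 ^ n) sums a 0" using powser_sums_zero[of a] by simp
  with 0[of 0] assms(1) show ?case using sums_unique2 by force
next
  case (Suc n)
  have "(\<lambda>n. diffs a n * s ^ n) sums deriv E s" if s: "\<bar>s\<bar> < \<epsilon>" for s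
  proof -
    obtain K where K: "\<bar>s\<bar> < K" "K < \<epsilon>" using s dense by blast
    have "summable (\<lambda>n. a n * K ^ n)" using Suc.prems[of K] K by (auto simp: sums_iff)
    then have D: "((\<lambda>x. \<Sum>n. a n * x ^ n) has_field_derivative (\<Sum>n. diffs a n * s ^ n)) (at s)"
      by (rule termdiffs_strong) (use K in auto)
    have "(E has_field_derivative (\<Sum>n. diffs a n * s ^ n)) (at s)"
    proof (rule has_field_derivative_transform_within_open[OF D])
      show "open {-\<epsilon><..<\<epsilon>}" "s \<in> {-\<epsilon><..<\<epsilon>}" using s by auto
      show "(\<Sum>n. a n * x ^ n) = E x" if "x \<in> {-\<epsilon><..<\<epsilon>}" for x
        using Suc.prems[of x] that by (auto simp: sums_iff abs_less_iff)
    qed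
    moreover from this have "deriv E s = (\<Sum>n. diffs a n * s ^ n)" by (rule DERIV_imp_deriv)
    ultimately have "(E has_field_derivative deriv E s) (at s)" by simp
    then show ?thesis
      by (rule termdiffs_sums_strong[of \<epsilon>, rotated]) (use Suc.prems s in auto)
  qed
  from Suc.IH[OF this] have "(deriv ^^ n) (deriv E) 0 = fact n * diffs a n" .
  then show ?case by (simp add: funpow_swap1 diffs_def)
qed

lemma hom_component_eq:
  assumes "0 < \<epsilon>" "\<And>s. \<bar>s\<bar> < \<epsilon> \<Longrightarrow> ((\<lambda>w :: bool list. s ^ length w * t w) has_sum E (s *\<^sub>R X) (s *\<^sub>R Y)) UNIV"
  shows "hom_component n E X Y = (\<Sum>w | length w = n. t w)"
proof -
  have "(\<lambda>n. (\<Sum>w | length w = n. t w) * s ^ n) sums E (s *\<^sub>R X) (s *\<^sub>R Y)" if "\<bar>s\<bar> < \<epsilon>" for s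
  proof -
    have hs: "((\<lambda>w. s ^ length w * t w) has_sum E (s *\<^sub>R X) (s *\<^sub>R Y)) UNIV" using assms(2) that .
    have "(\<lambda>n. \<Sum>w | length w = n. s ^ length w * t w) sums E (s *\<^sub>R X) (s *\<^sub>R Y)"
      using sums_by_length[OF has_sum_imp_summable[OF hs]] infsumI[OF hs] by simp
    moreover have "(\<Sum>w | length w = n. s ^ length w * t w) = (\<Sum>w | length w = n. t w) * s ^ n" for n
      by (simp add: sum_distrib_left mult.commute)
    ultimately show ?thesis by simp
  qed
  from deriv_of_power_series[OF assms(1) this, of n] show ?thesis
    by (simp add: hom_component_def)
qed

text \<open>On coefficients, the substitution \<open>(X, Y) \<mapsto> (-Y, -X)\<close>.\<close>

definition G_series_of :: "nc_series \<Rightarrow> nc_series" where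
  "G_series_of f w = (-1) ^ length w * f (map Not w)"

lemma geo_bdd_G_series_of: "geo_bdd C f \<Longrightarrow> geo_bdd C (G_series_of f)"
  unfolding geo_bdd_def G_series_of_def by (metis abs_mult abs_power_minus abs_one length_map mult_1 power_one)

context banach_product begin

primrec mon_deriv :: "(bool \<Rightarrow> 'a) \<Rightarrow> (bool \<Rightarrow> 'a) \<Rightarrow> bool list \<Rightarrow> 'a" where
  "mon_deriv e u [] = 0"
| "mon_deriv e u (a # w) = (if w = [] then u a else u a \<odot> mon e w + e a \<odot> mon_deriv e u w)"

definition ev_deriv :: "(bool \<Rightarrow> 'a) \<Rightarrow> (bool \<Rightarrow> 'a) \<Rightarrow> nc_series \<Rightarrow> 'a" where
  "ev_deriv e u f = (\<Sum>\<^sub>\<infinity>w. f w *\<^sub>R mon_deriv e u w)"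

lemma norm_mon_deriv:
  assumes e: "size_le e r" and u: "size_le u (H * r)" "0 \<le> H"
  shows "norm (mon_deriv e u w) \<le> H * (2 * r) ^ length w"
proof (induction w)
  case (Cons a w)
  have r: "0 \<le> r" using size_le_nonneg e .
  show ?case
  proof (cases "w = []")
    case True
    then show ?thesis using size_leD[OF u(1), of a] mult_nonneg_nonneg[OF u(2) r] by (simp add: mult.left_commute)
  next
    case False
    have "norm (mon_deriv e u (a # w)) \<le> norm (u a \<odot> mon e w) + norm (e a \<odot> mon_deriv e u w)"
      using False norm_triangle_ineq by simp
    also have "\<dots> \<le> (bnd * norm (u a)) * norm (mon e w) + (bnd * norm (e a)) * norm (mon_deriv e u w)"
      by (intro add_mono bnd(2))
    also have "\<dots> \<le> (H * r) * r ^ length w + r * (H * (2 * r) ^ length w)"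
    proof -
      have ua: "bnd * norm (u a) \<le> H * r" and ea: "bnd * norm (e a) \<le> r"
        using e u by (auto simp: size_le_def)
      show ?thesis
        by (rule add_mono[OF mult_mono[OF ua norm_mon[OF e]] mult_mono[OF ea Cons]])
          (use u r in auto)
    qed
    also have "\<dots> = H * r ^ length (a # w) * (1 + 2 ^ length w)" by (simp add: power_mult_distrib algebra_simps)
    also have "\<dots> \<le> H * r ^ length (a # w) * (2 ^ length (a # w))"
      using u r by (intro mult_left_mono) auto
    finally show ?thesis by (simp add: power_mult_distrib mult_ac)
  qed
qed (use u in auto)

text \<open>The second-order remainder of a monomial again grows geometrically in the length, so remainders can be summed over
all words and the derivative of a series is the sum of the derivatives.\<close>

lemma norm_mon_remainder:
  assumes e: "size_le e r" "size_le (\<lambda>a. e a + \<sigma> *\<^sub>R u a) r" and u: "size_le u (H * r)" "0 \<le> H"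
  shows "norm (mon (\<lambda>a. e a + \<sigma> *\<^sub>R u a) w - mon e w - \<sigma> *\<^sub>R mon_deriv e u w) \<le> \<sigma>\<^sup>2 * (H\<^sup>2 * (4 * r) ^ length w)"
    (is "norm (?R w) \<le> _")
proof (induction w)
  case (Cons a w)
  have r: "0 \<le> r" using size_le_nonneg e by blast
  show ?case
  proof (cases "w = []")
    case True
    then show ?thesis using r by simp
  next
    case False
    have eq: "?R (a # w) = \<sigma>\<^sup>2 *\<^sub>R (u a \<odot> mon_deriv e u w) + (e a + \<sigma> *\<^sub>R u a) \<odot> ?R w"
    proof -
      let ?e = "\<lambda>a. e a + \<sigma> *\<^sub>R u a"
      have "?R (a # w) = (e a \<odot> mon ?e w + \<sigma> *\<^sub>R (u a \<odot> mon ?e w)) - e a \<odot> mon e w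
          - \<sigma> *\<^sub>R (u a \<odot> mon e w + e a \<odot> mon_deriv e u w)"
        unfolding mon_Cons[OF False] mon_deriv.simps if_not_P[OF False] add_left scaleR_left ..
      also have "\<dots> = \<sigma>\<^sup>2 *\<^sub>R (u a \<odot> mon_deriv e u w) +
          ((e a \<odot> mon ?e w + \<sigma> *\<^sub>R (u a \<odot> mon ?e w)) - (e a \<odot> mon e w + \<sigma> *\<^sub>R (u a \<odot> mon e w))
            - \<sigma> *\<^sub>R (e a \<odot> mon_deriv e u w + \<sigma> *\<^sub>R (u a \<odot> mon_deriv e u w)))"
        by (simp only: scaleR_add_right scaleR_scaleR power2_eq_square) simp
      also have "\<dots> = \<sigma>\<^sup>2 *\<^sub>R (u a \<odot> mon_deriv e u w) + (e a + \<sigma> *\<^sub>R u a) \<odot> ?R w"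
        by (simp only: diff_right add_left scaleR_left scaleR_right)
      finally show ?thesis .
    qed
    have "norm (?R (a # w)) \<le> norm (\<sigma>\<^sup>2 *\<^sub>R (u a \<odot> mon_deriv e u w)) + norm ((e a + \<sigma> *\<^sub>R u a) \<odot> ?R w)"
      unfolding eq by (rule norm_triangle_ineq)
    also have "\<dots> \<le> \<sigma>\<^sup>2 * ((bnd * norm (u a)) * norm (mon_deriv e u w)) + (bnd * norm (e a + \<sigma> *\<^sub>R u a)) * norm (?R w)"
      using mult_left_mono[OF bnd(2)[of "u a" "mon_deriv e u w"], of "\<sigma>\<^sup>2"] bnd(2)[of "e a + \<sigma> *\<^sub>R u a" "?R w"]
      by (intro add_mono) simp_all
    also have "\<dots> \<le> \<sigma>\<^sup>2 * ((H * r) * (H * (2 * r) ^ length w)) + r * (\<sigma>\<^sup>2 * (H\<^sup>2 * (4 * r) ^ length w))"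
    proof -
      have ua: "bnd * norm (u a) \<le> H * r" and ea: "bnd * norm (e a + \<sigma> *\<^sub>R u a) \<le> r"
        using e u by (auto simp: size_le_def)
      show ?thesis
        by (rule add_mono[OF mult_left_mono[OF mult_mono[OF ua norm_mon_deriv[OF e(1) u]]] mult_mono[OF ea Cons]])
          (use u r in auto)
    qed
    also have "\<dots> = \<sigma>\<^sup>2 * (H\<^sup>2 * r ^ length (a # w) * (2 ^ length w + 4 ^ length w))"
      by (simp add: power_mult_distrib power2_eq_square algebra_simps)
    also have "\<dots> \<le> \<sigma>\<^sup>2 * (H\<^sup>2 * r ^ length (a # w) * (4 ^ length (a # w)))"
    proof -
      have "(2::real) ^ length w + 4 ^ length w \<le> 4 ^ length (a # w)"
        using power_mono[of "2::real" 4 "length w"] zero_le_power[of "4::real" "length w"]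
        unfolding length_Cons power_Suc by linarith
      then show ?thesis using r by (intro mult_left_mono) auto
    qed
    finally show ?thesis by (simp add: power_mult_distrib mult_ac)
  qed
qed simp

lemma ev_deriv_abs_summable:
  assumes f: "geo_bdd C f" and e: "size_le e r" "0 < r" and r: "4 * (C * r) < 1"
  shows "(\<lambda>w. norm (f w *\<^sub>R mon_deriv e u w)) summable_on UNIV"
proof -
  define H where "H = max (bnd * norm (u False)) (bnd * norm (u True)) / r"
  have u: "size_le u (H * r)" "0 \<le> H"
    using e(2) bnd(1) unfolding size_le_def H_def
    by (auto simp: all_bool_eq max_def intro!: divide_nonneg_pos)
  have C: "0 \<le> C" using f geo_bdd_nonneg by blast
  show ?thesis
  proof (rule Infinite_Sum.abs_summable_on_comparison_test')
    show "(\<lambda>w :: bool list. H * (2 * (C * r)) ^ length w) summable_on UNIV"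
      by (intro summable_on_cmult_right summable_words) (use C e r in auto)
    show "norm (f w *\<^sub>R mon_deriv e u w) \<le> H * (2 * (C * r)) ^ length w" for w
    proof -
      have "norm (f w *\<^sub>R mon_deriv e u w) \<le> C ^ length w * (H * (2 * r) ^ length w)"
        using geo_bddD[OF f, of w] norm_mon_deriv[OF e(1) u, of w] C by (auto intro!: mult_mono)
      then show ?thesis by (simp add: power_mult_distrib mult_ac)
    qed
  qed
qed

lemma has_sum_ev_deriv:
  assumes "geo_bdd C f" "size_le e r" "0 < r" "4 * (C * r) < 1"
  shows "((\<lambda>w. f w *\<^sub>R mon_deriv e u w) has_sum ev_deriv e u f) UNIV"
  unfolding ev_deriv_def by (rule has_sum_infsum[OF abs_summable_summable[OF ev_deriv_abs_summable[OF assms]]])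

lemma size_le_perturb:
  assumes e: "size_le e r" "0 < r"
  obtains \<delta> where "0 < \<delta>" "\<And>\<sigma>. \<bar>\<sigma>\<bar> < \<delta> \<Longrightarrow> size_le (\<lambda>a. e a + \<sigma> *\<^sub>R u a) (2 * r)"
proof -
  define M where "M = bnd * (norm (u False) + norm (u True)) + 1"
  have M: "0 < M" and uM: "bnd * norm (u a) \<le> M" for a
    using bnd(1) unfolding M_def by (auto simp: add_nonneg_pos distrib_left) (cases a; auto simp: add_increasing)+
  show ?thesis
  proof (rule that[of "r / M"])
    fix \<sigma> assume "\<bar>\<sigma>\<bar> < r / M"
    then have \<sigma>: "\<bar>\<sigma>\<bar> * M \<le> r" using M by (simp add: field_simps)
    show "size_le (\<lambda>a. e a + \<sigma> *\<^sub>R u a) (2 * r)"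
      unfolding size_le_def
    proof
      fix a
      have "bnd * norm (e a + \<sigma> *\<^sub>R u a) \<le> bnd * (norm (e a) + \<bar>\<sigma>\<bar> * norm (u a))"
        using bnd(1) norm_triangle_ineq[of "e a" "\<sigma> *\<^sub>R u a"] by (intro mult_left_mono) auto
      also have "\<dots> = bnd * norm (e a) + \<bar>\<sigma>\<bar> * (bnd * norm (u a))" by (simp add: algebra_simps)
      also have "\<dots> \<le> r + \<bar>\<sigma>\<bar> * M" using e uM by (intro add_mono mult_left_mono) (auto simp: size_le_def)
      finally show "bnd * norm (e a + \<sigma> *\<^sub>R u a) \<le> 2 * r" using \<sigma> by simp
    qed
  qed (use e M in auto)
qed

theorem ev_has_vector_derivative:
  assumes f: "geo_bdd C f" and e: "size_le e r" "0 < r" and r: "16 * (C * r) < 1"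
  shows "((\<lambda>\<sigma>. ev (\<lambda>a. e a + \<sigma> *\<^sub>R u a) f) has_vector_derivative ev_deriv e u f) (at 0)"
proof -
  have C: "0 \<le> C" using f geo_bdd_nonneg by blast
  define R where "R = 2 * r"
  have R: "0 < R" "8 * (C * R) < 1" using e r by (auto simp: R_def)
  have eR: "size_le e R" using size_le_mono[OF e(1)] e(2) by (simp add: R_def)
  define H where "H = max (bnd * norm (u False)) (bnd * norm (u True)) / R"
  have u: "size_le u (H * R)" "0 \<le> H"
    using R bnd(1) unfolding size_le_def H_def
    by (auto simp: all_bool_eq max_def intro!: divide_nonneg_pos)
  obtain \<delta> where \<delta>: "0 < \<delta>" "\<And>\<sigma>. \<bar>\<sigma>\<bar> < \<delta> \<Longrightarrow> size_le (\<lambda>a. e a + \<sigma> *\<^sub>R u a) R"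
    using size_le_perturb[OF e] unfolding R_def by metis
  define M where "M = (\<Sum>\<^sub>\<infinity>w :: bool list. H\<^sup>2 * (4 * (C * R)) ^ length w)"
  have Ms: "(\<lambda>w :: bool list. H\<^sup>2 * (4 * (C * R)) ^ length w) summable_on UNIV"
    by (intro summable_on_cmult_right summable_words) (use C R in auto)
  have CR: "0 \<le> C * R" using C R by simp
  have small: "2 * (C * R) < 1" "4 * (C * R) < 1" using R CR by linarith+
  have bound: "norm (ev (\<lambda>a. e a + \<sigma> *\<^sub>R u a) f - ev e f - \<sigma> *\<^sub>R ev_deriv e u f) \<le> \<sigma>\<^sup>2 * M" if \<sigma>: "\<bar>\<sigma>\<bar> < \<delta>" for \<sigma>
  proof -
    let ?e = "\<lambda>a. e a + \<sigma> *\<^sub>R u a"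
    let ?T = "\<lambda>w. f w *\<^sub>R (mon ?e w - mon e w - \<sigma> *\<^sub>R mon_deriv e u w)"
    have "((\<lambda>w. f w *\<^sub>R mon ?e w + (-1) *\<^sub>R (f w *\<^sub>R mon e w) + (-\<sigma>) *\<^sub>R (f w *\<^sub>R mon_deriv e u w)) has_sum
        (ev ?e f + (-1) *\<^sub>R ev e f + (-\<sigma>) *\<^sub>R ev_deriv e u f)) UNIV"
      by (intro has_sum_add has_sum_scaleR ev_has_sum[OF f \<delta>(2)[OF \<sigma>]] ev_has_sum[OF f eR]
          has_sum_ev_deriv[OF f eR R(1)] small)
    then have hs: "(?T has_sum (ev ?e f - ev e f - \<sigma> *\<^sub>R ev_deriv e u f)) UNIV"
      by (simp add: algebra_simps)
    have Tb: "norm (?T w) \<le> \<sigma>\<^sup>2 * (H\<^sup>2 * (4 * (C * R)) ^ length w)" for w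
    proof -
      have "norm (?T w) \<le> C ^ length w * (\<sigma>\<^sup>2 * (H\<^sup>2 * (4 * R) ^ length w))"
        using geo_bddD[OF f, of w] norm_mon_remainder[OF eR \<delta>(2)[OF \<sigma>] u, of w] C
        by (auto intro!: mult_mono)
      then show ?thesis by (simp add: power_mult_distrib mult_ac)
    qed
    have Ts: "(\<lambda>w. norm (?T w)) summable_on UNIV"
      by (rule Infinite_Sum.abs_summable_on_comparison_test'[OF summable_on_cmult_right[OF Ms, of "\<sigma>\<^sup>2"]]) (rule Tb)
    have "norm (infsum ?T UNIV) \<le> (\<Sum>\<^sub>\<infinity>w. norm (?T w))" by (rule norm_infsum_bound[OF Ts])
    also have "\<dots> \<le> (\<Sum>\<^sub>\<infinity>w :: bool list. \<sigma>\<^sup>2 * (H\<^sup>2 * (4 * (C * R)) ^ length w))"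
      by (rule infsum_mono[OF Ts summable_on_cmult_right[OF Ms]]) (rule Tb)
    also have "\<dots> = \<sigma>\<^sup>2 * M" unfolding M_def by (rule infsum_cmult_right) (rule Ms)
    finally show ?thesis using infsumI[OF hs] by simp
  qed
  show ?thesis
    unfolding has_vector_derivative_def
  proof (rule has_derivativeI_sandwich[of \<delta> _ _ _ _ "\<lambda>\<sigma>. \<bar>\<sigma>\<bar> * M"])
    show "((\<lambda>\<sigma>. \<bar>\<sigma>\<bar> * M) \<longlongrightarrow> 0) (at 0)" by (auto intro!: tendsto_eq_intros)
    fix \<sigma> :: real assume "\<sigma> \<noteq> 0" "dist \<sigma> 0 < \<delta>"
    then show "norm (ev (\<lambda>a. e a + \<sigma> *\<^sub>R u a) f - ev (\<lambda>a. e a + 0 *\<^sub>R u a) f - (\<sigma> - 0) *\<^sub>R ev_deriv e u f) / norm (\<sigma> - 0) \<le> \<bar>\<sigma>\<bar> * M"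
      using bound[of \<sigma>] by (auto simp: divide_simps power2_eq_square mult_ac)
  qed (use \<delta> in \<open>auto intro!: bounded_linear_scaleR_left\<close>)
qed

abbreviation (input) in_X :: "'a \<Rightarrow> bool \<Rightarrow> 'a" where "in_X U \<equiv> \<lambda>a. if a then 0 else U"
abbreviation (input) in_Y :: "'a \<Rightarrow> bool \<Rightarrow> 'a" where "in_Y U \<equiv> \<lambda>a. if a then U else 0"

lemma partial_eq_ev_deriv:
  assumes f: "geo_bdd C f" and r: "0 < r" "2 * (C * r) < 1"
    and F: "\<And>e. size_le e r \<Longrightarrow> F (e False) (e True) = ev e f"
    and e: "size_le e (r / 8)"
  shows "partial_X F (e False) (e True) U = ev_deriv e (in_X U) f"
    and "partial_Y F (e False) (e True) U = ev_deriv e (in_Y U) f"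
proof -
  have r8: "0 < r / 8" "16 * (C * (r / 8)) < 1" using r by auto
  have D: "((\<lambda>\<sigma>. F (e False + \<sigma> *\<^sub>R u False) (e True + \<sigma> *\<^sub>R u True)) has_vector_derivative ev_deriv e u f) (at 0)" for u
  proof -
    obtain \<delta> where \<delta>: "0 < \<delta>" "\<And>\<sigma>. \<bar>\<sigma>\<bar> < \<delta> \<Longrightarrow> size_le (\<lambda>a. e a + \<sigma> *\<^sub>R u a) (2 * (r / 8))"
      using size_le_perturb[OF e r8(1)] by metis
    show ?thesis
    proof (rule has_vector_derivative_transform_within_open[OF ev_has_vector_derivative[OF f e r8]])
      show "open {-\<delta><..<\<delta>}" "0 \<in> {-\<delta><..<\<delta>}" using \<delta> by auto
      fix \<sigma> assume "\<sigma> \<in> {-\<delta><..<\<delta>}"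
      then have "size_le (\<lambda>a. e a + \<sigma> *\<^sub>R u a) r"
        using size_le_mono[OF \<delta>(2)[of \<sigma>], of r] r by (auto simp: abs_less_iff)
      from F[OF this] show "ev (\<lambda>a. e a + \<sigma> *\<^sub>R u a) f = F (e False + \<sigma> *\<^sub>R u False) (e True + \<sigma> *\<^sub>R u True)" by simp
    qed
  qed
  show "partial_X F (e False) (e True) U = ev_deriv e (in_X U) f"
    unfolding partial_X_def using D[of "in_X U"] by (intro vector_derivative_at) simp
  show "partial_Y F (e False) (e True) U = ev_deriv e (in_Y U) f"
    unfolding partial_Y_def using D[of "in_Y U"] by (intro vector_derivative_at) simp
qed

lemma mon_map_Not: "mon (\<lambda>a. - e (\<not> a)) w = (-1) ^ length w *\<^sub>R mon e (map Not w)"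
proof (induction w)
  case (Cons a w)
  then show ?case by (cases "w = []") (auto simp: mon_Cons scaleR_right minus_left)
qed simp

lemma kv_G0_eq_ev:
  assumes "\<And>e. size_le e r \<Longrightarrow> kv_F0 com (e False) (e True) = ev e f" "size_le e r"
  shows "kv_G0 com (e False) (e True) = ev e (G_series_of f)"
proof -
  have "size_le (\<lambda>a. - e (\<not> a)) r" using assms(2) by (simp add: size_le_def)
  from assms(1)[OF this] have "kv_G0 com (e False) (e True) = ev (\<lambda>a. - e (\<not> a)) f"
    by (simp add: kv_G0_def)
  also have "\<dots> = (\<Sum>\<^sub>\<infinity>w. G_series_of f (map Not w) *\<^sub>R mon e (map Not w))"
    by (simp add: ev_def mon_map_Not G_series_of_def mult.commute o_def)
  also have "\<dots> = ev e (G_series_of f)"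
    unfolding ev_def
  proof (rule infsum_reindex_bij_betw)
    show "bij_betw (map Not) UNIV UNIV" by (rule bij_betwI[where g = "map Not"]) (auto simp: o_def)
  qed
  finally show ?thesis .
qed

text \<open>The derivative of a word has one factor less than the word; multiplying by \<open>s\<close>, as \<open>ad (s X)\<close> does, restores
homogeneity and avoids a negative exponent for the empty word.\<close>

lemma mon_deriv_scale: "s *\<^sub>R mon_deriv (\<lambda>a. s *\<^sub>R e a) u w = s ^ length w *\<^sub>R mon_deriv e u w"
proof (induction w)
  case (Cons a w)
  have "s *\<^sub>R mon_deriv (\<lambda>a. s *\<^sub>R e a) u (a # w) = s ^ length (a # w) *\<^sub>R mon_deriv e u (a # w)" if "w \<noteq> []"
  proof -
    have "s *\<^sub>R mon_deriv (\<lambda>a. s *\<^sub>R e a) u (a # w) = s *\<^sub>R (u a \<odot> mon (\<lambda>a. s *\<^sub>R e a) w) + s *\<^sub>R (e a \<odot> (s *\<^sub>R mon_deriv (\<lambda>a. s *\<^sub>R e a) u w))"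
      using that by (simp add: scaleR_left scaleR_right scaleR_add_right)
    also have "\<dots> = s ^ length (a # w) *\<^sub>R mon_deriv e u (a # w)"
      unfolding Cons mon_scale using that by (simp add: scaleR_right scaleR_add_right)
    finally show ?thesis .
  qed
  then show ?case by (cases "w = []") auto
qed simp

end

section \<open>The Todd series of adjoint operators\<close>

text \<open>The series \<open>todd y - 1\<close>, written as a multiple of \<open>y\<close> because series are only evaluated without constant term.\<close>

definition todd_series :: "nc_series \<Rightarrow> nc_series" where
  "todd_series y = nc_fps 1 0 (fps_shift 1 todd_fps) y y"

definition right_coeff :: nc_series where
  "right_coeff w = todd_series (letter False) w + todd_series (letter True) w - todd_series z_series w"

lemma todd_series_geo_bdd:
  assumes "fps_geo_bdd B todd_fps" "geo_bdd C y" "y [] = 0"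
  shows "fps_geo_bdd (B\<^sup>2) (fps_shift 1 todd_fps)" "geo_bdd (6 * B\<^sup>2 * C) (todd_series y)"
proof -
  have B: "1 \<le> B" and t: "\<And>n. \<bar>fps_nth todd_fps n\<bar> \<le> B ^ Suc n" using assms(1) by (auto simp: fps_geo_bdd_def)
  show *: "fps_geo_bdd (B\<^sup>2) (fps_shift 1 todd_fps)"
    unfolding fps_geo_bdd_def
  proof (intro conjI allI)
    show "1 \<le> B\<^sup>2" using B by simp
    fix n
    have "\<bar>fps_nth todd_fps (n + 1)\<bar> \<le> B ^ Suc (n + 1)" by (rule t)
    also have "\<dots> \<le> B ^ (2 * Suc n)" using B by (intro power_increasing) auto
    finally show "\<bar>fps_nth (fps_shift 1 todd_fps) n\<bar> \<le> (B\<^sup>2) ^ Suc n" by (simp only: power_mult fps_shift_nth)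
  qed
  show "geo_bdd (6 * B\<^sup>2 * C) (todd_series y)"
    unfolding todd_series_def by (rule geo_bdd_nc_fps) (use assms * in auto)
qed

context banach_product begin

lemma com_add_left: "com (x + y) z = com x z + com y z"
  and com_add_right: "com x (y + z) = com x y + com x z"
  and com_scale_left: "com (c *\<^sub>R x) y = c *\<^sub>R com x y"
  and com_scale_right: "com x (c *\<^sub>R y) = c *\<^sub>R com x y"
  by (simp_all add: com_def add_left add_right scaleR_left scaleR_right scaleR_diff_right)

lemma norm_com: "norm (com x y) \<le> 2 * bnd * norm x * norm y"
proof -
  have "norm (com x y) \<le> norm (x \<odot> y) + norm (y \<odot> x)" unfolding com_def by (rule norm_triangle_ineq4)
  also have "\<dots> \<le> bnd * norm x * norm y + bnd * norm y * norm x" by (intro add_mono bnd(2))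
  finally show ?thesis by (simp add: mult_ac)
qed

lemma bounded_linear_com: "bounded_linear (com x)"
proof (rule bounded_linear_intro[of _ "2 * bnd * norm x"])
  show "norm (com x y) \<le> norm y * (2 * bnd * norm x)" for y
    using norm_com[of x y] by (simp add: mult_ac)
qed (simp_all add: com_add_right com_scale_right)

primrec ad_word :: "(bool \<Rightarrow> 'a) \<Rightarrow> bool list \<Rightarrow> 'a \<Rightarrow> 'a" where
  "ad_word e [] v = v"
| "ad_word e (a # w) v = com (e a) (ad_word e w v)"

definition ad :: "'a \<Rightarrow> 'a \<Rightarrow>\<^sub>L 'a" where
  "ad x = Blinfun (com x)"

lemma ad_apply [simp]: "blinfun_apply (ad x) y = com x y"
  unfolding ad_def by (simp add: bounded_linear_Blinfun_apply bounded_linear_com)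

lemma norm_ad: "norm (ad x) \<le> 2 * bnd * norm x"
  by (rule norm_blinfun_bound) (use norm_com bnd(1) in auto)

lemma bounded_linear_ad: "bounded_linear ad"
  by (rule bounded_linear_intro[of _ "2 * bnd"])
    (auto intro!: blinfun_eqI simp: com_add_left com_scale_left plus_blinfun.rep_eq scaleR_blinfun.rep_eq norm_ad[THEN order_trans] mult_ac)

end

text \<open>The evaluation of series is used a second time, at the operators \<open>ad X\<close> and \<open>ad Y\<close>: on the right side of the
trace identity the series act on the whole Lie algebra.\<close>

lemma banach_product_blinfun: "banach_product (blinfun_compose :: ('b::banach \<Rightarrow>\<^sub>L 'b) \<Rightarrow> _)"
  by (intro banach_product.intro bounded_bilinear_blinfun_compose banach_product_axioms.intro)
    (rule blinfun_eqI, simp)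

context banach_product begin

interpretation op: banach_product "blinfun_compose :: ('a \<Rightarrow>\<^sub>L 'a) \<Rightarrow> _"
  by (rule banach_product_blinfun)

lemma ad_com: "ad (com x y) = op.com (ad x) (ad y)"
  by (rule blinfun_eqI) (simp add: op.com_def blinfun.diff_left com_def assoc diff_left diff_right)

lemma ad_nested_bracket: "ad (nested_bracket com e w) = nested_bracket op.com (\<lambda>a. ad (e a)) w"
proof (induction w)
  case Nil
  then show ?case by (simp add: linear_simps(3)[OF bounded_linear_ad])
next
  case (Cons a w)
  then show ?case by (cases w) (auto simp: ad_com)
qed

lemma op_size_le: "size_le e r \<Longrightarrow> op.size_le (\<lambda>a. ad (e a)) (2 * op.bnd * r)"
  unfolding size_le_def op.size_le_def
proof
  fix a assume "\<forall>a. bnd * norm (e a) \<le> r"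
  then have "norm (ad (e a)) \<le> 2 * r" using norm_ad[of "e a"] by (metis dual_order.trans mult.assoc mult_le_cancel_left_pos zero_less_numeral)
  then show "op.bnd * norm (ad (e a)) \<le> 2 * op.bnd * r"
    using op.bnd(1) mult_left_mono[of "norm (ad (e a))" "2 * r" op.bnd] by (simp add: mult_ac)
qed

text \<open>Dynkin's form only involves brackets, which \<open>ad\<close> preserves.\<close>

lemma ad_ch:
  assumes "size_le e r" "2 * (12 * r) < 1" "op.size_le (\<lambda>a. ad (e a)) r'" "2 * (12 * r') < 1"
  shows "ad (ch com (e False) (e True)) = op.ev (\<lambda>a. ad (e a)) z_series"
proof -
  have e: "(\<lambda>a. if a then e True else e False) = e" "(\<lambda>a. if a then ad (e True) else ad (e False)) = (\<lambda>a. ad (e a))" by auto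
  have "(\<lambda>n. ch_component com n (e False) (e True)) sums ch com (e False) (e True)"
    using ev_sums[OF geo_bdd_z assms(1,2)] unfolding ch_eq_ev[OF assms(1,2)]
    by (simp add: ch_component_eq e z_series_def)
  then have "(\<lambda>n. ad (ch_component com n (e False) (e True))) sums ad (ch com (e False) (e True))"
    by (rule bounded_linear.sums[OF bounded_linear_ad])
  moreover have "ad (ch_component com n (e False) (e True)) = ch_component op.com n (ad (e False)) (ad (e True))" for n
    by (simp add: ch_component_def e bounded_linear_ad linear_simps(5)[OF bounded_linear_ad] ad_nested_bracket
        linear_sum[OF bounded_linear.linear[OF bounded_linear_ad]])
  moreover have "(\<lambda>n. ch_component op.com n (ad (e False)) (ad (e True))) sums op.ev (\<lambda>a. ad (e a)) z_series"
    using op.ev_sums[OF geo_bdd_z assms(3,4)] by (simp add: op.ch_component_eq e z_series_def)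
  ultimately show ?thesis by (simp add: sums_iff)
qed

lemma fps_op_todd:
  assumes y: "geo_bdd C y" "y [] = 0" and B: "fps_geo_bdd B todd_fps"
    and e: "op.size_le e r" "2 * (6 * B\<^sup>2 * C * r) < 1"
    and Y: "ad Y = op.ev e y"
  shows "fps_op todd_fps (com Y) v = v + op.ev e (todd_series y) v"
proof -
  have "(\<lambda>n. fps_nth (fps_shift 1 todd_fps) n *\<^sub>R (op.mult_op 1 0 (op.ev e y) ^^ n) (op.ev e y)) sums op.ev e (todd_series y)"
    unfolding todd_series_def
    by (rule op.fps_op_ev) (use y todd_series_geo_bdd(1)[OF B y] e in auto)
  then have "(\<lambda>n. blinfun_apply (fps_nth (fps_shift 1 todd_fps) n *\<^sub>R (op.mult_op 1 0 (op.ev e y) ^^ n) (op.ev e y)) v)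
     sums blinfun_apply (op.ev e (todd_series y)) v"
    by (rule bounded_linear.sums[OF blinfun.bounded_linear_left])
  moreover have "blinfun_apply ((op.mult_op 1 0 (op.ev e y) ^^ n) (op.ev e y)) v = (com Y ^^ Suc n) v" for n
    by (induction n) (simp_all add: op.mult_op_def flip: Y)
  ultimately have "(\<lambda>n. fps_nth todd_fps (Suc n) *\<^sub>R (com Y ^^ Suc n) v) sums op.ev e (todd_series y) v"
    by (simp add: scaleR_blinfun.rep_eq)
  then have "(\<lambda>n. fps_nth todd_fps n *\<^sub>R (com Y ^^ n) v) sums (op.ev e (todd_series y) v + fps_nth todd_fps 0 *\<^sub>R (com Y ^^ 0) v)"
    by (subst (asm) sums_Suc_iff) (simp)
  moreover have "fps_nth todd_fps 0 = 1" by (simp add: todd_fps_eq)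
  ultimately show ?thesis by (simp add: fps_op_def sums_iff add.commute)
qed

end

section \<open>Traces over a finite-dimensional Lie algebra\<close>

text \<open>The coordinate functionals \<open>c b\<close> are continuous on the ambient space. This allows traces over \<open>L\<close> to be taken term by
term in a convergent sum of operators.\<close>

locale lie_carrier = banach_product m for m :: "'a::banach \<Rightarrow> 'a \<Rightarrow> 'a" (infixl "\<odot>" 70) +
  fixes L B :: "'a set" and c :: "'a \<Rightarrow> 'a \<Rightarrow> real"
  assumes basis: "independent B" "finite B" "span B = L"
    and closed_L: "closed L"
    and mult_L: "x \<in> L \<Longrightarrow> y \<in> L \<Longrightarrow> x \<odot> y \<in> L"
    and coord: "b \<in> B \<Longrightarrow> bounded_linear (c b)"
    and coord_L: "b \<in> B \<Longrightarrow> x \<in> L \<Longrightarrow> c b x = representation B x b"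
begin

lemma subspace_L: "subspace L"
  using basis(3) subspace_span by metis

lemma com_L: "x \<in> L \<Longrightarrow> y \<in> L \<Longrightarrow> com x y \<in> L"
  unfolding com_def using mult_L subspace_L subspace_diff by blast

lemma fd_lie_algebra: "fd_lie_algebra L com"
proof (rule fd_lie_algebra.intro)
  show "com x (com y z) + com y (com z x) + com z (com x y) = 0" for x y z
    by (simp add: com_def diff_left diff_right assoc)
  show "com x x = 0" for x by (simp add: com_def)
qed (use subspace_L basis com_L in \<open>auto simp: com_add_left com_add_right com_scale_left com_scale_right\<close>)

definition tr :: "('a \<Rightarrow> 'a) \<Rightarrow> real" where
  "tr A = (\<Sum>b\<in>B. c b (A b))"

lemma trace_on_eq_tr:
  assumes "\<And>x y. x \<in> L \<Longrightarrow> y \<in> L \<Longrightarrow> A (x + y) = A x + A y"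
    and "\<And>c x. x \<in> L \<Longrightarrow> A (c *\<^sub>R x) = c *\<^sub>R A x" and "\<And>x. x \<in> L \<Longrightarrow> A x \<in> L"
  shows "trace_on L A = tr A"
proof -
  define B' where "B' = (SOME B. independent B \<and> span B = L)"
  have B': "independent B'" "span B' = L"
    using someI_ex[of "\<lambda>B. independent B \<and> span B = L"] basis unfolding B'_def by blast+
  have "finite B'"
    using B' basis span_superset[of B'] independent_span_bound[of B B'] by blast
  have "trace_on L A = (\<Sum>b\<in>B'. representation B' (A b) b)"
    by (simp add: trace_on_def B'_def Let_def)
  also have "\<dots> = (\<Sum>b\<in>B. representation B (A b) b)"
    by (rule trace_basis_change[of B' L B A]) (use B' \<open>finite B'\<close> basis assms in auto)
  also have "\<dots> = tr A"
    unfolding tr_def using basis(3) span_superset[of B] assms(3) by (intro sum.cong refl) (auto simp: coord_L subset_eq)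
  finally show ?thesis .
qed

lemma has_sum_in_L:
  assumes "(f has_sum x) A" "\<And>w. w \<in> A \<Longrightarrow> f w \<in> L"
  shows "x \<in> L"
proof (rule Lim_in_closed_set[OF closed_L])
  show "(sum f \<longlongrightarrow> x) (finite_subsets_at_top A)" using assms(1) by (simp add: has_sum_def)
  show "\<forall>\<^sub>F F in finite_subsets_at_top A. sum f F \<in> L"
    by (rule eventually_finite_subsets_at_top_weakI) (use assms(2) subspace_sum[OF subspace_L] in blast)
qed simp

lemma has_sum_trace:
  assumes hs: "\<And>v. v \<in> L \<Longrightarrow> ((\<lambda>w. T w v) has_sum A v) W"
    and lin: "\<And>w. linear (T w)" and T_L: "\<And>w v. v \<in> L \<Longrightarrow> T w v \<in> L"
  shows "((\<lambda>w. tr (T w)) has_sum trace_on L A) W"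
proof -
  have "trace_on L A = tr A"
  proof (rule trace_on_eq_tr)
    fix x y k assume x: "x \<in> L"
    show "A x \<in> L" by (rule has_sum_in_L[OF hs[OF x]]) (use T_L x in auto)
    show "A (k *\<^sub>R x) = k *\<^sub>R A x"
      using has_sum_scaleR[OF hs[OF x], of k] hs[of "k *\<^sub>R x"] x subspace_scale[OF subspace_L x]
      by (simp add: linear_scale[OF lin] has_sum_unique)
    assume y: "y \<in> L"
    show "A (x + y) = A x + A y"
      using has_sum_add[OF hs[OF x] hs[OF y]] hs[of "x + y"] subspace_add[OF subspace_L x y]
      by (simp add: linear_add[OF lin] has_sum_unique)
  qed
  moreover have "((\<lambda>w. tr (T w)) has_sum tr A) W"
  proof -
    have one: "((\<lambda>w. c b (T w b)) has_sum c b (A b)) W" if b: "b \<in> B" for b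
    proof -
      have "b \<in> L" using b basis(3) span_superset by blast
      from has_sum_bounded_linear[OF coord[OF b] hs[OF this]] show ?thesis by (simp add: o_def)
    qed
    have "((\<lambda>w. \<Sum>b\<in>B'. c b (T w b)) has_sum (\<Sum>b\<in>B'. c b (A b))) W" if "finite B'" "B' \<subseteq> B" for B'
      using that by (induction B' rule: finite_induct) (auto intro!: has_sum_add one)
    then show ?thesis unfolding tr_def using basis(2) by blast
  qed
  ultimately show ?thesis by simp
qed

lemma tr_scale: "tr (\<lambda>v. k *\<^sub>R A v) = k * tr A"
  unfolding tr_def sum_distrib_left
  by (rule sum.cong[OF refl]) (simp add: linear_simps(5)[OF coord])

lemma mon_L: "(\<And>a. e a \<in> L) \<Longrightarrow> mon e w \<in> L"
proof (induction w)
  case (Cons a w)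
  then show ?case by (cases "w = []") (auto simp: mon_Cons mult_L)
qed (use subspace_L subspace_0 in auto)

lemma mon_deriv_L: "(\<And>a. e a \<in> L) \<Longrightarrow> (\<And>a. u a \<in> L) \<Longrightarrow> mon_deriv e u w \<in> L"
proof (induction w)
  case (Cons a w)
  then show ?case using subspace_add[OF subspace_L] mon_L[of e w] by (auto simp: mult_L)
qed (use subspace_L subspace_0 in auto)

lemma linear_mon_deriv:
  assumes "\<And>a. linear (\<lambda>v. u v a)"
  shows "linear (\<lambda>v. mon_deriv e (u v) w)"
proof (rule linearI)
  show "mon_deriv e (u (x + y)) w = mon_deriv e (u x) w + mon_deriv e (u y) w" for x y
    by (induction w) (auto simp: linear_add[OF assms] add_left add_right)
  show "mon_deriv e (u (k *\<^sub>R x)) w = k *\<^sub>R mon_deriv e (u x) w" for k x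
    by (induction w) (auto simp: linear_scale[OF assms] scaleR_left scaleR_right scaleR_add_right)
qed

definition left_term :: "(bool \<Rightarrow> 'a) \<Rightarrow> bool list \<Rightarrow> real" where
  "left_term e w = tr (\<lambda>v. F0_series w *\<^sub>R com (e False) (mon_deriv e (in_X v) w)
     + G_series_of F0_series w *\<^sub>R com (e True) (mon_deriv e (in_Y v) w))"

lemma size_le_exists: obtains \<rho> where "0 < \<rho>" "size_le e \<rho>"
proof (rule that)
  show "0 < bnd * (norm (e False) + norm (e True)) + 1"
    using bnd(1) by (intro add_nonneg_pos mult_nonneg_nonneg) auto
  have "norm (e a) \<le> norm (e False) + norm (e True)" for a by (cases a) auto
  then have "bnd * norm (e a) \<le> bnd * (norm (e False) + norm (e True))" for a
    using bnd(1) by (intro mult_left_mono) auto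
  then show "size_le e (bnd * (norm (e False) + norm (e True)) + 1)"
    unfolding size_le_def by (meson add_increasing2 le_add_same_cancel1 order_trans zero_le_one)
qed

lemma size_le_scale_small:
  assumes "size_le e \<rho>" "\<bar>s\<bar> * \<rho> \<le> r"
  shows "size_le (\<lambda>a. s *\<^sub>R e a) r"
  unfolding size_le_def
proof
  fix a
  have "bnd * norm (s *\<^sub>R e a) = \<bar>s\<bar> * (bnd * norm (e a))" by simp
  also have "\<dots> \<le> \<bar>s\<bar> * \<rho>" using assms(1) by (intro mult_left_mono) (auto simp: size_le_def)
  finally show "bnd * norm (s *\<^sub>R e a) \<le> r" using assms(2) by simp
qed

text \<open>At \<open>(s X, s Y)\<close> the operator under the trace is the sum over all words \<open>w\<close> of \<open>s ^ length w\<close> times a fixed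
linear operator.\<close>

theorem hom_component_left:
  assumes e: "\<And>a. e a \<in> L"
  shows "hom_component n (kv_trace_left L com (kv_F0 com) (kv_G0 com)) (e False) (e True)
    = (\<Sum>w | length w = n. left_term e w)"
proof -
  obtain C r where r: "0 < r" and f: "geo_bdd C F0_series" and Cr: "2 * (C * r) < 1"
    and F0: "\<And>e. size_le e r \<Longrightarrow> kv_F0 com (e False) (e True) = ev e F0_series"
    using kv_F0_eq_ev by blast
  note g = geo_bdd_G_series_of[OF f]
  have G0: "kv_G0 com (e False) (e True) = ev e (G_series_of F0_series)" if "size_le e r" for e
    using kv_G0_eq_ev[OF F0 that] by simp
  obtain \<rho> where \<rho>: "0 < \<rho>" "size_le e \<rho>" using size_le_exists by blast
  show ?thesis
  proof (rule hom_component_eq)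
    show "0 < r / (8 * \<rho>)" using r \<rho> by simp
    fix s assume s: "\<bar>s\<bar> < r / (8 * \<rho>)"
    let ?se = "\<lambda>a. s *\<^sub>R e a"
    have se: "size_le ?se (r / 8)" using size_le_scale_small[OF \<rho>(2), of s "r / 8"] s \<rho> by (simp add: field_simps)
    have r8: "0 < r / 8" "4 * (C * (r / 8)) < 1"
      using r Cr mult_nonneg_nonneg[OF geo_bdd_nonneg[OF f], of r] by auto
    define A where "A v = com (s *\<^sub>R e False) (partial_X (kv_F0 com) (s *\<^sub>R e False) (s *\<^sub>R e True) v)
      + com (s *\<^sub>R e True) (partial_Y (kv_G0 com) (s *\<^sub>R e False) (s *\<^sub>R e True) v)" for v
    define T where "T w v = F0_series w *\<^sub>R com (e False) (mon_deriv e (in_X v) w)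
     + G_series_of F0_series w *\<^sub>R com (e True) (mon_deriv e (in_Y v) w)" for w v
    have sT: "F0_series w *\<^sub>R com (s *\<^sub>R e False) (mon_deriv ?se (in_X v) w)
        + G_series_of F0_series w *\<^sub>R com (s *\<^sub>R e True) (mon_deriv ?se (in_Y v) w) = s ^ length w *\<^sub>R T w v" for w v
    proof -
      have "com (s *\<^sub>R e a) (mon_deriv ?se u w) = s ^ length w *\<^sub>R com (e a) (mon_deriv e u w)" for a u
        using mon_deriv_scale[of s e u w] by (simp add: com_scale_left flip: com_scale_right)
      then show ?thesis by (simp add: T_def scaleR_add_right mult.commute)
    qed
    have hs: "((\<lambda>w. s ^ length w *\<^sub>R T w v) has_sum A v) UNIV" for v
    proof -
      have "((\<lambda>w. com (s *\<^sub>R e False) (F0_series w *\<^sub>R mon_deriv ?se (in_X v) w)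
          + com (s *\<^sub>R e True) (G_series_of F0_series w *\<^sub>R mon_deriv ?se (in_Y v) w)) has_sum
        (com (s *\<^sub>R e False) (ev_deriv ?se (in_X v) F0_series) + com (s *\<^sub>R e True) (ev_deriv ?se (in_Y v) (G_series_of F0_series)))) UNIV"
        by (intro has_sum_add has_sum_bounded_linear[OF bounded_linear_com, unfolded o_def]
            has_sum_ev_deriv[OF f se r8] has_sum_ev_deriv[OF g se r8])
      moreover have "A v = com (s *\<^sub>R e False) (ev_deriv ?se (in_X v) F0_series) + com (s *\<^sub>R e True) (ev_deriv ?se (in_Y v) (G_series_of F0_series))"
        using partial_eq_ev_deriv(1)[OF f r Cr F0 se] partial_eq_ev_deriv(2)[OF g r Cr G0 se] by (simp add: A_def)
      ultimately show ?thesis by (simp add: com_scale_right sT)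
    qed
    have lin: "linear (\<lambda>v. s ^ length w *\<^sub>R T w v)" for w
    proof -
      have l: "linear (\<lambda>v. com (e a) (mon_deriv e (u v) w))" if "\<And>a. linear (\<lambda>v. u v a)" for a u
        using linear_compose[OF linear_mon_deriv[of u e w, OF that] bounded_linear.linear[OF bounded_linear_com[of "e a"]]]
        by (simp add: o_def)
      show ?thesis
        unfolding T_def
        by (intro linear_compose_scale_right linear_compose_add l) (auto intro!: linearI)
    qed
    have TL: "s ^ length w *\<^sub>R T w v \<in> L" if "v \<in> L" for w v
      unfolding T_def
      by (intro subspace_scale[OF subspace_L] subspace_add[OF subspace_L] com_L mon_deriv_L e)
        (use that subspace_0[OF subspace_L] in auto)
    have "((\<lambda>w. tr (\<lambda>v. s ^ length w *\<^sub>R T w v)) has_sum trace_on L A) UNIV"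
      by (rule has_sum_trace[OF hs lin TL])
    then show "((\<lambda>w. s ^ length w * left_term e w) has_sum
        kv_trace_left L com (kv_F0 com) (kv_G0 com) (s *\<^sub>R e False) (s *\<^sub>R e True)) UNIV"
      by (simp add: kv_trace_left_def A_def[abs_def] o_def tr_scale left_term_def T_def)
  qed
qed

interpretation op: banach_product "blinfun_compose :: ('a \<Rightarrow>\<^sub>L 'a) \<Rightarrow> _"
  by (rule banach_product_blinfun)

lemma op_mon_apply: "w \<noteq> [] \<Longrightarrow> blinfun_apply (op.mon (\<lambda>a. ad (e a)) w) v = ad_word e w v"
proof (induction w)
  case (Cons a w)
  then show ?case by (cases "w = []") (auto simp: op.mon_Cons)
qed simp

theorem hom_component_right:
  assumes e: "\<And>a. e a \<in> L"
  shows "hom_component n (kv_trace_right L com) (e False) (e True)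
    = (\<Sum>w | length w = n. 1 / 2 * (right_coeff w * tr (ad_word e w)))"
proof -
  obtain D where D: "fps_geo_bdd D todd_fps" using kv_fps_geo_bdd by metis
  have D1: "1 \<le> D\<^sup>2" using D by (auto simp: fps_geo_bdd_def)
  define C where "C = 6 * D\<^sup>2 * 12"
  have C: "12 \<le> C" "0 < C" using D1 by (auto simp: C_def)
  obtain \<rho> where \<rho>: "0 < \<rho>" "size_le e \<rho>" using size_le_exists by blast
  define K where "K = 2 * op.bnd"
  have K: "1 \<le> K" using op.bnd(1) by (simp add: K_def)
  define r where "r = 1 / (4 * C * K)"
  have r: "0 < r" and CKr: "2 * (C * (K * r)) < 1" using C K by (auto simp: r_def)
  have rKr: "r \<le> K * r" using mult_right_mono[OF K, of r] r by simp
  have small: "2 * (12 * r) < 1" "2 * (12 * (K * r)) < 1"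
  proof -
    have "12 * (K * r) \<le> C * (K * r)" using C K r by (intro mult_right_mono) auto
    then show "2 * (12 * (K * r)) < 1" using CKr by linarith
    then show "2 * (12 * r) < 1" using rKr by linarith
  qed
  show ?thesis
  proof (rule hom_component_eq)
    show "0 < r / \<rho>" using r \<rho> by simp
    fix s assume s: "\<bar>s\<bar> < r / \<rho>"
    let ?se = "\<lambda>a. s *\<^sub>R e a"
    have se: "size_le ?se r" using size_le_scale_small[OF \<rho>(2), of s r] s \<rho> by (simp add: field_simps)
    have ose: "op.size_le (\<lambda>a. ad (?se a)) (K * r)" using op_size_le[OF se] by (simp add: K_def)
    have todd: "fps_op todd_fps (com Y) v = v + op.ev (\<lambda>a. ad (?se a)) (todd_series y) v"
      if "geo_bdd 12 y" "y [] = 0" "ad Y = op.ev (\<lambda>a. ad (?se a)) y" for Y y v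
      by (rule fps_op_todd[OF that(1,2) D ose _ that(3)]) (use CKr in \<open>simp add: C_def\<close>)
    have l12: "geo_bdd 12 (letter a)" for a by (rule geo_bdd_mono[OF geo_bdd_letter]) simp
    define A where "A v = fps_op todd_fps (com (s *\<^sub>R e False)) v + fps_op todd_fps (com (s *\<^sub>R e True)) v
      - fps_op todd_fps (com (ch com (s *\<^sub>R e False) (s *\<^sub>R e True))) v - v" for v
    let ?ev = "op.ev (\<lambda>a. ad (?se a))"
    have A: "A v = ?ev (todd_series (letter False)) v + ?ev (todd_series (letter True)) v - ?ev (todd_series z_series) v" for v
      unfolding A_def
      using todd[OF l12[of False], of "s *\<^sub>R e False" v] todd[OF l12[of True], of "s *\<^sub>R e True" v]
        todd[OF geo_bdd_z, of "ch com (s *\<^sub>R e False) (s *\<^sub>R e True)" v] ad_ch[OF se small(1) ose small(2)]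
      by (simp add: op.ev_letter)
    have ts: "geo_bdd C (todd_series y)" if "geo_bdd 12 y" "y [] = 0" for y
      using todd_series_geo_bdd(2)[OF D that] by (simp add: C_def)
    have ts0: "todd_series y [] = 0" if "y [] = 0" for y using that by (simp add: todd_series_def)
    define T where "T w v = s ^ length w *\<^sub>R (right_coeff w *\<^sub>R ad_word e w v)" for w v
    have hs: "((\<lambda>w. T w v) has_sum A v) UNIV" for v
    proof -
      have h: "((\<lambda>w. y w *\<^sub>R blinfun_apply (op.mon (\<lambda>a. ad (?se a)) w) v) has_sum (?ev y) v) UNIV" if "geo_bdd C y" for y
        using has_sum_bounded_linear[OF blinfun.bounded_linear_left op.ev_has_sum[OF that ose CKr], of v]
        by (simp add: o_def scaleR_blinfun.rep_eq)
      have "((\<lambda>w. todd_series (letter False) w *\<^sub>R blinfun_apply (op.mon (\<lambda>a. ad (?se a)) w) v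
          + todd_series (letter True) w *\<^sub>R blinfun_apply (op.mon (\<lambda>a. ad (?se a)) w) v
          + (-1) *\<^sub>R (todd_series z_series w *\<^sub>R blinfun_apply (op.mon (\<lambda>a. ad (?se a)) w) v)) has_sum
          (?ev (todd_series (letter False)) v + ?ev (todd_series (letter True)) v + (-1) *\<^sub>R ?ev (todd_series z_series) v)) UNIV"
        by (intro has_sum_add has_sum_scaleR h ts l12 geo_bdd_z series_Nil)
      moreover have "todd_series (letter False) w *\<^sub>R blinfun_apply (op.mon (\<lambda>a. ad (?se a)) w) v
          + todd_series (letter True) w *\<^sub>R blinfun_apply (op.mon (\<lambda>a. ad (?se a)) w) v
          + (-1) *\<^sub>R (todd_series z_series w *\<^sub>R blinfun_apply (op.mon (\<lambda>a. ad (?se a)) w) v) = T w v" for w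
      proof (cases "w = []")
        case False
        have "op.mon (\<lambda>a. ad (?se a)) w = s ^ length w *\<^sub>R op.mon (\<lambda>a. ad (e a)) w"
          using op.mon_scale[of s "\<lambda>a. ad (e a)" w] by (simp add: linear_simps(5)[OF bounded_linear_ad])
        then show ?thesis
          by (simp add: T_def right_coeff_def op_mon_apply[OF False] scaleR_blinfun.rep_eq algebra_simps)
      qed (simp add: T_def right_coeff_def ts0)
      ultimately show ?thesis by (simp add: A)
    qed
    have lin_ad: "linear (ad_word e w)" for w
    proof (rule linearI)
      show "ad_word e w (x + y) = ad_word e w x + ad_word e w y" for x y
        by (induction w) (auto simp: com_add_right)
      show "ad_word e w (k *\<^sub>R x) = k *\<^sub>R ad_word e w x" for k x
        by (induction w) (auto simp: com_scale_right)
    qed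
    have ad_L: "ad_word e w v \<in> L" if "v \<in> L" for w v
      using that by (induction w) (auto intro: com_L e)
    have "((\<lambda>w. tr (T w)) has_sum trace_on L A) UNIV"
      unfolding T_def
      by (rule has_sum_trace[OF hs[unfolded T_def]])
        (auto intro!: linear_compose_scale_right lin_ad subspace_scale[OF subspace_L] ad_L)
    then have "((\<lambda>w. (1 / 2) *\<^sub>R tr (T w)) has_sum (1 / 2) *\<^sub>R trace_on L A) UNIV" by (rule has_sum_scaleR)
    then show "((\<lambda>w. s ^ length w * (1 / 2 * (right_coeff w * tr (ad_word e w)))) has_sum
        kv_trace_right L com (s *\<^sub>R e False) (s *\<^sub>R e True)) UNIV"
      by (simp add: kv_trace_right_def A_def[abs_def] T_def[abs_def] tr_scale mult_ac)
  qed
qed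

end

section \<open>Matrices as bounded sequences\<close>

text \<open>With a metric on the index set, bounded sequences are bounded continuous functions on a metric space and
therefore form a Banach space.\<close>

instantiation nat :: metric_space
begin

definition dist_nat :: "nat \<Rightarrow> nat \<Rightarrow> real" where
  "dist_nat m n = \<bar>real m - real n\<bar>"

definition uniformity_nat :: "(nat \<times> nat) filter" where
  "uniformity_nat = (INF e\<in>{0 <..}. principal {(x, y). dist x y < e})"

instance
proof
  show "uniformity = (INF e\<in>{0 <..}. principal {(x :: nat, y). dist x y < e})"
    by (rule uniformity_nat_def)
  show "open U = (\<forall>x\<in>U. eventually (\<lambda>(x', y). x' = x \<longrightarrow> y \<in> U) uniformity)" for U :: "nat set"
  proof -
    have "uniformity \<le> principal {(x :: nat, y). dist x y < 1}"
      unfolding uniformity_nat_def by (rule INF_lower) simp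
    moreover have "eventually (\<lambda>(x', y). x' = x \<longrightarrow> y \<in> U) (principal {(x :: nat, y). dist x y < 1})"
      if "x \<in> U" for x
    proof -
      have "y = x" if "dist x y < 1" for y :: nat
        using that unfolding dist_nat_def by linarith
      then show ?thesis using that by (auto simp: eventually_principal)
    qed
    ultimately show ?thesis using filter_leD by (auto simp: open_discrete)
  qed
qed (auto simp: dist_nat_def)

end

instance bcontfun :: (metric_space, banach) banach ..

type_synonym bseq = "nat \<Rightarrow>\<^sub>C real"

definition supp_fun :: "nat set \<Rightarrow> (nat \<Rightarrow> real) \<Rightarrow> bseq" where
  "supp_fun I g = Bcontfun (\<lambda>n. if n \<in> I then g n else 0)"

lemma supp_fun_apply [simp]:
  assumes "finite I"
  shows "apply_bcontfun (supp_fun I g) n = (if n \<in> I then g n else 0)"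
proof -
  have "finite (range (\<lambda>n. if n \<in> I then g n else 0))"
    by (rule finite_subset[of _ "insert 0 (g ` I)"]) (use assms in auto)
  then have "(\<lambda>n. if n \<in> I then g n else 0) \<in> bcontfun"
    by (auto simp: bcontfun_def intro: finite_imp_bounded)
  then show ?thesis by (simp add: supp_fun_def Bcontfun_inverse)
qed

text \<open>The index \<open>9 * i + j\<close> with \<open>i < 8\<close> and \<open>j < 9\<close> stands for the entry \<open>(i, j)\<close> of a matrix of size 9 with last row zero.
Such matrices form the affine Lie algebra: the first eight columns are \<open>gl(8)\<close>, the last column is its module
\<open>R^8\<close>. All other entries of a sequence are ignored by the product, which is associative on the whole space.\<close>

definition mat_mult :: "bseq \<Rightarrow> bseq \<Rightarrow> bseq" where
  "mat_mult f g = supp_fun {..<72} (\<lambda>n. \<Sum>l<8. apply_bcontfun f (9 * (n div 9) + l) * apply_bcontfun g (9 * l + n mod 9))"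

lemma mat_mult_apply: "apply_bcontfun (mat_mult f g) n =
    (if n < 72 then \<Sum>l<8. apply_bcontfun f (9 * (n div 9) + l) * apply_bcontfun g (9 * l + n mod 9) else 0)"
  by (simp add: mat_mult_def)

lemma mat_mult_entry:
  assumes "i < 8" "j < 9"
  shows "apply_bcontfun (mat_mult f g) (9 * i + j) = (\<Sum>l<8. apply_bcontfun f (9 * i + l) * apply_bcontfun g (9 * l + j))"
proof -
  have "(9 * i + j) div 9 = i" "(9 * i + j) mod 9 = j" "9 * i + j < 72" using assms by auto
  then show ?thesis by (simp add: mat_mult_apply)
qed

lemma mat_mult_assoc: "mat_mult (mat_mult f g) h = mat_mult f (mat_mult g h)"
proof (rule bcontfun_eqI)
  fix n
  show "apply_bcontfun (mat_mult (mat_mult f g) h) n = apply_bcontfun (mat_mult f (mat_mult g h)) n"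
  proof (cases "n < 72")
    case True
    then have n: "n div 9 < 8" "n mod 9 < 9" by auto
    have "apply_bcontfun (mat_mult (mat_mult f g) h) n =
       (\<Sum>l<8. \<Sum>k<8. apply_bcontfun f (9 * (n div 9) + k) * apply_bcontfun g (9 * k + l) * apply_bcontfun h (9 * l + n mod 9))"
      using True n by (simp add: mat_mult_apply[of "mat_mult f g"] mat_mult_entry sum_distrib_right)
    also have "\<dots> = (\<Sum>k<8. \<Sum>l<8. apply_bcontfun f (9 * (n div 9) + k) * apply_bcontfun g (9 * k + l) * apply_bcontfun h (9 * l + n mod 9))"
      by (rule sum.swap)
    also have "\<dots> = apply_bcontfun (mat_mult f (mat_mult g h)) n"
      using True n by (simp add: mat_mult_apply[of f] mat_mult_entry sum_distrib_left mult.assoc)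
    finally show ?thesis .
  qed (simp add: mat_mult_apply)
qed

lemma banach_product_mat_mult: "banach_product mat_mult"
proof (intro banach_product.intro banach_product_axioms.intro)
  show "bounded_bilinear mat_mult"
  proof
    show "\<exists>K. \<forall>a b. norm (mat_mult a b) \<le> norm a * norm b * K"
    proof (intro exI[of _ 8] allI)
      fix a b :: bseq
      show "norm (mat_mult a b) \<le> norm a * norm b * 8"
      proof (rule norm_bound)
        fix n
        have "norm (apply_bcontfun (mat_mult a b) n) \<le> (\<Sum>l<8::nat. norm a * norm b)"
        proof (cases "n < 72")
          case True
          have "norm (apply_bcontfun (mat_mult a b) n) \<le> (\<Sum>l<8. norm (apply_bcontfun a (9 * (n div 9) + l) * apply_bcontfun b (9 * l + n mod 9)))"
            using True by (simp add: mat_mult_apply sum_abs)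
          also have "\<dots> \<le> (\<Sum>l<8::nat. norm a * norm b)"
            unfolding norm_mult by (intro sum_mono mult_mono norm_bounded) auto
          finally show ?thesis .
        qed (simp add: mat_mult_apply)
        then show "norm (apply_bcontfun (mat_mult a b) n) \<le> norm a * norm b * 8" by simp
      qed
    qed
  qed (auto intro!: bcontfun_eqI simp: mat_mult_apply plus_bcontfun.rep_eq scaleR_bcontfun.rep_eq distrib_left distrib_right sum.distrib sum_distrib_left mult_ac)
qed (rule mat_mult_assoc)

definition L_of :: "nat set \<Rightarrow> bseq set" where
  "L_of I = {f. \<forall>n. n \<notin> I \<longrightarrow> apply_bcontfun f n = 0}"

definition unit_seq :: "nat \<Rightarrow> bseq" where
  "unit_seq k = supp_fun {k} (\<lambda>_. 1)"

lemma unit_seq_apply [simp]: "apply_bcontfun (unit_seq k) n = (if n = k then 1 else 0)"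
  by (simp add: unit_seq_def)

lemma inj_unit_seq: "inj unit_seq"
  by (rule injI) (metis unit_seq_apply zero_neq_one)

lemma bounded_linear_apply_bcontfun: "bounded_linear (\<lambda>f :: bseq. apply_bcontfun f n)"
  by (rule bounded_linear_intro[of _ 1]) (use norm_bounded in \<open>auto simp: plus_bcontfun.rep_eq scaleR_bcontfun.rep_eq simp del: real_norm_def\<close>)

lemma apply_bcontfun_sum: "apply_bcontfun (\<Sum>i\<in>S. g i) n = (\<Sum>i\<in>S. apply_bcontfun (g i :: bseq) n)"
  by (rule linear_sum[OF bounded_linear.linear[OF bounded_linear_apply_bcontfun]])

text \<open>The support of \<open>gl(8)\<close> for \<open>d = 8\<close> and of the affine algebra for \<open>d = 9\<close>.\<close>

definition mat_idx :: "nat \<Rightarrow> nat set" where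
  "mat_idx d = {n. n < 72 \<and> n mod 9 < d}"

lemma finite_mat_idx [simp]: "finite (mat_idx d)"
  by (rule finite_subset[of _ "{..<72}"]) (auto simp: mat_idx_def)

lemma unit_expansion:
  assumes "finite I" "f \<in> L_of I"
  shows "f = (\<Sum>n\<in>I. apply_bcontfun f n *\<^sub>R unit_seq n)"
proof (rule bcontfun_eqI)
  fix k
  show "apply_bcontfun f k = apply_bcontfun (\<Sum>n\<in>I. apply_bcontfun f n *\<^sub>R unit_seq n) k"
    using assms by (cases "k \<in> I") (auto simp: apply_bcontfun_sum L_of_def scaleR_bcontfun.rep_eq sum.delta' if_distrib cong: if_cong)
qed

lemma subspace_L_of: "subspace (L_of I)"
  by (auto simp: subspace_def L_of_def plus_bcontfun.rep_eq scaleR_bcontfun.rep_eq)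

lemma span_unit_seq:
  assumes "finite I"
  shows "span (unit_seq ` I) = L_of I"
proof
  show "span (unit_seq ` I) \<subseteq> L_of I"
    by (rule span_minimal[OF _ subspace_L_of]) (auto simp: L_of_def)
  show "L_of I \<subseteq> span (unit_seq ` I)"
  proof
    fix f assume "f \<in> L_of I"
    from unit_expansion[OF assms this] show "f \<in> span (unit_seq ` I)"
      by (metis (no_types, lifting) imageI span_base span_scale span_sum)
  qed
qed

lemma independent_unit_seq: "finite I \<Longrightarrow> independent (unit_seq ` I)"
proof (rule independent_if_scalars_zero)
  fix g :: "bseq \<Rightarrow> real" and x
  assume I: "finite I" and z: "(\<Sum>x\<in>unit_seq ` I. g x *\<^sub>R x) = 0" and "x \<in> unit_seq ` I"
  then obtain k where k: "k \<in> I" "x = unit_seq k" by auto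
  have "0 = apply_bcontfun (\<Sum>n\<in>I. g (unit_seq n) *\<^sub>R unit_seq n) k"
    using z by (simp add: sum.reindex[OF inj_on_subset[OF inj_unit_seq]])
  also have "\<dots> = g (unit_seq k)"
    using I k by (simp add: apply_bcontfun_sum scaleR_bcontfun.rep_eq sum.delta' if_distrib cong: if_cong)
  finally show "g x = 0" using k by simp
qed auto

lemma closed_L_of: "closed (L_of I)"
proof -
  have "L_of I = (\<Inter>n\<in>-I. {f. apply_bcontfun f n = 0})" by (auto simp: L_of_def)
  moreover have "closed {f :: bseq. apply_bcontfun f n = 0}" for n
    by (intro closed_Collect_eq continuous_intros linear_continuous_on bounded_linear_apply_bcontfun)
  ultimately show ?thesis by auto
qed

lemma mat_mult_L_of: "g \<in> L_of (mat_idx d) \<Longrightarrow> mat_mult f g \<in> L_of (mat_idx d)"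
  unfolding L_of_def mat_idx_def by (auto simp: mat_mult_apply intro!: sum.neutral)

definition coord_of :: "bseq \<Rightarrow> bseq \<Rightarrow> real" where
  "coord_of b f = apply_bcontfun f (inv unit_seq b)"

lemma lie_carrier_mat_idx: "lie_carrier mat_mult (L_of (mat_idx d)) (unit_seq ` mat_idx d) coord_of"
proof (intro lie_carrier.intro banach_product_mat_mult lie_carrier_axioms.intro)
  show "bounded_linear (coord_of b)" for b
    unfolding coord_of_def[abs_def] by (rule bounded_linear_apply_bcontfun)
  show "coord_of b f = representation (unit_seq ` mat_idx d) f b" if b: "b \<in> unit_seq ` mat_idx d" and f: "f \<in> L_of (mat_idx d)" for b f
  proof -
    obtain k where k: "k \<in> mat_idx d" "b = unit_seq k" using b by auto
    have "representation (unit_seq ` mat_idx d) f b = (\<Sum>n\<in>mat_idx d. apply_bcontfun f n * representation (unit_seq ` mat_idx d) (unit_seq n) b)"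
      by (subst unit_expansion[OF finite_mat_idx f], subst real_vector.representation_sum)
        (auto simp: independent_unit_seq span_base span_scale real_vector.representation_scale)
    also have "\<dots> = (\<Sum>n\<in>mat_idx d. if n = k then apply_bcontfun f n else 0)"
      by (rule sum.cong[OF refl])
        (use k inj_unit_seq in \<open>auto simp: real_vector.representation_basis independent_unit_seq dest: injD\<close>)
    also have "\<dots> = apply_bcontfun f k" using k by simp
    finally show ?thesis using k by (simp add: coord_of_def inv_f_f[OF inj_unit_seq])
  qed
qed (auto simp: independent_unit_seq span_unit_seq closed_L_of mat_mult_L_of)

interpretation mat: banach_product mat_mult by (rule banach_product_mat_mult)
interpretation L0: lie_carrier mat_mult "L_of (mat_idx 8)" "unit_seq ` mat_idx 8" coord_of by (rule lie_carrier_mat_idx)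
interpretation L1: lie_carrier mat_mult "L_of (mat_idx 9)" "unit_seq ` mat_idx 9" coord_of by (rule lie_carrier_mat_idx)

lemma tr_diff:
  "L1.tr A = L0.tr A + (\<Sum>i<8. apply_bcontfun (A (unit_seq (9 * i + 8))) (9 * i + 8))"
proof -
  have *: "(\<Sum>b\<in>unit_seq ` I. coord_of b (A b)) = (\<Sum>n\<in>I. apply_bcontfun (A (unit_seq n)) n)" for I
    by (simp add: sum.reindex[OF inj_on_subset[OF inj_unit_seq]] coord_of_def inv_f_f[OF inj_unit_seq])
  have split: "mat_idx 9 = mat_idx 8 \<union> (\<lambda>i. 9 * i + 8) ` {..<8}"
  proof (rule set_eqI)
    fix n :: nat
    have "n < 72 \<and> n mod 9 = 8 \<longleftrightarrow> n \<in> (\<lambda>i. 9 * i + 8) ` {..<8}"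
    proof
      assume "n < 72 \<and> n mod 9 = 8"
      then have "n = 9 * (n div 9) + 8" "n div 9 < 8" using mult_div_mod_eq[of 9 n] by auto
      then show "n \<in> (\<lambda>i. 9 * i + 8) ` {..<8}" by blast
    qed auto
    moreover have "n mod 9 < 9" by simp
    ultimately show "n \<in> mat_idx 9 \<longleftrightarrow> n \<in> mat_idx 8 \<union> (\<lambda>i. 9 * i + 8) ` {..<8}"
      by (auto simp: mat_idx_def less_Suc_eq)
  qed
  have "mat_idx 8 \<inter> (\<lambda>i. 9 * i + 8) ` {..<8} = {}" by (auto simp: mat_idx_def)
  then have "(\<Sum>n\<in>mat_idx 9. apply_bcontfun (A (unit_seq n)) n) = (\<Sum>n\<in>mat_idx 8. apply_bcontfun (A (unit_seq n)) n)
      + (\<Sum>i<8. apply_bcontfun (A (unit_seq (9 * i + 8))) (9 * i + 8))"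
    unfolding split by (subst sum.union_disjoint) (auto simp: sum.reindex inj_on_def)
  then show ?thesis unfolding L0.tr_def L1.tr_def * .
qed

text \<open>An element of the last column annihilates everything from the left, because its only nonzero entry would be paired
with the zero last row.\<close>

lemma mat_mult_last_col: "mat_mult (unit_seq (9 * i + 8)) x = 0"
proof (rule bcontfun_eqI)
  fix n
  have "9 * (n div 9) + l \<noteq> 9 * i + 8" if "l < 8" for l
  proof
    assume "9 * (n div 9) + l = 9 * i + 8"
    then have "(9 * (n div 9) + l) mod 9 = (9 * i + 8) mod 9" by simp
    then show False using that by simp
  qed
  then show "apply_bcontfun (mat_mult (unit_seq (9 * i + 8)) x) n = apply_bcontfun 0 n"
    by (auto simp: mat_mult_apply intro!: sum.neutral)
qed

lemma com_last_col: "mat.com x (unit_seq (9 * i + 8)) = mat_mult x (unit_seq (9 * i + 8))"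
  by (simp add: mat.com_def mat_mult_last_col)

lemma mat_mult_unit_diag:
  assumes "i < 8"
  shows "apply_bcontfun (mat_mult x (unit_seq (9 * i + 8))) (9 * i + 8) = apply_bcontfun x (9 * i + i)"
proof -
  have eq: "9 * l + 8 = 9 * i + (8::nat) \<longleftrightarrow> l = i" for l by auto
  show ?thesis using assms by (simp add: mat_mult_entry eq if_distrib sum.delta cong: if_cong)
qed

definition diag_sum :: "bseq \<Rightarrow> real" where
  "diag_sum x = (\<Sum>i<8. apply_bcontfun x (9 * i + i))"

lemma ad_word_last_col:
  "w \<noteq> [] \<Longrightarrow> mat.ad_word e w (unit_seq (9 * i + 8)) = mat_mult (mat.mon e w) (unit_seq (9 * i + 8))"
proof (induction w)
  case (Cons a w)
  show ?case
  proof (cases "w = []")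
    case False
    then show ?thesis using Cons
      by (simp add: mat.com_def mat.mon_Cons mat_mult_assoc mat_mult_last_col mat.zero_right)
  qed (simp add: com_last_col)
qed simp

lemma tr_ad_word_diff:
  assumes "w \<noteq> []"
  shows "L1.tr (mat.ad_word e w) - L0.tr (mat.ad_word e w) = diag_sum (mat.mon e w)"
  by (simp add: tr_diff ad_word_last_col[OF assms] mat_mult_unit_diag diag_sum_def)

text \<open>Differentiating a word in the direction of the last column replaces one letter by a left annihilator, which only gives
a nonzero product when this letter is the last one.\<close>

lemma mon_deriv_last_col:
  fixes c :: bool
  defines "v \<equiv> \<lambda>i. unit_seq (9 * i + 8)"
  assumes "w \<noteq> []"
  shows "mat.com (e c) (mat.mon_deriv e (\<lambda>a. if a = c then v i else 0) w) =
    (if last w = c then mat_mult (mat.mon e (c # butlast w)) (v i) else 0)"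
proof -
  have z: "mat_mult (v i) x = 0" for x by (simp add: v_def mat_mult_last_col)
  have d: "mat.mon_deriv e (\<lambda>a. if a = c then v i else 0) w =
     (if last w = c then if butlast w = [] then v i else mat_mult (mat.mon e (butlast w)) (v i) else 0)"
    using assms(2)
  proof (induction w)
    case (Cons a w)
    show ?case
    proof (cases "w = []")
      case False
      have b: "butlast (a # w) = a # butlast w" "last (a # w) = last w" using False by auto
      show ?thesis
        using Cons.IH[OF False] False
        by (auto simp: b z mat.zero_left mat.zero_right mat.mon_Cons mat_mult_assoc)
    qed simp
  qed simp
  show ?thesis
    unfolding d
    by (auto simp: mat.com_def z mat.zero_left mat.zero_right mat_mult_assoc mat.mon_Cons)
qed

text \<open>The coefficient with which the trace of a word on the last column enters the left side.\<close>

definition left_coeff :: nc_series where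
  "left_coeff w = (if last w then G_series_of F0_series w else F0_series w)"

lemma left_term_diff:
  assumes "w \<noteq> []"
  shows "L1.left_term e w - L0.left_term e w = left_coeff w * diag_sum (mat.mon e (last w # butlast w))"
proof -
  have i1: "(\<lambda>a. if a then 0 else v) = (\<lambda>a. if a = False then v else 0)"
    "(\<lambda>a. if a then v else 0) = (\<lambda>a. if a = True then v else 0)" for v :: bseq by auto
  have "F0_series w *\<^sub>R mat.com (e False) (mat.mon_deriv e (\<lambda>a. if a then 0 else unit_seq (9 * i + 8)) w) +
      G_series_of F0_series w *\<^sub>R mat.com (e True) (mat.mon_deriv e (\<lambda>a. if a then unit_seq (9 * i + 8) else 0) w)
      = left_coeff w *\<^sub>R mat_mult (mat.mon e (last w # butlast w)) (unit_seq (9 * i + 8))" for i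
    unfolding i1 mon_deriv_last_col[OF assms] by (auto simp: left_coeff_def)
  then show ?thesis
    unfolding L0.left_term_def L1.left_term_def tr_diff
    by (simp add: scaleR_bcontfun.rep_eq mat_mult_unit_diag diag_sum_def sum_distrib_left)
qed

section \<open>The cyclic representation\<close>

text \<open>The letter \<open>a\<close> moves from \<open>i\<close> to \<open>i + 1\<close> modulo 8 at those places \<open>i\<close> of the cyclic word where \<open>a\<close> stands.\<close>

definition cyc_letter :: "bool list \<Rightarrow> bool \<Rightarrow> bseq" where
  "cyc_letter W a = supp_fun {..<72} (\<lambda>n. if n mod 9 = (n div 9 + 1) mod 8 \<and> W ! (n div 9) = a then 1 else 0)"

lemma cyc_letter_entry:
  "i < 8 \<Longrightarrow> j < 9 \<Longrightarrow> apply_bcontfun (cyc_letter W a) (9 * i + j) = (if j = (i + 1) mod 8 \<and> W ! i = a then 1 else 0)"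
proof -
  assume "i < 8" "j < 9"
  then have "(9 * i + j) div 9 = i" "(9 * i + j) mod 9 = j" "9 * i + j < 72" by auto
  then show ?thesis by (simp add: cyc_letter_def)
qed

lemma cyc_letter_L: "cyc_letter W a \<in> L_of (mat_idx 8)"
proof -
  have "(n div 9 + 1) mod 8 < 8" for n :: nat by simp
  then show ?thesis by (auto simp: cyc_letter_def L_of_def mat_idx_def)
qed

lemma L0_subset_L1: "L_of (mat_idx 8) \<subseteq> L_of (mat_idx 9)"
  by (auto simp: L_of_def mat_idx_def)

lemma mon_cyc_letter:
  assumes "w \<noteq> []" "i < 8" "j < 9"
  shows "apply_bcontfun (mat.mon (cyc_letter W) w) (9 * i + j) =
    (if j = (i + length w) mod 8 \<and> (\<forall>k<length w. w ! k = W ! ((i + k) mod 8)) then 1 else 0)"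
  using assms
proof (induction w arbitrary: i)
  case (Cons a w)
  show ?case
  proof (cases "w = []")
    case True
    then show ?thesis using Cons.prems by (auto simp: cyc_letter_entry)
  next
    case False
    let ?i = "(i + 1) mod 8"
    have "apply_bcontfun (mat.mon (cyc_letter W) (a # w)) (9 * i + j) =
      (\<Sum>l<8. apply_bcontfun (cyc_letter W a) (9 * i + l) * apply_bcontfun (mat.mon (cyc_letter W) w) (9 * l + j))"
      using Cons.prems by (simp add: mat.mon_Cons[OF False] mat_mult_entry)
    also have "\<dots> = (\<Sum>l<8. if l = ?i then (if W ! i = a then apply_bcontfun (mat.mon (cyc_letter W) w) (9 * l + j) else 0) else 0)"
      using Cons.prems by (intro sum.cong) (auto simp: cyc_letter_entry)
    also have "\<dots> = (if W ! i = a then apply_bcontfun (mat.mon (cyc_letter W) w) (9 * ?i + j) else 0)"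
      by (subst sum.delta) auto
    also have "\<dots> = (if j = (i + length (a # w)) mod 8 \<and> (\<forall>k<length (a # w). (a # w) ! k = W ! ((i + k) mod 8)) then 1 else 0)"
    proof -
      have "(?i + length w) mod 8 = (i + length (a # w)) mod 8" by (simp add: mod_simps)
      moreover have "(\<forall>k<length (a # w). (a # w) ! k = W ! ((i + k) mod 8)) \<longleftrightarrow>
         W ! i = a \<and> (\<forall>k<length w. w ! k = W ! ((?i + k) mod 8))"
      proof -
        have "(?i + k) mod 8 = (i + Suc k) mod 8" for k by (simp add: mod_simps)
        then show ?thesis using Cons.prems(2) by (auto simp: All_less_Suc2)
      qed
      ultimately show ?thesis using Cons.IH[OF False, of ?i] Cons.prems by auto
    qed
    finally show ?thesis .
  qed
qed simp

lemma diag_sum_cyc: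
  assumes W: "length W = 8" and w: "length w = 8"
  shows "diag_sum (mat.mon (cyc_letter W) w) = (\<Sum>i<8. if w = rotate i W then 1 else 0)"
  unfolding diag_sum_def
proof (rule sum.cong[OF refl])
  fix i :: nat assume i: "i \<in> {..<8}"
  have "w = rotate i W \<longleftrightarrow> (\<forall>k<length w. w ! k = W ! ((i + k) mod 8))"
    using W w by (auto simp: list_eq_iff_nth_eq nth_rotate add.commute)
  moreover have "w \<noteq> []" using w by auto
  ultimately show "apply_bcontfun (mat.mon (cyc_letter W) w) (9 * i + i) = (if w = rotate i W then 1 else 0)"
    using i w by (subst mon_cyc_letter) auto
qed

lemma sum_words_cyc:
  assumes W: "length W = 8"
  shows "(\<Sum>w | length w = 8. h w * diag_sum (mat.mon (cyc_letter W) w)) = (\<Sum>i<8. h (rotate i W))"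
proof -
  have "(\<Sum>w | length w = 8. h w * diag_sum (mat.mon (cyc_letter W) w)) =
     (\<Sum>w | length w = 8. \<Sum>i<8. if w = rotate i W then h w else 0)"
    by (intro sum.cong refl) (simp add: diag_sum_cyc[OF W] sum_distrib_left if_distrib cong: if_cong)
  also have "\<dots> = (\<Sum>i<8. \<Sum>w | length w = 8. if w = rotate i W then h w else 0)" by (rule sum.swap)
  also have "\<dots> = (\<Sum>i<8. h (rotate i W))"
    by (intro sum.cong refl) (subst sum.delta, use W in auto)
  finally show ?thesis .
qed

text \<open>If the identity held for \<open>gl(8)\<close> and for the affine algebra, then it would hold for the difference of the traces,
which is the trace on the last column.\<close>

theorem cyclic_word_criterion:
  assumes W: "length W = 8"
    and ne: "(\<Sum>i<8. left_coeff (rotate (Suc i) W)) \<noteq> (\<Sum>i<8. 1 / 2 * right_coeff (rotate i W))"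
  shows "\<exists>(L :: bseq set) br X Y.
    fd_lie_algebra L br \<and> X \<in> L \<and> Y \<in> L \<and>
    hom_component 8 (kv_trace_left L br (kv_F0 br) (kv_G0 br)) X Y
      \<noteq> hom_component 8 (kv_trace_right L br) X Y"
proof (rule ccontr)
  assume neg: "\<not> ?thesis"
  let ?e = "cyc_letter W"
  have e0: "?e a \<in> L_of (mat_idx 8)" and e1: "?e a \<in> L_of (mat_idx 9)" for a
    using cyc_letter_L L0_subset_L1 by auto
  have eq0: "(\<Sum>w | length w = 8. L0.left_term ?e w) =
      (\<Sum>w | length w = 8. 1 / 2 * (right_coeff w * L0.tr (mat.ad_word ?e w)))"
    unfolding L0.hom_component_left[OF e0, symmetric] L0.hom_component_right[OF e0, symmetric]
    using neg L0.fd_lie_algebra e0 by blast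
  have eq1: "(\<Sum>w | length w = 8. L1.left_term ?e w) =
      (\<Sum>w | length w = 8. 1 / 2 * (right_coeff w * L1.tr (mat.ad_word ?e w)))"
    unfolding L1.hom_component_left[OF e1, symmetric] L1.hom_component_right[OF e1, symmetric]
    using neg L1.fd_lie_algebra e1 by blast
  have "(\<Sum>i<8. left_coeff (rotate (Suc i) W)) =
      (\<Sum>w | length w = 8. left_coeff (rotate1 w) * diag_sum (mat.mon ?e w))"
    using sum_words_cyc[OF W, of "\<lambda>w. left_coeff (rotate1 w)"] by simp
  also have "\<dots> = (\<Sum>w | length w = 8. left_coeff w * diag_sum (mat.mon ?e (last w # butlast w)))"
  proof (rule sum.reindex_bij_witness[of _ "\<lambda>w. last w # butlast w" rotate1])
    fix w :: "bool list" assume "w \<in> {w. length w = 8}"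
    then have w: "w \<noteq> []" "length w = 8" by auto
    show "last (rotate1 w) # butlast (rotate1 w) = w" using w by (cases w) auto
    show "rotate1 (last w # butlast w) = w" using w by simp
    show "last w # butlast w \<in> {w. length w = 8}" using w by simp
    show "left_coeff (rotate1 w) * diag_sum (mat.mon ?e (last (rotate1 w) # butlast (rotate1 w))) =
      left_coeff (rotate1 w) * diag_sum (mat.mon ?e w)" using w by (cases w) auto
  qed auto
  also have "\<dots> = (\<Sum>w | length w = 8. L1.left_term ?e w - L0.left_term ?e w)"
    by (rule sum.cong[OF refl], subst left_term_diff) auto
  also have "\<dots> = (\<Sum>w | length w = 8. 1 / 2 * right_coeff w * (L1.tr (mat.ad_word ?e w) - L0.tr (mat.ad_word ?e w)))"
    by (simp add: sum_subtractf eq0 eq1 algebra_simps)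
  also have "\<dots> = (\<Sum>w | length w = 8. 1 / 2 * right_coeff w * diag_sum (mat.mon ?e w))"
    by (rule sum.cong[OF refl], subst tr_ad_word_diff) auto
  also have "\<dots> = (\<Sum>i<8. 1 / 2 * right_coeff (rotate i W))"
    by (rule sum_words_cyc[OF W])
  finally show False using ne by simp
qed

section \<open>The Kashiwara-Vergne series in degree eight\<close>

lemma nc_mult_scale: "nc_mult (scale_series t f) (scale_series t g) = scale_series t (nc_mult f g)"
proof
  fix w
  have "nc_mult (scale_series t f) (scale_series t g) w =
     (\<Sum>i\<le>length w. (t ^ i * t ^ (length w - i)) * (f (take i w) * g (drop i w)))"
    unfolding nc_mult_def scale_series_def by (intro sum.cong refl) (simp add: min_absorb2 mult_ac)
  also have "\<dots> = (\<Sum>i\<le>length w. t ^ length w * (f (take i w) * g (drop i w)))"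
    by (intro sum.cong refl) (simp flip: power_add)
  finally show "nc_mult (scale_series t f) (scale_series t g) w = scale_series t (nc_mult f g) w"
    by (simp add: scale_series_def nc_mult_def sum_distrib_left)
qed

lemma nc_ad_power_scale:
  "(nc_ad \<alpha> \<beta> (scale_series t z) ^^ n) (scale_series t p) = scale_series t ((nc_ad \<alpha> \<beta> z ^^ n) p)"
proof (induction n)
  case (Suc n)
  have "nc_ad \<alpha> \<beta> (scale_series t z) (scale_series t q) = scale_series t (nc_ad \<alpha> \<beta> z q)" for q
    by (rule ext) (simp only: nc_ad_def nc_mult_scale, simp add: scale_series_def nc_ad_def algebra_simps)
  then show ?case by (simp add: Suc)
qed simp

lemma nc_mult_cmult_left: "nc_mult (\<lambda>w. c * f w) g w = c * nc_mult f g w"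
  and nc_mult_cmult_right: "nc_mult f (\<lambda>w. c * g w) w = c * nc_mult f g w"
  by (simp_all add: nc_mult_def sum_distrib_left mult_ac)

lemma nc_mult_sum_left: "nc_mult (\<lambda>w. \<Sum>k\<in>S. c k * h k w) g w = (\<Sum>k\<in>S. c k * nc_mult (h k) g w)"
  unfolding nc_mult_def sum_distrib_left sum_distrib_right by (subst sum.swap) (simp add: mult_ac)

lemma nc_ad_power_sum:
  "(nc_ad \<alpha> \<beta> z ^^ n) (\<lambda>w. \<Sum>k\<in>S. c k * h k w) = (\<lambda>w. \<Sum>k\<in>S. c k * (nc_ad \<alpha> \<beta> z ^^ n) (h k) w)"
proof (induction n)
  case (Suc n)
  have "nc_ad \<alpha> \<beta> z (\<lambda>w. \<Sum>k\<in>S. c k * q k w) = (\<lambda>w. \<Sum>k\<in>S. c k * nc_ad \<alpha> \<beta> z (q k) w)" for q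
    by (simp add: fun_eq_iff nc_ad_def nc_mult_sum_left nc_mult_sum_right sum_distrib_left sum.distrib algebra_simps)
  then show ?case by (simp add: Suc)
qed simp

lemma nc_ad_power_cmult:
  "(nc_ad \<alpha> \<beta> (\<lambda>w. c * z w) ^^ n) p = (\<lambda>w. c ^ n * (nc_ad \<alpha> \<beta> z ^^ n) p w)"
proof (induction n)
  case (Suc n)
  have "nc_ad \<alpha> \<beta> (\<lambda>w. c * z w) (\<lambda>w. d * q w) = (\<lambda>w. c * d * nc_ad \<alpha> \<beta> z q w)" for d q
    by (rule ext) (simp add: nc_ad_def nc_mult_cmult_left nc_mult_cmult_right algebra_simps)
  then show ?case by (simp add: Suc)
qed simp

lemma nc_ad_power_cmult_right: "(nc_ad \<alpha> \<beta> z ^^ n) (\<lambda>w. c * p w) = (\<lambda>w. c * (nc_ad \<alpha> \<beta> z ^^ n) p w)"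
  using nc_ad_power_sum[where c = "\<lambda>_. c" and h = "\<lambda>_. p" and S = "{()}"] by simp

lemma letter_cmult: "(\<lambda>w. t * letter a w) = scale_series t (letter a)"
  "(\<lambda>w. t * two_letters w) = scale_series t two_letters"
  by (auto simp: fun_eq_iff letter_def two_letters_def scale_series_def)

lemma nc_ad_letter_cong:
  assumes "\<And>v. Suc (length v) = length w \<Longrightarrow> f v = g v"
  shows "nc_ad \<alpha> \<beta> (letter a) f w = nc_ad \<alpha> \<beta> (letter a) g w"
proof -
  have 1: "letter a (take i w) * f (drop i w) = letter a (take i w) * g (drop i w)" if "i \<le> length w" for i
    using that assms[of "drop i w"] by (cases "i = 1") (auto simp: letter_def dest!: arg_cong[where f = length])
  have 2: "f (take i w) * letter a (drop i w) = g (take i w) * letter a (drop i w)" if "i \<le> length w" for i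
    using that assms[of "take i w"] by (cases "Suc i = length w") (auto simp: letter_def dest!: arg_cong[where f = length])
  have "nc_mult (letter a) f w = nc_mult (letter a) g w" "nc_mult f (letter a) w = nc_mult g (letter a) w"
    unfolding nc_mult_def by (intro sum.cong refl 1 2; simp)+
  then show ?thesis by (simp add: nc_ad_def)
qed

lemma nc_ad_letter_power_cong:
  assumes "\<And>v. length v = m \<Longrightarrow> f v = g v" "length w = n + m"
  shows "(nc_ad \<alpha> \<beta> (letter a) ^^ n) f w = (nc_ad \<alpha> \<beta> (letter a) ^^ n) g w"
  using assms(2)
proof (induction n arbitrary: w)
  case (Suc n)
  show ?case unfolding funpow.simps o_apply by (rule nc_ad_letter_cong) (use Suc in auto)
qed (use assms(1) in auto)

definition p_series :: nc_series where
  "p_series = nc_fps 1 (-1) psi_fps z_series two_letters"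

abbreviation adx_p :: "nat \<Rightarrow> nc_series" where
  "adx_p n \<equiv> (nc_ad 1 (-1) (letter False) ^^ n) p_series"

lemma p_series_Nil [simp]: "p_series [] = 0"
  by (simp add: p_series_def)

text \<open>Homogeneity in \<open>t\<close>. The factor \<open>t\<close> on the left accounts for the argument \<open>X + Y\<close>, which is not scaled.\<close>

lemma p_scale: "t * nc_fps 1 (-1) psi_fps (scale_series t z_series) two_letters w = t ^ length w * p_series w"
proof -
  have *: "t * (nc_ad 1 (-1) (scale_series t z_series) ^^ n) two_letters w = t ^ length w * (nc_ad 1 (-1) z_series ^^ n) two_letters w" for n
    using fun_cong[OF nc_ad_power_cmult_right[where \<alpha> = 1 and \<beta> = "-1" and z = "scale_series t z_series" and n = n and c = t and p = two_letters], of w]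
    unfolding letter_cmult nc_ad_power_scale by (simp add: scale_series_def)
  then show ?thesis
    unfolding p_series_def nc_fps_def sum_distrib_left
    by (intro sum.cong refl) (simp only: mult.left_commute[of t] *, simp)
qed

text \<open>The powers of \<open>t\<close> are kept on the left to avoid subtraction in the exponent.\<close>

lemma adx_p_scale:
  "t ^ Suc n * (nc_ad 1 (-1) (letter False) ^^ n) (nc_fps 1 (-1) psi_fps (scale_series t z_series) two_letters) w
    = t ^ length w * adx_p n w"
proof -
  let ?p = "nc_fps 1 (-1) psi_fps (scale_series t z_series) two_letters"
  have "(\<lambda>w. t * ?p w) = scale_series t p_series" by (simp add: fun_eq_iff p_scale scale_series_def)
  then have "(nc_ad 1 (-1) (scale_series t (letter False)) ^^ n) (\<lambda>w. t * ?p w) w = t ^ length w * adx_p n w"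
    by (simp add: nc_ad_power_scale) (simp add: scale_series_def)
  then show ?thesis
    unfolding letter_cmult(1)[symmetric] by (simp add: nc_ad_power_cmult nc_ad_power_cmult_right mult_ac)
qed

definition bern_fps :: "real fps" where
  "bern_fps = inverse (exp_tail (- 1) 1)"

abbreviation bern :: "nat \<Rightarrow> real" where
  "bern \<equiv> fps_nth bern_fps"

text \<open>The coefficient of \<open>(ad x)^n p\<close> in \<open>F^1\<close> at words of length \<open>l\<close>: the coefficient of \<open>z^n\<close> in the quotient
\<open>(1 - exp(-t z)) / (1 - exp(-z))\<close> times \<open>t ^ (l - n - 1)\<close>, integrated over \<open>t\<close>.\<close>

definition kappa :: "nat \<Rightarrow> nat \<Rightarrow> real" where
  "kappa l n = (\<Sum>i\<le>n. (-1) ^ i / fact (Suc i) * bern (n - i) / real (l - n + i + 1))"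

lemma has_integral_monomial: "((\<lambda>t. t ^ k) has_integral (1 / real (Suc k))) {0..1::real}"
proof -
  have "((\<lambda>t. t ^ k) has_integral ((\<lambda>t. t ^ Suc k / real (Suc k)) 1 - (\<lambda>t. t ^ Suc k / real (Suc k)) 0)) {0..1::real}"
  proof (rule fundamental_theorem_of_calculus)
    fix x :: real
    have "((\<lambda>t. t ^ Suc k / real (Suc k)) has_real_derivative x ^ k) (at x within {0..1})"
      by (rule DERIV_cong[OF DERIV_cdivide[OF DERIV_pow]]) (simp del: of_nat_Suc)
    then show "((\<lambda>t. t ^ Suc k / real (Suc k)) has_vector_derivative x ^ k) (at x within {0..1})"
      by (simp add: has_real_derivative_iff_has_vector_derivative)
  qed simp
  then show ?thesis by simp
qed

lemma F1_series_eq: "F1_series w = (\<Sum>n<length w. kappa (length w) n * adx_p n w)"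
proof -
  let ?l = "length w"
  define g where "g t = (\<Sum>n<?l. \<Sum>i\<le>n. ((-1) ^ i / fact (Suc i) * bern (n - i) * adx_p n w) * t ^ (?l - n + i))" for t :: real
  have eq: "kv_integrand t w = g t" if t: "t \<noteq> 0" for t
  proof -
    let ?p = "nc_fps 1 (-1) psi_fps (scale_series t z_series) two_letters"
    let ?D = "\<lambda>n. (nc_ad 1 (-1) (letter False) ^^ n) ?p w"
    have "kv_integrand t w = (\<Sum>n<?l. fps_nth (quot_fps t) n * ?D n)"
      unfolding kv_integrand_def nc_fps_def[of _ _ "quot_fps t"]
      by (rule sum.mono_neutral_right) (auto intro!: nc_ad_power_short)
    also have "\<dots> = g t"
      unfolding g_def
    proof (rule sum.cong[OF refl])
      fix n assume "n \<in> {..<?l}"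
      then have "?l = Suc n + (?l - Suc n)" by simp
      then have n: "t ^ ?l = t ^ Suc n * t ^ (?l - Suc n)" by (metis power_add)
      then have "t ^ Suc n * ?D n = t ^ Suc n * (t ^ (?l - Suc n) * adx_p n w)"
        unfolding adx_p_scale by simp
      then have D: "?D n = t ^ (?l - Suc n) * adx_p n w" using t by simp
      show "fps_nth (quot_fps t) n * ?D n = (\<Sum>i\<le>n. ((-1) ^ i / fact (Suc i) * bern (n - i) * adx_p n w) * t ^ (?l - n + i))"
        unfolding quot_fps_nth bern_fps_def[symmetric] D sum_distrib_right atLeast0AtMost
      proof (rule sum.cong[OF refl])
        fix i
        have "t ^ (?l - n + i) = t * t ^ i * t ^ (?l - Suc n)"
          using \<open>n \<in> {..<?l}\<close> by (simp add: Suc_diff_Suc add.commute[of i] flip: power_Suc power_add)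
        then show "t * fps_nth (exp_tail (- t) 1) i * bern (n - i) * (t ^ (?l - Suc n) * adx_p n w) =
            ((-1) ^ i / fact (Suc i) * bern (n - i) * adx_p n w) * t ^ (?l - n + i)"
          by (simp add: power_minus[of t] mult_ac del: fact_Suc)
      qed
    qed
    finally show ?thesis .
  qed
  have "(g has_integral (\<Sum>n<?l. \<Sum>i\<le>n. ((-1) ^ i / fact (Suc i) * bern (n - i) * adx_p n w) * (1 / real (Suc (?l - n + i))))) {0..1}"
    unfolding g_def by (intro has_integral_sum has_integral_mult_right has_integral_monomial) auto
  then have "((\<lambda>t. kv_integrand t w) has_integral (\<Sum>n<?l. \<Sum>i\<le>n. ((-1) ^ i / fact (Suc i) * bern (n - i) * adx_p n w) * (1 / real (Suc (?l - n + i))))) {0..1}"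
    by (rule has_integral_spike_finite[of "{0}", rotated 2]) (use eq in auto)
  then have "F1_series w = (\<Sum>n<?l. \<Sum>i\<le>n. ((-1) ^ i / fact (Suc i) * bern (n - i) * adx_p n w) * (1 / real (Suc (?l - n + i))))"
    unfolding F1_series_def by (rule integral_unique)
  also have "\<dots> = (\<Sum>n<?l. kappa ?l n * adx_p n w)"
    unfolding kappa_def sum_distrib_right by (intro sum.cong refl) (simp add: mult_ac del: fact_Suc)
  finally show ?thesis .
qed

lemma fps_nth_from_product:
  fixes f g h :: "real fps"
  assumes "f * g = h" "fps_nth f 0 = 1"
  shows "fps_nth g n = fps_nth h n - (\<Sum>i<n. fps_nth f (n - i) * fps_nth g i)"
proof -
  have "fps_nth h n = (\<Sum>i=0..n. fps_nth g i * fps_nth f (n - i))"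
    using assms(1) fps_mult_nth[of g f n] by (simp add: mult.commute)
  also have "{0..n} = insert n {..<n}" by auto
  finally show ?thesis using assms(2) by (simp add: mult.commute)
qed

lemmas sum_expand = lessThan_nat_numeral lessThan_Suc fact_numeral

lemma bern_values:
  "bern 0 = 1" "bern (Suc 0) = 1/2" "bern 2 = 1/12" "bern 3 = 0" "bern 4 = -1/720" "bern 5 = 0" "bern 6 = 1/30240" "bern 7 = 0"
proof -
  have "exp_tail (-1) 1 * bern_fps = 1" unfolding bern_fps_def by (rule inverse_mult_eq_1') simp
  note r = fps_nth_from_product[OF this]
  show b0: "bern 0 = 1" by (simp add: bern_fps_def)
  show b1: "bern (Suc 0) = 1/2" by (subst r) (simp_all add: b0)
  show b2: "bern 2 = 1/12" by (subst r) (simp_all add: sum_expand b0 b1)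
  show b3: "bern 3 = 0" by (subst r) (simp_all add: sum_expand b0 b1 b2)
  show b4: "bern 4 = -1/720" by (subst r) (simp_all add: sum_expand b0 b1 b2 b3)
  show b5: "bern 5 = 0" by (subst r) (simp_all add: sum_expand b0 b1 b2 b3 b4)
  show b6: "bern 6 = 1/30240" by (subst r) (simp_all add: sum_expand b0 b1 b2 b3 b4 b5)
  show b7: "bern 7 = 0" by (subst r) (simp_all add: sum_expand b0 b1 b2 b3 b4 b5 b6)
qed

lemma todd_values:
  "fps_nth todd_fps 0 = 1" "fps_nth todd_fps (Suc 0) = -1/2" "fps_nth todd_fps 2 = 1/12" "fps_nth todd_fps 3 = 0"
  "fps_nth todd_fps 4 = -1/720" "fps_nth todd_fps 5 = 0" "fps_nth todd_fps 6 = 1/30240" "fps_nth todd_fps 7 = 0"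
  "fps_nth todd_fps 8 = -1/1209600"
proof -
  have "exp_tail 1 1 * todd_fps = 1" unfolding todd_fps_eq by (rule inverse_mult_eq_1') simp
  note r = fps_nth_from_product[OF this]
  show b0: "fps_nth todd_fps 0 = 1" by (simp add: todd_fps_eq)
  show b1: "fps_nth todd_fps (Suc 0) = -1/2" by (subst r) (simp_all add: b0)
  show b2: "fps_nth todd_fps 2 = 1/12" by (subst r) (simp_all add: sum_expand b0 b1)
  show b3: "fps_nth todd_fps 3 = 0" by (subst r) (simp_all add: sum_expand b0 b1 b2)
  show b4: "fps_nth todd_fps 4 = -1/720" by (subst r) (simp_all add: sum_expand b0 b1 b2 b3)
  show b5: "fps_nth todd_fps 5 = 0" by (subst r) (simp_all add: sum_expand b0 b1 b2 b3 b4)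
  show b6: "fps_nth todd_fps 6 = 1/30240" by (subst r) (simp_all add: sum_expand b0 b1 b2 b3 b4 b5)
  show b7: "fps_nth todd_fps 7 = 0" by (subst r) (simp_all add: sum_expand b0 b1 b2 b3 b4 b5 b6)
  show b8: "fps_nth todd_fps 8 = -1/1209600" by (subst r) (simp_all add: sum_expand b0 b1 b2 b3 b4 b5 b6 b7)
qed

lemma psi_values:
  "fps_nth psi_fps 0 = 1/2" "fps_nth psi_fps (Suc 0) = 1/6" "fps_nth psi_fps 2 = 0" "fps_nth psi_fps 3 = -1/180"
  "fps_nth psi_fps 4 = 0" "fps_nth psi_fps 5 = 1/5040" "fps_nth psi_fps 6 = 0" "fps_nth psi_fps 7 = -1/151200"
proof -
  define q where "q = exp_tail (-1) 1 * psi_fps"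
  have "exp_tail 1 1 * q = exp_tail 1 2 * ((exp_tail 1 1 * exp_tail (-1) 1) * inverse (exp_tail 1 1 * exp_tail (-1) 1))"
    unfolding q_def psi_fps_eq by (simp only: mult_ac)
  also have "(exp_tail 1 1 * exp_tail (-1) 1) * inverse (exp_tail 1 1 * exp_tail (-1) 1) = (1 :: real fps)"
    by (rule inverse_mult_eq_1') simp
  finally have "exp_tail 1 1 * q = exp_tail 1 2" by simp
  note r = fps_nth_from_product[OF this]
  have q0: "fps_nth q 0 = 1/2" by (subst r) (simp_all add: fact_numeral)
  have q1: "fps_nth q (Suc 0) = -1/12" by (subst r) (simp_all add: q0 fact_numeral)
  have q2: "fps_nth q 2 = 0" by (subst r) (simp_all add: sum_expand q0 q1)
  have q3: "fps_nth q 3 = 1/720" by (subst r) (simp_all add: sum_expand q0 q1 q2)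
  have q4: "fps_nth q 4 = 0" by (subst r) (simp_all add: sum_expand q0 q1 q2 q3)
  have q5: "fps_nth q 5 = -1/30240" by (subst r) (simp_all add: sum_expand q0 q1 q2 q3 q4)
  have q6: "fps_nth q 6 = 0" by (subst r) (simp_all add: sum_expand q0 q1 q2 q3 q4 q5)
  have q7: "fps_nth q 7 = 1/1209600" by (subst r) (simp_all add: sum_expand q0 q1 q2 q3 q4 q5 q6)
  note s = fps_nth_from_product[OF q_def[symmetric]]
  show b0: "fps_nth psi_fps 0 = 1/2" by (subst s) (simp_all add: q0)
  show b1: "fps_nth psi_fps (Suc 0) = 1/6" by (subst s) (simp_all add: b0 q1)
  show b2: "fps_nth psi_fps 2 = 0" by (subst s) (simp_all add: sum_expand b0 b1 q2)
  show b3: "fps_nth psi_fps 3 = -1/180" by (subst s) (simp_all add: sum_expand b0 b1 b2 q3)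
  show b4: "fps_nth psi_fps 4 = 0" by (subst s) (simp_all add: sum_expand b0 b1 b2 b3 q4)
  show b5: "fps_nth psi_fps 5 = 1/5040" by (subst s) (simp_all add: sum_expand b0 b1 b2 b3 b4 q5)
  show b6: "fps_nth psi_fps 6 = 0" by (subst s) (simp_all add: sum_expand b0 b1 b2 b3 b4 b5 q6)
  show b7: "fps_nth psi_fps 7 = -1/151200" by (subst s) (simp_all add: sum_expand b0 b1 b2 b3 b4 b5 b6 q7)
qed

text \<open>Both \<open>F^1(X, Y)\<close> and \<open>exp(ad X) F^1(-X, -Y)\<close> are combinations of the series \<open>(ad x)^k p\<close>, with coefficients
which depend only on the length of the word.\<close>

lemma F0_series_degree_8:
  assumes w: "length w = 8"
  shows "F0_series w = (50400 * adx_p 0 w - 25200 * adx_p 1 w + 13800 * adx_p 2 w - 4800 * adx_p 3 w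
    + 1194 * adx_p 4 w - 232 * adx_p 5 w + 39 * adx_p 6 w - 6 * adx_p 7 w) / 453600 + z_series w / 4"
proof -
  have neg: "(nc_ad 1 (-1) (letter False) ^^ n) (scale_series (-1) F1_series) w =
      (-1) ^ (8 - n) * (\<Sum>k<8 - n. kappa (8 - n) k * adx_p (n + k) w)" if n: "n \<le> 8" for n
  proof -
    have "(nc_ad 1 (-1) (letter False) ^^ n) (scale_series (-1) F1_series) w =
       (nc_ad 1 (-1) (letter False) ^^ n) (\<lambda>v. \<Sum>k<8 - n. ((-1) ^ (8 - n) * kappa (8 - n) k) * adx_p k v) w"
      by (rule nc_ad_letter_power_cong[where m = "8 - n"])
        (use n w in \<open>auto simp: scale_series_def F1_series_eq sum_distrib_left mult_ac\<close>)
    also have "\<dots> = (\<Sum>k<8 - n. ((-1) ^ (8 - n) * kappa (8 - n) k) * adx_p (n + k) w)"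
      by (simp add: nc_ad_power_sum funpow_add)
    finally show ?thesis by (simp add: sum_distrib_left mult_ac)
  qed
  define D where "D k = adx_p k w" for k
  have "w \<noteq> [False]" using w by auto
  then have "F0_series w = 1 / 2 * ((\<Sum>k<8. kappa 8 k * D k)
     + (\<Sum>n\<le>8. 1 / fact n * ((-1) ^ (8 - n) * (\<Sum>k<8 - n. kappa (8 - n) k * D (n + k))))) + z_series w / 4"
    unfolding F0_series_def nc_fps_def w
    using w by (simp add: F1_series_eq neg letter_def D_def)
  also have "\<dots> = (50400 * D 0 - 25200 * D 1 + 13800 * D 2 - 4800 * D 3
    + 1194 * D 4 - 232 * D 5 + 39 * D 6 - 6 * D 7) / 453600 + z_series w / 4"
  proof -
    have "D (Suc (Suc 0)) = D 2" "D (Suc (Suc (Suc 0))) = D 3" by (simp_all add: eval_nat_numeral)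
    then show ?thesis
      by (simp add: lessThan_nat_numeral lessThan_Suc atMost_nat_numeral atMost_Suc kappa_def bern_values fact_numeral)
        (simp add: field_simps)
  qed
  finally show ?thesis by (simp add: D_def)
qed

section \<open>Integer tables along a cyclic word\<close>

text \<open>A table lists, for \<open>l = 0, \<dots>, 8\<close>, the coefficients of a series at the eight words of length \<open>l\<close> which can be read
off the cyclic word, indexed by their starting position. The empty list stands for the zero vector. The product of
series becomes a product of polynomials in a variable \<open>\<tau>\<close> that rotates vectors when they are moved past it.\<close>

type_synonym vec = "int list"
type_synonym table = "vec list"

fun vadd :: "vec \<Rightarrow> vec \<Rightarrow> vec" where
  "vadd [] b = b"
| "vadd a [] = a"
| "vadd (x # a) (y # b) = (x + y) # vadd a b"

fun vmul :: "vec \<Rightarrow> vec \<Rightarrow> vec" where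
  "vmul (x # a) (y # b) = (x * y) # vmul a b"
| "vmul _ _ = []"

fun tadd :: "table \<Rightarrow> table \<Rightarrow> table" where
  "tadd [] B = B"
| "tadd A [] = A"
| "tadd (a # A) (b # B) = vadd a b # tadd A B"

fun tmul :: "nat \<Rightarrow> table \<Rightarrow> table \<Rightarrow> table" where
  "tmul (Suc n) (a # A) B = tadd (map (vmul a) (take (Suc n) B)) ([] # tmul n A (map rotate1 B))"
| "tmul _ _ _ = []"

definition tscale :: "int \<Rightarrow> table \<Rightarrow> table" where
  "tscale k = map (map ((*) k))"

definition tdiv :: "int \<Rightarrow> table \<Rightarrow> table" where
  "tdiv k = map (map (\<lambda>x. x div k))"

definition divisible :: "int \<Rightarrow> table \<Rightarrow> bool" where
  "divisible k A \<longleftrightarrow> list_all (list_all (\<lambda>x. x mod k = 0)) A"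

fun tseries :: "(table \<Rightarrow> table) \<Rightarrow> table \<Rightarrow> int list \<Rightarrow> table" where
  "tseries S P [] = []"
| "tseries S P (k # ks) = (if ks = [] then tscale k P
     else tadd (if k = 0 then [] else tscale k P) (tseries S (S P) ks))"

definition tcom :: "table \<Rightarrow> table \<Rightarrow> table" where
  "tcom F P = tadd (tmul 9 F P) (tscale (-1) (tmul 9 P F))"

definition tab :: "bool list \<Rightarrow> (bool list \<Rightarrow> int) \<Rightarrow> table" where
  "tab W g = map (\<lambda>l. (\<lambda>v. if list_all (\<lambda>x. x = 0) v then [] else v) (map (\<lambda>i. g (take l (rotate i W))) [0..<8])) [0..<9]"

definition vnth :: "vec \<Rightarrow> nat \<Rightarrow> int" where
  "vnth v i = (if v = [] then 0 else v ! i)"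

definition wf_vec :: "vec \<Rightarrow> bool" where
  "wf_vec v \<longleftrightarrow> v = [] \<or> length v = 8"

fun entry :: "table \<Rightarrow> nat \<Rightarrow> nat \<Rightarrow> int" where
  "entry [] l i = 0"
| "entry (v # A) 0 i = vnth v i"
| "entry (v # A) (Suc l) i = entry A l i"

lemma vadd_zip: "length a = length b \<Longrightarrow> vadd a b = map2 (+) a b"
  by (induction a b rule: vadd.induct) auto

lemma vmul_zip: "vmul a b = map2 (*) a b"
  by (induction a b rule: vmul.induct) (auto simp: neq_Nil_conv)

lemma vadd_Nil2 [simp]: "vadd a [] = a" by (cases a) auto

lemma vec_add:
  assumes "wf_vec a" "wf_vec b"
  shows "wf_vec (vadd a b)" "i < 8 \<Longrightarrow> vnth (vadd a b) i = vnth a i + vnth b i"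
proof -
  consider "a = []" | "b = []" | "length a = 8" "length b = 8" using assms by (auto simp: wf_vec_def)
  then show "wf_vec (vadd a b)" "i < 8 \<Longrightarrow> vnth (vadd a b) i = vnth a i + vnth b i"
    using assms by (cases; auto simp: wf_vec_def vnth_def vadd_zip)+
qed

lemma vec_mul:
  assumes "wf_vec a" "wf_vec b"
  shows "wf_vec (vmul a b)" "i < 8 \<Longrightarrow> vnth (vmul a b) i = vnth a i * vnth b i"
  using assms by (auto simp: wf_vec_def vnth_def vmul_zip)

lemma entry_Nil_Cons [simp]: "entry ([] # A) l i = (case l of 0 \<Rightarrow> 0 | Suc l \<Rightarrow> entry A l i)"
  by (cases l) (auto simp: vnth_def)

lemma entry_add:
  assumes "list_all wf_vec A" "list_all wf_vec B" "i < 8"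
  shows "entry (tadd A B) l i = entry A l i + entry B l i"
  using assms
proof (induction A B arbitrary: l rule: tadd.induct)
  case (3 a A b B)
  then show ?case by (cases l) (auto simp: vec_add)
qed auto

lemma wf_add: "list_all wf_vec A \<Longrightarrow> list_all wf_vec B \<Longrightarrow> list_all wf_vec (tadd A B)"
  by (induction A B rule: tadd.induct) (auto simp: vec_add)

lemma entry_map:
  assumes "h [] = []" "\<And>v. v \<in> set A \<Longrightarrow> vnth (h v) i = g (vnth v j)" "g 0 = 0"
  shows "entry (map h A) l i = g (entry A l j)"
  using assms(2)
proof (induction A arbitrary: l)
  case (Cons v A)
  then show ?case by (cases l) auto
qed (use assms in auto)

lemma entry_take: "l < n \<Longrightarrow> entry (take n A) l i = entry A l i"
proof (induction A arbitrary: l n)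
  case (Cons v A)
  then show ?case by (cases n; cases l) auto
qed simp

lemma wf_map: "list_all wf_vec A \<Longrightarrow> (\<And>v. wf_vec v \<Longrightarrow> wf_vec (h v)) \<Longrightarrow> list_all wf_vec (map h A)"
  by (induction A) auto

lemma entry_scale:
  assumes "list_all wf_vec A" "i < 8"
  shows "entry (tscale k A) l i = k * entry A l i"
  unfolding tscale_def
  by (rule entry_map) (use assms in \<open>auto simp: list_all_iff wf_vec_def vnth_def\<close>)

lemma entry_div:
  assumes "list_all wf_vec A" "i < 8"
  shows "entry (tdiv k A) l i = entry A l i div k"
  unfolding tdiv_def
  by (rule entry_map) (use assms in \<open>auto simp: list_all_iff wf_vec_def vnth_def\<close>)

lemma wf_scale: "list_all wf_vec A \<Longrightarrow> list_all wf_vec (tscale k A)"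
  unfolding tscale_def by (rule wf_map) (auto simp: wf_vec_def)

lemma wf_div: "list_all wf_vec A \<Longrightarrow> list_all wf_vec (tdiv k A)"
  unfolding tdiv_def by (rule wf_map) (auto simp: wf_vec_def)

lemma entry_rotate:
  assumes "list_all wf_vec A" "i < 8"
  shows "entry (map rotate1 A) l i = entry A l (Suc i mod 8)"
proof (rule entry_map[where g = "\<lambda>x. x"])
  fix v assume "v \<in> set A"
  then have "v = [] \<or> length v = 8" using assms by (auto simp: list_all_iff wf_vec_def)
  then show "vnth (rotate1 v) i = vnth v (Suc i mod 8)"
    using assms(2) by (auto simp: vnth_def nth_rotate1)
qed auto

lemma wf_vec_Nil: "wf_vec []"
  by (simp add: wf_vec_def)

lemma tmul_correct:
  assumes "list_all wf_vec A" "list_all wf_vec B"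
  shows "list_all wf_vec (tmul n A B) \<and> (\<forall>l<n. \<forall>i<8.
    entry (tmul n A B) l i = (\<Sum>j\<le>l. entry A j i * entry B (l - j) ((i + j) mod 8)))"
  using assms
proof (induction n A B rule: tmul.induct)
  case (1 n a A B)
  have wB: "list_all wf_vec (map rotate1 B)" by (rule wf_map[OF 1(3)]) (auto simp: wf_vec_def)
  have wA: "list_all wf_vec A" and wa: "wf_vec a" using 1(2) by auto
  note IH = 1(1)[OF wA wB]
  have wT: "list_all wf_vec (take (Suc n) B)" using 1(3) by (auto simp: list_all_iff dest: in_set_takeD)
  have wM: "list_all wf_vec (map (vmul a) (take (Suc n) B))" by (rule wf_map[OF wT]) (rule vec_mul[OF wa])
  have wR: "list_all wf_vec ([] # tmul n A (map rotate1 B))" using IH wf_vec_Nil by simp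
  show ?case
  proof (intro conjI allI impI)
    show "list_all wf_vec (tmul (Suc n) (a # A) B)" using wf_add[OF wM wR] by simp
    fix l i :: nat assume l: "l < Suc n" and i: "i < 8"
    have "entry (map (vmul a) (take (Suc n) B)) l i = vnth a i * entry (take (Suc n) B) l i"
      by (rule entry_map) (use vec_mul[OF wa] wT i in \<open>auto simp: list_all_iff vmul_zip\<close>)
    then have "entry (tmul (Suc n) (a # A) B) l i =
        vnth a i * entry B l i + (case l of 0 \<Rightarrow> 0 | Suc l' \<Rightarrow> entry (tmul n A (map rotate1 B)) l' i)"
      using entry_add[OF wM wR i] entry_take[OF l] by simp
    also have "\<dots> = (\<Sum>j\<le>l. entry (a # A) j i * entry B (l - j) ((i + j) mod 8))"
    proof (cases l)
      case (Suc l')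
      have "entry (tmul n A (map rotate1 B)) l' i = (\<Sum>j\<le>l'. entry A j i * entry B (l' - j) ((i + Suc j) mod 8))"
      proof -
        have "entry (tmul n A (map rotate1 B)) l' i = (\<Sum>j\<le>l'. entry A j i * entry (map rotate1 B) (l' - j) ((i + j) mod 8))"
          using IH l i Suc by auto
        also have "\<dots> = (\<Sum>j\<le>l'. entry A j i * entry B (l' - j) ((i + Suc j) mod 8))"
          by (intro sum.cong refl) (simp add: entry_rotate[OF 1(3)] mod_simps)
        finally show ?thesis .
      qed
      then show ?thesis using i by (simp add: Suc sum.atMost_Suc_shift del: sum.atMost_Suc)
    qed (use i in simp)
    finally show "entry (tmul (Suc n) (a # A) B) l i = (\<Sum>j\<le>l. entry (a # A) j i * entry B (l - j) ((i + j) mod 8))" .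
  qed
qed auto

text \<open>The factor \<open>210 ^ l\<close>, with \<open>210 = 2 * 3 * 5 * 7\<close>, clears the denominators at words of length \<open>l\<close> and is
compatible with products.\<close>

definition tabulates :: "bool list \<Rightarrow> real \<Rightarrow> table \<Rightarrow> nc_series \<Rightarrow> bool" where
  "tabulates W c A f \<longleftrightarrow> list_all wf_vec A \<and>
    (\<forall>l\<le>8. \<forall>i<8. real_of_int (entry A l i) = c * 210 ^ l * f (take l (rotate i W)))"

lemma tabulatesD: "tabulates W c A f \<Longrightarrow> l \<le> 8 \<Longrightarrow> i < 8 \<Longrightarrow> real_of_int (entry A l i) = c * 210 ^ l * f (take l (rotate i W))"
  by (simp add: tabulates_def)

lemma tabulates_Nil: "tabulates W c [] (\<lambda>w. 0)"
  by (simp add: tabulates_def)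

lemma tabulates_add: "tabulates W c A f \<Longrightarrow> tabulates W c B g \<Longrightarrow> tabulates W c (tadd A B) (\<lambda>w. f w + g w)"
  unfolding tabulates_def by (auto simp: entry_add wf_add algebra_simps)

lemma tabulates_scale: "tabulates W c A f \<Longrightarrow> tabulates W c (tscale k A) (\<lambda>w. real_of_int k * f w)"
  unfolding tabulates_def by (auto simp: entry_scale wf_scale)

lemma tabulates_factor: "tabulates W c A (\<lambda>w. k * f w) = tabulates W (c * k) A f"
  unfolding tabulates_def by (simp add: mult_ac)

lemma entry_divisible: "divisible k A \<Longrightarrow> list_all wf_vec A \<Longrightarrow> i < 8 \<Longrightarrow> k dvd entry A l i"
proof (induction A arbitrary: l)
  case (Cons v A)
  then show ?case
    by (cases l) (auto simp: divisible_def vnth_def wf_vec_def list_all_iff dvd_eq_mod_eq_0)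
qed simp

lemma tabulates_div:
  assumes "tabulates W (c * real_of_int k) A f" "divisible k A" "k \<noteq> 0"
  shows "tabulates W c (tdiv k A) f"
proof -
  have wf: "list_all wf_vec A" using assms(1) by (simp add: tabulates_def)
  show ?thesis
    unfolding tabulates_def
  proof (intro conjI allI impI wf_div wf)
    fix l i :: nat assume "l \<le> 8" "i < 8"
    then show "real_of_int (entry (tdiv k A) l i) = c * 210 ^ l * f (take l (rotate i W))"
      using entry_divisible[OF assms(2) wf, of i l] tabulatesD[OF assms(1), of l i] assms(3)
      by (simp add: entry_div[OF wf] real_of_int_div)
  qed
qed

text \<open>The end of a subword of a rotation is the beginning of a further rotation, as long as the length of the cyclic word
is not exceeded.\<close>

lemma drop_take_rotate:
  assumes "length V = 8" "j \<le> l" "l \<le> 8"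
  shows "drop j (take l V) = take (l - j) (rotate j V)"
  using assms by (cases "j = 8") (auto simp: rotate_drop_take drop_take)

lemma tabulates_mult:
  assumes W: "length W = 8" and A: "tabulates W c A f" and B: "tabulates W d B g"
  shows "tabulates W (c * d) (tmul 9 A B) (nc_mult f g)"
proof -
  have wf: "list_all wf_vec A" "list_all wf_vec B" using A B by (auto simp: tabulates_def)
  note T = tmul_correct[OF wf, of 9]
  have "real_of_int (entry (tmul 9 A B) l i) = c * d * 210 ^ l * nc_mult f g (take l (rotate i W))"
    if l: "l \<le> 8" and i: "i < 8" for l i
  proof -
    have "real_of_int (entry (tmul 9 A B) l i) =
        (\<Sum>j\<le>l. real_of_int (entry A j i) * real_of_int (entry B (l - j) ((i + j) mod 8)))"
      using T l i by simp
    also have "\<dots> = (\<Sum>j\<le>l. c * d * 210 ^ l * (f (take j (take l (rotate i W))) * g (drop j (take l (rotate i W)))))"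
    proof (rule sum.cong[OF refl])
      fix j assume "j \<in> {..l}"
      then have j: "j \<le> l" by simp
      have "drop j (take l (rotate i W)) = take (l - j) (rotate j (rotate i W))"
        by (rule drop_take_rotate) (use j l W in auto)
      also have "\<dots> = take (l - j) (rotate ((i + j) mod 8) W)"
        using W rotate_conv_mod[of "i + j" W] by (simp add: rotate_rotate add.commute)
      finally have d: "drop j (take l (rotate i W)) = take (l - j) (rotate ((i + j) mod 8) W)" .
      have "(210::real) ^ l = 210 ^ j * 210 ^ (l - j)" using j by (simp flip: power_add)
      then show "real_of_int (entry A j i) * real_of_int (entry B (l - j) ((i + j) mod 8)) =
          c * d * 210 ^ l * (f (take j (take l (rotate i W))) * g (drop j (take l (rotate i W))))"
        using tabulatesD[OF A, of j i] tabulatesD[OF B, of "l - j" "(i + j) mod 8"] j l i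
        by (simp add: d min_absorb1 mult_ac)
    qed
    finally show ?thesis using l W by (simp add: nc_mult_def sum_distrib_left min_absorb2)
  qed
  then show ?thesis using T by (simp add: tabulates_def)
qed

lemma tabulates_tab:
  assumes W: "length W = 8" and g: "\<And>w. length w \<le> 8 \<Longrightarrow> real_of_int (g w) = c * 210 ^ length w * f w"
  shows "tabulates W c (tab W g) f"
proof -
  let ?s = "\<lambda>v. if list_all (\<lambda>x. x = 0) v then [] else v"
  have s: "vnth (?s v) i = v ! i" if "length v = 8" "i < 8" for v i
    using that by (auto simp: vnth_def list_all_length)
  have e: "entry A l i = (if l < length A then vnth (A ! l) i else 0)" for A l i
    by (induction A l i rule: entry.induct) auto
  show ?thesis
    unfolding tabulates_def
  proof (intro conjI allI impI)
    show "list_all wf_vec (tab W g)" by (auto simp: tab_def list_all_iff wf_vec_def)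
    fix l i :: nat assume l: "l \<le> 8" and i: "i < 8"
    have "entry (tab W g) l i = vnth (?s (map (\<lambda>i. g (take l (rotate i W))) [0..<8])) i"
      using l by (simp add: e tab_def nth_map del: upt_Suc)
    also have "\<dots> = g (take l (rotate i W))"
      by (subst s) (use i in \<open>auto simp del: upt_Suc\<close>)
    finally show "real_of_int (entry (tab W g) l i) = c * 210 ^ l * f (take l (rotate i W))"
      using g[of "take l (rotate i W)"] l W by (simp add: min_absorb2)
  qed
qed

lemma tabulates_cong:
  assumes "length W = 8" "\<And>w. length w \<le> 8 \<Longrightarrow> f w = g w" "tabulates W c A f"
  shows "tabulates W c A g"
  using assms by (simp add: tabulates_def)

lemma tabulates_series:
  assumes S: "\<And>P p. tabulates W c P p \<Longrightarrow> tabulates W c (S P) (s p)" and P: "tabulates W c P p"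
  shows "tabulates W c (tseries S P ks) (\<lambda>w. \<Sum>k<length ks. real_of_int (ks ! k) * (s ^^ k) p w)"
  using P
proof (induction ks arbitrary: P p)
  case (Cons k ks)
  have 1: "(\<Sum>j<length (k # ks). real_of_int ((k # ks) ! j) * (s ^^ j) p w) =
      real_of_int k * p w + (\<Sum>j<length ks. real_of_int (ks ! j) * (s ^^ j) (s p) w)" for w
    by (simp add: sum.lessThan_Suc_shift funpow_swap1 del: sum.lessThan_Suc)
  show ?case
  proof (cases "ks = []")
    case True
    then show ?thesis using tabulates_scale[OF Cons.prems, of k] by simp
  next
    case False
    have "tabulates W c (if k = 0 then [] else tscale k P) (\<lambda>w. real_of_int k * p w)"
      using tabulates_scale[OF Cons.prems, of k] tabulates_Nil by simp
    from tabulates_add[OF this Cons.IH[OF S[OF Cons.prems]]] show ?thesis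
      using False by (simp only: 1 tseries.simps if_False)
  qed
qed (simp add: tabulates_Nil)

lemma tabulates_com:
  assumes "length W = 8" "tabulates W 1 F f" "tabulates W c P p"
  shows "tabulates W c (tcom F P) (nc_ad 1 (-1) f p)"
proof -
  have "tabulates W c (tmul 9 F P) (nc_mult f p)" "tabulates W c (tmul 9 P F) (nc_mult p f)"
    using tabulates_mult[OF assms] tabulates_mult[OF assms(1,3,2)] by simp_all
  from tabulates_add[OF this(1) tabulates_scale[OF this(2), of "-1"]] show ?thesis
    by (simp add: tcom_def nc_ad_def[abs_def])
qed

definition exp_table :: "bool list \<Rightarrow> bool \<Rightarrow> table" where
  "exp_table W a = tab W (\<lambda>w. if list_all (\<lambda>b. b = a) w then 210 ^ length w div fact (length w) else 0)"

definition letter_table :: "bool list \<Rightarrow> bool \<Rightarrow> table" where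
  "letter_table W a = tab W (\<lambda>w. if w = [a] then 210 else 0)"

text \<open>The negative of the unit series, to be added to \<open>e^x e^y\<close>.\<close>

definition one_table :: "bool list \<Rightarrow> table" where
  "one_table W = tab W (\<lambda>w. if w = [] then -1 else 0)"

definition q_table :: "bool list \<Rightarrow> table" where
  "q_table W = tadd (tmul 9 (exp_table W False) (exp_table W True)) (one_table W)"

text \<open>The coefficients of the logarithm times \<open>840\<close>, the least common multiple of \<open>1, \<dots>, 8\<close>. Similarly, the lists of integers
below are the coefficients of \<open>\<psi>\<close> times \<open>151200\<close>, those of \<open>F0_series_degree_8\<close> times \<open>453600\<close>, and those of the Todd
series times \<open>1209600\<close>.\<close>

definition log_table :: "table \<Rightarrow> table" where
  "log_table q = tseries (tmul 9 q) q [840, -420, 280, -210, 168, -140, 120, -105]"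

definition p_table :: "table \<Rightarrow> table \<Rightarrow> table \<Rightarrow> table" where
  "p_table z x y = tseries (tcom z) (tadd x y) [75600, 25200, 0, -840, 0, 30, 0, -1]"

text \<open>The common factor is \<open>151200 * 453600 = 68584320000\<close>; a quarter of it multiplies the Campbell-Hausdorff series.\<close>

definition F_table :: "table \<Rightarrow> table \<Rightarrow> table \<Rightarrow> table" where
  "F_table z x p = tadd (tseries (tcom x) p [50400, -25200, 13800, -4800, 1194, -232, 39, -6]) (tscale 17146080000 z)"

definition todd_table :: "table \<Rightarrow> table" where
  "todd_table y = tseries (tmul 9 y) y [-604800, 100800, 0, -1680, 0, 40, 0, -1]"

lemma tabulates_letter: "length W = 8 \<Longrightarrow> tabulates W 1 (letter_table W a) (letter a)"
  unfolding letter_table_def by (rule tabulates_tab) (auto simp: letter_def)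

lemma tabulates_exp: 
  assumes "length W = 8" shows "tabulates W 1 (exp_table W a) (nc_exp a)"
  unfolding exp_table_def
proof (rule tabulates_tab[OF assms])
  fix w :: "bool list" assume "length w \<le> 8"
  then have "length w = 0 \<or> length w = 1 \<or> length w = 2 \<or> length w = 3 \<or> length w = 4 \<or>
      length w = 5 \<or> length w = 6 \<or> length w = 7 \<or> length w = 8" by arith
  then have "real_of_int (210 ^ length w div fact (length w)) = 210 ^ length w / fact (length w)"
    by (auto simp: fact_numeral)
  then show "real_of_int (if list_all (\<lambda>b. b = a) w then 210 ^ length w div fact (length w) else 0) = 1 * 210 ^ length w * nc_exp a w"
    by (auto simp: nc_exp_def list_all_iff)
qed

lemma nc_mult_one_right [simp]: "nc_mult f nc_one w = f w"
proof -
  have "nc_mult f nc_one w = (\<Sum>i\<le>length w. if i = length w then f w else 0)"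
    unfolding nc_mult_def by (intro sum.cong refl) (auto simp: nc_one_def)
  then show ?thesis by simp
qed

definition ch_minus_one :: nc_series where
  "ch_minus_one w = nc_mult (nc_exp False) (nc_exp True) w - nc_one w"

lemma tabulates_q:
  assumes "length W = 8"
  shows "tabulates W 1 (q_table W) ch_minus_one"
proof -
  have "tabulates W 1 (one_table W) (\<lambda>w. - nc_one w)"
    unfolding one_table_def by (rule tabulates_tab[OF assms]) (auto simp: nc_one_def)
  from tabulates_add[OF tabulates_mult[OF assms tabulates_exp[OF assms, of False] tabulates_exp[OF assms, of True]], simplified, OF this]
  show ?thesis by (simp add: q_table_def ch_minus_one_def[abs_def])
qed

lemma sum_lessThan_8:
  fixes g :: "nat \<Rightarrow> real"
  shows "(\<Sum>k<8. g k) = g 0 + g 1 + g 2 + g 3 + g 4 + g 5 + g 6 + g 7"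
  by (simp add: eval_nat_numeral)

lemma sum_eight_coeffs:
  "(\<Sum>k<length [a0, a1, a2, a3, a4, a5, a6, a7]. real_of_int ([a0, a1, a2, a3, a4, a5, a6, a7] ! k) * g k) =
    real_of_int a0 * g 0 + real_of_int a1 * g 1 + real_of_int a2 * g 2 + real_of_int a3 * g 3 +
    real_of_int a4 * g 4 + real_of_int a5 * g 5 + real_of_int a6 * g 6 + real_of_int a7 * g 7"
  by (simp add: eval_nat_numeral)

lemma z_series_short:
  assumes "length w \<le> 8"
  shows "840 * z_series w = (\<Sum>k<length [840, -420, 280, -210, 168, -140, 120, -105 :: int]. real_of_int ([840, -420, 280, -210, 168, -140, 120, -105] ! k) *
     (nc_mult ch_minus_one ^^ k) ch_minus_one w)"
proof -
  have p: "(nc_mult ch_minus_one ^^ k) ch_minus_one = nc_power ch_minus_one (Suc k)" for k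
  proof -
    have "nc_mult ch_minus_one nc_one = ch_minus_one" by (rule ext) simp
    then show ?thesis by (simp only: funpow_Suc_right o_apply)
  qed
  have q0: "ch_minus_one [] = 0" by (simp add: ch_minus_one_def nc_exp_def nc_one_def)
  have "z_series w = (\<Sum>k = 1..length w. (- 1) ^ (k + 1) / real k * nc_power ch_minus_one k w)"
    by (simp add: z_series_def nc_log_def ch_minus_one_def[abs_def])
  also have "\<dots> = (\<Sum>k = 1..8. (- 1) ^ (k + 1) / real k * nc_power ch_minus_one k w)"
    by (rule sum.mono_neutral_left) (use assms q0 in \<open>auto simp: nc_power_short\<close>)
  also have "\<dots> = (\<Sum>k<8. (- 1) ^ (Suc k + 1) / real (Suc k) * nc_power ch_minus_one (Suc k) w)"
    by (rule sum.reindex_bij_witness[of _ Suc "\<lambda>k. k - 1"]) auto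
  finally show ?thesis
    unfolding p sum_eight_coeffs sum_lessThan_8 by (simp del: funpow.simps)
qed

lemma tabulates_z:
  assumes W: "length W = 8" and d: "divisible 840 (log_table (q_table W))"
  shows "tabulates W 1 (tdiv 840 (log_table (q_table W))) z_series"
proof -
  have S: "tabulates W 1 (tmul 9 (q_table W) P) (nc_mult ch_minus_one p)" if "tabulates W 1 P p" for P p
    using tabulates_mult[OF W tabulates_q[OF W] that] by simp
  have "tabulates W 1 (log_table (q_table W)) (\<lambda>w. 840 * z_series w)"
    unfolding log_table_def
    by (rule tabulates_cong[OF W _ tabulates_series[where S = "tmul 9 (q_table W)" and s = "nc_mult ch_minus_one", OF S tabulates_q[OF W]]])
      (rule z_series_short[symmetric], assumption)
  then show ?thesis
    by (intro tabulates_div d) (simp_all add: tabulates_factor)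
qed

lemma tabulates_p:
  assumes W: "length W = 8" and z: "tabulates W 1 z z_series"
  shows "tabulates W 151200 (p_table z (letter_table W False) (letter_table W True)) p_series"
proof -
  have xy: "tabulates W 1 (tadd (letter_table W False) (letter_table W True)) two_letters"
    using tabulates_add[OF tabulates_letter[OF W, of False] tabulates_letter[OF W, of True]]
    by (simp add: two_letters_def[abs_def])
  have "tabulates W 1 (p_table z (letter_table W False) (letter_table W True)) (\<lambda>w. 151200 * p_series w)"
    unfolding p_table_def
  proof (rule tabulates_cong[OF W _ tabulates_series[where S = "tcom z" and s = "nc_ad 1 (-1) z_series", OF tabulates_com[OF W z] xy]])
    fix w :: "bool list" assume w: "length w \<le> 8"
    define D where "D k = (nc_ad 1 (-1) z_series ^^ k) two_letters w" for k
    have "p_series w = (\<Sum>n\<le>length w. fps_nth psi_fps n * (nc_ad 1 (-1) z_series ^^ n) two_letters w)"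
      by (simp add: p_series_def nc_fps_def)
    also have "\<dots> = (\<Sum>n<length w. fps_nth psi_fps n * (nc_ad 1 (-1) z_series ^^ n) two_letters w)"
      by (rule sum.mono_neutral_right) (auto intro!: nc_ad_power_short)
    also have "\<dots> = (\<Sum>n<8. fps_nth psi_fps n * (nc_ad 1 (-1) z_series ^^ n) two_letters w)"
      by (rule sum.mono_neutral_left) (use w in \<open>auto intro!: nc_ad_power_short\<close>)
    finally have "p_series w = (\<Sum>n<8. fps_nth psi_fps n * D n)" by (simp only: D_def)
    then show "(\<Sum>k<length [75600, 25200, 0, - 840, 0, 30, 0, - 1 :: int]. real_of_int ([75600, 25200, 0, - 840, 0, 30, 0, - 1] ! k) *
        (nc_ad 1 (- 1) z_series ^^ k) two_letters w) = 151200 * p_series w"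
      unfolding sum_eight_coeffs sum_lessThan_8 D_def[symmetric] by (simp add: psi_values)
  qed
  then show ?thesis by (simp add: tabulates_factor)
qed

lemma F_table_row:
  assumes W: "length W = 8" and z: "tabulates W 1 z z_series" and i: "i < 8"
  shows "real_of_int (entry (F_table z (letter_table W False) (p_table z (letter_table W False) (letter_table W True))) 8 i)
    = 68584320000 * 210 ^ 8 * F0_series (rotate i W)"
proof -
  let ?ks = "[50400, -25200, 13800, -4800, 1194, -232, 39, -6] :: int list"
  have p: "tabulates W 1 (p_table z (letter_table W False) (letter_table W True)) (\<lambda>w. 151200 * p_series w)"
    using tabulates_p[OF W z] by (simp add: tabulates_factor)
  define D where "D k = adx_p k (rotate i W)" for k
  have ts: "tabulates W 1 (tseries (tcom (letter_table W False)) (p_table z (letter_table W False) (letter_table W True)) ?ks)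
      (\<lambda>w. \<Sum>k<length ?ks. real_of_int (?ks ! k) * (nc_ad 1 (-1) (letter False) ^^ k) (\<lambda>w. 151200 * p_series w) w)"
    by (rule tabulates_series[OF tabulates_com[OF W tabulates_letter[OF W]] p])
  note T = tabulatesD[OF tabulates_add[OF ts tabulates_scale[OF z, of 17146080000]], folded F_table_def]
  have tk: "take 8 (rotate i W) = rotate i W" using W by simp
  have F0: "F0_series (rotate i W) = (50400 * D 0 - 25200 * D 1 + 13800 * D 2 - 4800 * D 3
    + 1194 * D 4 - 232 * D 5 + 39 * D 6 - 6 * D 7) / 453600 + z_series (rotate i W) / 4"
    unfolding D_def by (rule F0_series_degree_8) (use W in simp)
  show ?thesis
    using T[OF order_refl i] unfolding tk sum_eight_coeffs nc_ad_power_cmult_right D_def[symmetric] F0 by simp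
qed

lemma todd_table_row:
  assumes W: "length W = 8" and y: "tabulates W 1 A y" "y [] = 0" and i: "i < 8"
  shows "real_of_int (entry (todd_table A) 8 i) = 1209600 * 210 ^ 8 * todd_series y (rotate i W)"
proof -
  let ?ks = "[-604800, 100800, 0, -1680, 0, 40, 0, -1] :: int list"
  let ?w = "rotate i W"
  have a: "nc_ad 1 0 y = nc_mult y" by (auto simp: fun_eq_iff nc_ad_def)
  have S: "tabulates W 1 (tmul 9 A P) (nc_mult y p)" if "tabulates W 1 P p" for P p
    using tabulates_mult[OF W y(1) that] by simp
  define D where "D k = (nc_mult y ^^ k) y ?w" for k
  have tk: "take 8 ?w = ?w" using W by simp
  have ts: "tabulates W 1 (todd_table A) (\<lambda>w. \<Sum>k<length ?ks. real_of_int (?ks ! k) * (nc_mult y ^^ k) y w)"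
    unfolding todd_table_def by (rule tabulates_series[OF S y(1)])
  have "real_of_int (entry (todd_table A) 8 i) = 1209600 * 210 ^ 8 * (\<Sum>k<8. fps_nth todd_fps (k + 1) * D k)"
    using tabulatesD[OF ts order_refl i]
    unfolding tk D_def[symmetric] sum_eight_coeffs sum_lessThan_8 by (simp add: todd_values todd_values(3)[unfolded numeral_2_eq_2])
  also have "(\<Sum>k<8. fps_nth todd_fps (k + 1) * D k) = todd_series y ?w"
  proof -
    have "todd_series y ?w = (\<Sum>n\<le>8. fps_nth todd_fps (Suc n) * (nc_mult y ^^ n) y ?w)"
      using W by (simp add: todd_series_def nc_fps_def a)
    also have "\<dots> = (\<Sum>n<8. fps_nth todd_fps (Suc n) * (nc_mult y ^^ n) y ?w)"
    proof (rule sum.mono_neutral_right)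
      show "\<forall>n\<in>{..8} - {..<8}. fps_nth todd_fps (Suc n) * (nc_mult y ^^ n) y ?w = 0"
        using nc_ad_power_short[of y y ?w 8 1 0] W y(2) by (auto simp: a)
    qed auto
    finally show ?thesis by (simp add: D_def)
  qed
  finally show ?thesis by simp
qed

section \<open>The word xxxyxxyy\<close>

abbreviation counter_word :: "bool list" where
  "counter_word \<equiv> [False, False, False, True, False, False, True, True]"

definition z_table :: "bool list \<Rightarrow> table" where
  "z_table W = tdiv 840 (log_table (q_table W))"

definition F_table_of :: "table \<Rightarrow> table \<Rightarrow> table \<Rightarrow> table" where
  "F_table_of z x y = F_table z x (p_table z x y)"

abbreviation F_rows :: "bool list \<Rightarrow> table" where
  "F_rows W \<equiv> F_table_of (z_table W) (letter_table W False) (letter_table W True)"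

text \<open>At the rotations ending in \<open>y\<close> the left side takes the coefficient of \<open>G^0\<close>, which in degree 8 is that of \<open>F^0\<close>
at the complementary word; \<open>B\<close> is the table for the latter.\<close>

definition mixed_sum :: "bool list \<Rightarrow> table \<Rightarrow> table \<Rightarrow> int" where
  "mixed_sum W A B = (\<Sum>i\<leftarrow>[0..<8]. if last (rotate i W) then entry B 8 i else entry A 8 i)"

lemma exact_counter_word: "divisible 840 (log_table (q_table counter_word)) \<and> divisible 840 (log_table (q_table (map Not counter_word)))"
  by code_simp

text \<open>Divided by \<open>68584320000 * 210 ^ 8\<close> this is \<open>-1/544320\<close>.\<close>

lemma left_value:
  "mixed_sum counter_word (F_rows counter_word)
     (F_rows (map Not counter_word))
   = - 126000 * 210 ^ 8"
  by code_simp

lemma right_values: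
  "mixed_sum counter_word (todd_table (z_table counter_word)) (todd_table (z_table counter_word)) = 0 \<and>
   mixed_sum counter_word (todd_table (letter_table counter_word False)) (todd_table (letter_table counter_word False)) = 0 \<and>
   mixed_sum counter_word (todd_table (letter_table counter_word True)) (todd_table (letter_table counter_word True)) = 0"
  by code_simp

lemma mixed_sum_eq: "mixed_sum W A B = (\<Sum>i<8. if last (rotate i W) then entry B 8 i else entry A 8 i)"
  unfolding mixed_sum_def by (subst sum_list_distinct_conv_sum_set) (simp_all add: lessThan_atLeast0)

lemma tabulates_z_counter_word:
  "tabulates counter_word 1 (z_table counter_word) z_series" "tabulates (map Not counter_word) 1 (z_table (map Not counter_word)) z_series"
  unfolding z_table_def by (rule tabulates_z; use exact_counter_word in simp)+

lemma left_sum: "(\<Sum>i<8. left_coeff (rotate (Suc i) counter_word)) = - 1 / 544320"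
proof -
  let ?N = "68584320000 * 210 ^ 8 :: real"
  define h where "h i = left_coeff (rotate i counter_word)" for i
  \<comment> \<open>the criterion sums over the rotations starting with the second letter; the sum is cyclic\<close>
  have "rotate 8 counter_word = counter_word" by (rule rotate_id) simp
  then have "h 8 = h 0" by (simp add: h_def)
  moreover have "(\<Sum>i<8. h (Suc i)) + h 0 = (\<Sum>i<8. h i) + h 8"
    using sum.lessThan_Suc_shift[of h 8] sum.lessThan_Suc[of h 8] by linarith
  ultimately have "(\<Sum>i<8. left_coeff (rotate (Suc i) counter_word)) = (\<Sum>i<8. left_coeff (rotate i counter_word))"
    unfolding h_def by linarith
  moreover have "?N * (\<Sum>i<8. left_coeff (rotate i counter_word)) = real_of_int (mixed_sum counter_word
      (F_rows counter_word)
      (F_rows (map Not counter_word)))"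
    unfolding mixed_sum_eq of_int_sum sum_distrib_left
  proof (rule sum.cong[OF refl])
    fix i :: nat assume "i \<in> {..<8}"
    then have i: "i < 8" by simp
    have "left_coeff (rotate i counter_word) = (if last (rotate i counter_word) then F0_series (rotate i (map Not counter_word)) else F0_series (rotate i counter_word))"
      by (simp only: left_coeff_def G_series_of_def rotate_map length_rotate) simp
    then show "?N * left_coeff (rotate i counter_word) = real_of_int (if last (rotate i counter_word)
        then entry (F_rows (map Not counter_word)) 8 i
        else entry (F_rows counter_word) 8 i)"
      using F_table_row[OF _ tabulates_z_counter_word(1) i] F_table_row[OF _ tabulates_z_counter_word(2) i]
      by (simp only: F_table_of_def split: if_split) simp
  qed
  ultimately show ?thesis unfolding left_value by simp
qed

lemma right_sum: "(\<Sum>i<8. 1 / 2 * right_coeff (rotate i counter_word)) = 0"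
proof -
  have todd: "(\<Sum>i<8. todd_series y (rotate i counter_word)) = 0"
    if "tabulates counter_word 1 A y" "y [] = 0" "mixed_sum counter_word (todd_table A) (todd_table A) = 0" for A y
  proof -
    have "1209600 * 210 ^ 8 * (\<Sum>i<8. todd_series y (rotate i counter_word)) = real_of_int (mixed_sum counter_word (todd_table A) (todd_table A))"
      unfolding mixed_sum_eq of_int_sum sum_distrib_left
      by (rule sum.cong[OF refl]) (use todd_table_row[OF _ that(1,2)] in simp)
    then show ?thesis unfolding that(3) by simp
  qed
  have "(\<Sum>i<8. right_coeff (rotate i counter_word)) = 0"
    unfolding right_coeff_def sum_subtractf sum.distrib
    using todd[OF tabulates_letter[of counter_word False]] todd[OF tabulates_letter[of counter_word True]] todd[OF tabulates_z_counter_word(1)] right_values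
    by simp
  then show ?thesis by (simp flip: sum_distrib_left sum_divide_distrib)
qed

theorem mainTheorem1:
  shows "\<exists>(L :: (nat \<Rightarrow>\<^sub>C real) set) br X Y.
    fd_lie_algebra L br \<and> X \<in> L \<and> Y \<in> L \<and>
    hom_component 8 (kv_trace_left L br (kv_F0 br) (kv_G0 br)) X Y
      \<noteq> hom_component 8 (kv_trace_right L br) X Y"
  by (rule cyclic_word_criterion[of counter_word]) (simp_all only: left_sum right_sum, simp_all)

end
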